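(* Let $R,S\in\mathscr{A}$ be two symmetries with $\tau(R)=\alpha$, $\tau(S)=\beta$, let $(U_t)_{t\ge 0}$ be a free unitary Brownian motion freely independent from $\{R,S\}$, let $\nu_t$ be the spectral distribution on the unit circle $\mathbb{T}$ of the unitary $RU_tSU_t^*$, and let $$H(t,z)=\int_{\mathbb{T}}\frac{\zeta+z}{\zeta-z}\,d\nu_t(\zeta)=1+2\sum_{n\ge1}\tau[(RU_tSU_t^* )^n]z^n,\qquad |z|<1,$$ be its Herglotz transform. Then $H$ satisfies, for $t\ge 0$ and $|z|<1$, the partial differential equation $$\partial_tH+\frac z2\,\partial_z (H^2)=\frac{2z(\alpha z^2+2\beta z+\alpha)(\beta z^2+2\alpha z+\beta)}{(1-z^2)^3}.$$
   Context: $(\mathscr{A},\tau)$ is a $W^*$-probability space (von Neumann algebra with faithful normal tracial state $\tau$). A symmetry is a self-adjoint unitary. A free unitary Brownian motion $(U_t)_{t\ge0}$ in $(\mathscr{A},\tau)$ with $U_0=\mathbf 1$ is the solution of the free stochastic differential equation $dU_t=iU_t\,dB_t-\tfrac12U_t\,dt$, where $(B_t)$ is a free additive (semicircular) Brownian motion with $\tau(B_t^2)=t$. *)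

theory Defs
  imports "HOL-Analysis.Analysis"
begin

subsection \<open>Complex Hilbert spaces and their bounded operators\<close>

class complex_vector = real_vector +
  fixes scaleC :: "complex \<Rightarrow> 'a \<Rightarrow> 'a"  (infixr \<open>*\<^sub>C\<close> 75)
  assumes scaleC_add_right: "c *\<^sub>C (x + y) = c *\<^sub>C x + c *\<^sub>C y"
    and scaleC_add_left: "(c + d) *\<^sub>C x = c *\<^sub>C x + d *\<^sub>C x"
    and scaleC_scaleC: "c *\<^sub>C d *\<^sub>C x = (c * d) *\<^sub>C x"
    and scaleC_of_real: "complex_of_real r *\<^sub>C x = r *\<^sub>R x"

text \<open>
  The inner product is linear in its first argument. The axiom \<open>norm_eq_sqrt_cinner\<close> makes it
  positive definite, because \<open>sqrt\<close> is injective and negative on negative reals.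
  The class \<open>perfect_space\<close> only excludes the zero space, so that the operators form a ring
  with \<open>1 \<noteq> 0\<close>; on the zero space there are no states.
\<close>

class complex_hilbert_space = complex_vector + banach + perfect_space +
  fixes cinner :: "'a \<Rightarrow> 'a \<Rightarrow> complex"
  assumes cinner_commute: "cinner x y = cnj (cinner y x)"
    and cinner_add_left: "cinner (x + y) z = cinner x z + cinner y z"
    and cinner_scaleC_left: "cinner (c *\<^sub>C x) y = c * cinner x y"
    and norm_eq_sqrt_cinner: "norm x = sqrt (Re (cinner x x))"

lemma scaleC_scaleR_commute: "c *\<^sub>C r *\<^sub>R x = r *\<^sub>R c *\<^sub>C x"
  for x :: "'a::complex_vector"
  by (simp add: scaleC_of_real [symmetric] scaleC_scaleC mult.commute)

lemma scaleC_zero_right: "c *\<^sub>C 0 = (0::'a::complex_vector)"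
  using scaleC_add_right [of c 0 "0::'a"] by simp

lemma scaleC_minus_right: "c *\<^sub>C (- x) = - (c *\<^sub>C x)" for x :: "'a::complex_vector"
  using scaleC_scaleR_commute [of c "-1" x] by simp

lemma norm_scaleC: "norm (c *\<^sub>C x) = cmod c * norm x" for x :: "'a::complex_hilbert_space"
proof -
  have "cinner (c *\<^sub>C x) (c *\<^sub>C x) = c * cnj (c * cinner x x)"
    by (metis cinner_commute cinner_scaleC_left)
  also have "\<dots> = (c * cnj c) * cinner x x"
    by (metis cinner_commute complex_cnj_mult mult.assoc)
  also have "\<dots> = complex_of_real ((cmod c)\<^sup>2) * cinner x x"
    by (metis complex_norm_square)
  finally show ?thesis
    by (simp add: norm_eq_sqrt_cinner real_sqrt_mult)
qed

text \<open>The space \<open>B(H)\<close>, normed by the operator norm.\<close>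

typedef (overloaded) 'h bop =
    "{a :: 'h::complex_hilbert_space \<Rightarrow>\<^sub>L 'h. \<forall>c x. blinfun_apply a (c *\<^sub>C x) = c *\<^sub>C blinfun_apply a x}"
  morphisms blinfun_of_bop Abs_bop
  by (rule exI [of _ 0]) (simp add: scaleC_zero_right)

setup_lifting type_definition_bop

lift_definition bop_apply :: "'h::complex_hilbert_space bop \<Rightarrow> 'h \<Rightarrow> 'h"
  is blinfun_apply .

instantiation bop :: (complex_hilbert_space) real_vector
begin

lift_definition zero_bop :: "'a bop" is 0
  by (simp add: scaleC_zero_right)
lift_definition plus_bop :: "'a bop \<Rightarrow> 'a bop \<Rightarrow> 'a bop" is "(+)"
  by (simp add: blinfun.add_left scaleC_add_right)
lift_definition uminus_bop :: "'a bop \<Rightarrow> 'a bop" is uminus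
  by (simp add: blinfun.minus_left scaleC_minus_right)
lift_definition minus_bop :: "'a bop \<Rightarrow> 'a bop \<Rightarrow> 'a bop" is "(-)"
  by (metis (no_types, lifting) add_uminus_conv_diff blinfun.add_left blinfun.minus_left
      scaleC_add_right scaleC_minus_right)
lift_definition scaleR_bop :: "real \<Rightarrow> 'a bop \<Rightarrow> 'a bop" is "(*\<^sub>R)"
  by (simp add: blinfun.scaleR_left scaleC_scaleR_commute)

instance
  by (standard; transfer) (simp_all add: scaleR_add_right scaleR_add_left)

end

instantiation bop :: (complex_hilbert_space) real_normed_algebra_1
begin

lift_definition one_bop :: "'a bop" is id_blinfun
  by simp
lift_definition times_bop :: "'a bop \<Rightarrow> 'a bop \<Rightarrow> 'a bop" is "(o\<^sub>L)"
  by simp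
lift_definition norm_bop :: "'a bop \<Rightarrow> real" is norm .
definition dist_bop :: "'a bop \<Rightarrow> 'a bop \<Rightarrow> real"
  where "dist_bop a b = norm (a - b)"
definition sgn_bop :: "'a bop \<Rightarrow> 'a bop"
  where "sgn_bop a = a /\<^sub>R norm a"
definition uniformity_bop :: "('a bop \<times> 'a bop) filter"
  where "uniformity_bop = (INF e\<in>{0<..}. principal {(a, b). dist a b < e})"
definition open_bop :: "'a bop set \<Rightarrow> bool"
  where "open_bop S = (\<forall>a\<in>S. \<forall>\<^sub>F (a', b) in uniformity. a' = a \<longrightarrow> b \<in> S)"

instance
proof
  fix a b c :: "'a bop" and r :: real
  show "dist a b = norm (a - b)" by (rule dist_bop_def)
  show "sgn a = a /\<^sub>R norm a" by (rule sgn_bop_def)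
  show "(uniformity :: ('a bop \<times> 'a bop) filter) = (INF e\<in>{0<..}. principal {(a, b). dist a b < e})"
    by (rule uniformity_bop_def)
  show "open S = (\<forall>a\<in>S. \<forall>\<^sub>F (a', b) in uniformity. a' = a \<longrightarrow> b \<in> S)" for S :: "'a bop set"
    by (rule open_bop_def)
  show "a * b * c = a * (b * c)" by transfer (simp add: blinfun_eqI)
  show "(a + b) * c = a * c + b * c" by transfer (simp add: blinfun_eqI blinfun.add_left)
  show "a * (b + c) = a * b + a * c"
    by transfer (simp add: blinfun_eqI blinfun.add_left blinfun.add_right)
  show "r *\<^sub>R a * b = r *\<^sub>R (a * b)" by transfer (simp add: blinfun_eqI blinfun.scaleR_left)
  show "a * r *\<^sub>R b = r *\<^sub>R (a * b)"
    by transfer (simp add: blinfun_eqI blinfun.scaleR_left blinfun.scaleR_right)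
  show "1 * a = a" by transfer (simp add: blinfun_eqI)
  show "a * 1 = a" by transfer (simp add: blinfun_eqI)
  show "norm a = 0 \<longleftrightarrow> a = 0" by transfer simp
  show "norm (a + b) \<le> norm a + norm b" by transfer (rule norm_triangle_ineq)
  show "norm (r *\<^sub>R a) = \<bar>r\<bar> * norm a" by transfer simp
  show "norm (a * b) \<le> norm a * norm b" by transfer (rule norm_blinfun_compose)
  show norm_one: "norm (1::'a bop) = 1" by transfer simp
  have "norm (0::'a bop) = 0" by transfer simp
  with norm_one show "(0::'a bop) \<noteq> 1" by force
qed

end

lemma bounded_linear_scaleC_blinfun: "bounded_linear (\<lambda>x. c *\<^sub>C blinfun_apply a x)"
  for a :: "'a::complex_hilbert_space \<Rightarrow>\<^sub>L 'a"
proof (rule bounded_linear_intro [where K = "cmod c * norm a"])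
  show "norm (c *\<^sub>C blinfun_apply a x) \<le> norm x * (cmod c * norm a)" for x
    using mult_left_mono [OF norm_blinfun [of a x] norm_ge_zero [of c]]
    by (simp add: norm_scaleC mult_ac)
qed (simp_all add: blinfun.add_right blinfun.scaleR_right scaleC_add_right scaleC_scaleR_commute)

instantiation bop :: (complex_hilbert_space) complex_vector
begin

lift_definition scaleC_bop :: "complex \<Rightarrow> 'a bop \<Rightarrow> 'a bop"
  is "\<lambda>c a. Blinfun (\<lambda>x. c *\<^sub>C blinfun_apply a x)"
  by (simp add: bounded_linear_Blinfun_apply [OF bounded_linear_scaleC_blinfun]
      scaleC_scaleC mult.commute)

lemma bop_apply_scaleC: "bop_apply (c *\<^sub>C a) x = c *\<^sub>C bop_apply a x"
  by transfer (simp add: bounded_linear_Blinfun_apply [OF bounded_linear_scaleC_blinfun])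

instance
proof
  fix a b :: "'a bop" and c d :: complex and r :: real
  have eqI: "a = b" if "\<And>x. bop_apply a x = bop_apply b x" for a b :: "'a bop"
    using that by transfer (rule blinfun_eqI)
  have add: "bop_apply (a + b) x = bop_apply a x + bop_apply b x" for a b :: "'a bop" and x
    by transfer (simp add: blinfun.add_left)
  show "c *\<^sub>C (a + b) = c *\<^sub>C a + c *\<^sub>C b"
    by (rule eqI) (simp add: bop_apply_scaleC add scaleC_add_right)
  show "(c + d) *\<^sub>C a = c *\<^sub>C a + d *\<^sub>C a"
    by (rule eqI) (simp add: bop_apply_scaleC add scaleC_add_left)
  show "c *\<^sub>C d *\<^sub>C a = (c * d) *\<^sub>C a"
    by (rule eqI) (simp add: bop_apply_scaleC scaleC_scaleC)
  have "bop_apply (r *\<^sub>R a) x = r *\<^sub>R bop_apply a x" for x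
    by transfer (simp add: blinfun.scaleR_left)
  then show "complex_of_real r *\<^sub>C a = r *\<^sub>R a"
    by (intro eqI) (simp add: bop_apply_scaleC scaleC_of_real)
qed

end

text \<open>The adjoint exists by the Riesz representation theorem, and is unique.\<close>

definition adj :: "'h::complex_hilbert_space bop \<Rightarrow> 'h bop"
  where "adj a = (THE b. \<forall>x y. cinner (bop_apply a x) y = cinner x (bop_apply b y))"

definition selfadjoint :: "'h::complex_hilbert_space bop \<Rightarrow> bool"
  where "selfadjoint a \<longleftrightarrow> adj a = a"

definition unitary :: "'h::complex_hilbert_space bop \<Rightarrow> bool"
  where "unitary a \<longleftrightarrow> adj a * a = 1 \<and> a * adj a = 1"

definition symmetry :: "'h::complex_hilbert_space bop \<Rightarrow> bool"
  where "symmetry a \<longleftrightarrow> selfadjoint a \<and> unitary a"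

text \<open>The order is meant for self-adjoint operators, whose quadratic forms are real.\<close>

definition bop_le :: "'h::complex_hilbert_space bop \<Rightarrow> 'h bop \<Rightarrow> bool"
  where "bop_le a b \<longleftrightarrow> (\<forall>x. Re (cinner (bop_apply a x) x) \<le> Re (cinner (bop_apply b x) x))"


subsection \<open>\<open>W\<^sup>*\<close>-probability spaces\<close>

definition commutant :: "'h::complex_hilbert_space bop set \<Rightarrow> 'h bop set"
  where "commutant A = {b. \<forall>a\<in>A. a * b = b * a}"

text \<open>A commutant is a unital subalgebra, so this describes unital star-subalgebras of \<open>B(H)\<close>.\<close>

definition von_neumann_algebra :: "'h::complex_hilbert_space bop set \<Rightarrow> bool"
  where "von_neumann_algebra A \<longleftrightarrow> (\<forall>a\<in>A. adj a \<in> A) \<and> commutant (commutant A) = A"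

text \<open>
  Normality is preservation of suprema of bounded increasing nets of self-adjoint elements,
  the nets being given by upward directed sets \<open>D\<close>.
\<close>

locale wstar_probability_space =
  fixes A :: "'h::complex_hilbert_space bop set" and \<tau> :: "'h bop \<Rightarrow> complex"
  assumes von_neumann: "von_neumann_algebra A"
    and add: "\<lbrakk>a \<in> A; b \<in> A\<rbrakk> \<Longrightarrow> \<tau> (a + b) = \<tau> a + \<tau> b"
    and scaleC: "a \<in> A \<Longrightarrow> \<tau> (c *\<^sub>C a) = c * \<tau> a"
    and positive: "a \<in> A \<Longrightarrow> \<tau> (adj a * a) \<in> \<real>\<^sub>\<ge>\<^sub>0"
    and unital: "\<tau> 1 = 1"
    and tracial: "\<lbrakk>a \<in> A; b \<in> A\<rbrakk> \<Longrightarrow> \<tau> (a * b) = \<tau> (b * a)"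
    and faithful: "\<lbrakk>a \<in> A; \<tau> (adj a * a) = 0\<rbrakk> \<Longrightarrow> a = 0"
    and normal: "\<lbrakk>D \<subseteq> A; D \<noteq> {}; \<forall>a\<in>D. selfadjoint a;
        \<forall>a\<in>D. \<forall>b\<in>D. \<exists>c\<in>D. bop_le a c \<and> bop_le b c;
        s \<in> A; selfadjoint s; \<forall>a\<in>D. bop_le a s;
        \<forall>u\<in>A. selfadjoint u \<longrightarrow> (\<forall>a\<in>D. bop_le a u) \<longrightarrow> bop_le s u\<rbrakk>
      \<Longrightarrow> Re (\<tau> s) = (SUP a\<in>D. Re (\<tau> a))"

definition norm2 :: "('h::complex_hilbert_space bop \<Rightarrow> complex) \<Rightarrow> 'h bop \<Rightarrow> real"
  where "norm2 \<tau> a = sqrt (Re (\<tau> (adj a * a)))"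

inductive_set star_algebra_generated ::
    "'h::complex_hilbert_space bop set \<Rightarrow> 'h bop set" for X where
  base: "a \<in> X \<Longrightarrow> a \<in> star_algebra_generated X"
| one: "1 \<in> star_algebra_generated X"
| add: "\<lbrakk>a \<in> star_algebra_generated X; b \<in> star_algebra_generated X\<rbrakk>
    \<Longrightarrow> a + b \<in> star_algebra_generated X"
| scaleC: "a \<in> star_algebra_generated X \<Longrightarrow> c *\<^sub>C a \<in> star_algebra_generated X"
| mult: "\<lbrakk>a \<in> star_algebra_generated X; b \<in> star_algebra_generated X\<rbrakk>
    \<Longrightarrow> a * b \<in> star_algebra_generated X"
| adj: "a \<in> star_algebra_generated X \<Longrightarrow> adj a \<in> star_algebra_generated X"

text \<open>
  Two sets are free if the unital star-algebras they generate are: alternating products of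
  centred elements are centred. In a word the flag says which algebra a letter is taken from.
\<close>

definition freely_independent ::
    "('h::complex_hilbert_space bop \<Rightarrow> complex) \<Rightarrow> 'h bop set \<Rightarrow> 'h bop set \<Rightarrow> bool"
  where "freely_independent \<tau> X Y \<longleftrightarrow>
    (\<forall>w :: (bool \<times> 'h bop) list. w \<noteq> [] \<longrightarrow> distinct_adj (map fst w) \<longrightarrow>
      (\<forall>(b, a) \<in> set w. a \<in> star_algebra_generated (if b then X else Y) \<and> \<tau> a = 0) \<longrightarrow>
      \<tau> (prod_list (map snd w)) = 0)"


subsection \<open>Distributions\<close>

text \<open>
  The spectral distribution of a normal element: the compactly supported Borel probability measure
  with the same star-moments.
\<close>

definition spectral_distribution ::
    "('h::complex_hilbert_space bop \<Rightarrow> complex) \<Rightarrow> 'h bop \<Rightarrow> complex measure \<Rightarrow> bool"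
  where "spectral_distribution \<tau> a \<nu> \<longleftrightarrow>
    sets \<nu> = sets borel \<and> emeasure \<nu> UNIV = 1 \<and>
    (\<exists>K. compact K \<and> emeasure \<nu> (- K) = 0) \<and>
    (\<forall>k l. (LINT \<zeta>|\<nu>. \<zeta> ^ k * cnj \<zeta> ^ l) = \<tau> (a ^ k * adj a ^ l))"

text \<open>The centred semicircle law of variance \<open>v > 0\<close> (radius \<open>2 sqrt v\<close>).\<close>

definition semicircular ::
    "('h::complex_hilbert_space bop \<Rightarrow> complex) \<Rightarrow> real \<Rightarrow> 'h bop \<Rightarrow> bool"
  where "semicircular \<tau> v x \<longleftrightarrow> selfadjoint x \<and>
    (\<forall>n. \<tau> (x ^ n) = complex_of_real
      (integral {- 2 * sqrt v..2 * sqrt v} (\<lambda>u. u ^ n * (sqrt (4 * v - u\<^sup>2) / (2 * pi * v)))))"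

definition herglotz_transform :: "complex measure \<Rightarrow> complex \<Rightarrow> complex"
  where "herglotz_transform \<nu> z = (LINT \<zeta>|\<nu>. (\<zeta> + z) / (\<zeta> - z))"


subsection \<open>Free Brownian motions and the free stochastic integral\<close>

definition vn_filtration ::
    "'h::complex_hilbert_space bop set \<Rightarrow> (real \<Rightarrow> 'h bop set) \<Rightarrow> bool"
  where "vn_filtration A \<F> \<longleftrightarrow>
    (\<forall>t\<ge>0. von_neumann_algebra (\<F> t) \<and> \<F> t \<subseteq> A) \<and> (\<forall>s t. 0 \<le> s \<longrightarrow> s \<le> t \<longrightarrow> \<F> s \<subseteq> \<F> t)"

definition free_brownian_motion ::
    "('h::complex_hilbert_space bop \<Rightarrow> complex) \<Rightarrow> (real \<Rightarrow> 'h bop set) \<Rightarrow> (real \<Rightarrow> 'h bop) \<Rightarrow> bool"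
  where "free_brownian_motion \<tau> \<F> B \<longleftrightarrow>
    B 0 = 0 \<and> (\<forall>t\<ge>0. B t \<in> \<F> t \<and> selfadjoint (B t)) \<and>
    (\<forall>s t. 0 \<le> s \<longrightarrow> s < t \<longrightarrow>
      semicircular \<tau> (t - s) (B t - B s) \<and> freely_independent \<tau> {B t - B s} (\<F> s))"

text \<open>
  A simple adapted process on \<open>[0, t]\<close> is given by a partition \<open>p 0 = 0 < \<dots> < p n = t\<close> and values
  \<open>X i \<in> \<F> (p i)\<close> on \<open>[p i, p (i + 1))\<close>.
\<close>

definition simple_adapted ::
    "(real \<Rightarrow> 'h::complex_hilbert_space bop set) \<Rightarrow> real \<Rightarrow> nat \<Rightarrow> (nat \<Rightarrow> real) \<Rightarrow> (nat \<Rightarrow> 'h bop) \<Rightarrow> bool"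
  where "simple_adapted \<F> t n p X \<longleftrightarrow>
    p 0 = 0 \<and> p n = t \<and> (\<forall>i<n. p i < p (Suc i) \<and> X i \<in> \<F> (p i))"

definition simple_process ::
    "nat \<Rightarrow> (nat \<Rightarrow> real) \<Rightarrow> (nat \<Rightarrow> 'h::complex_hilbert_space bop) \<Rightarrow> real \<Rightarrow> 'h bop"
  where "simple_process n p X s = (\<Sum>i<n. indicat_real {p i..<p (Suc i)} s *\<^sub>R X i)"

definition simple_integral ::
    "(real \<Rightarrow> 'h::complex_hilbert_space bop) \<Rightarrow> nat \<Rightarrow> (nat \<Rightarrow> real) \<Rightarrow> (nat \<Rightarrow> 'h bop) \<Rightarrow> 'h bop"
  where "simple_integral B n p X = (\<Sum>i<n. X i * (B (p (Suc i)) - B (p i)))"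

text \<open>
  \<open>I = \<integral>\<^sub>0\<^sup>t X\<^sub>s dB\<^sub>s\<close>, obtained as usual by extending the Ito isometry from simple adapted
  processes to their closure in \<open>L\<^sup>2([0, t]; L\<^sup>2(\<tau>))\<close>.
\<close>

definition has_free_ito_integral ::
    "('h::complex_hilbert_space bop \<Rightarrow> complex) \<Rightarrow> (real \<Rightarrow> 'h bop set) \<Rightarrow> (real \<Rightarrow> 'h bop) \<Rightarrow>
     (real \<Rightarrow> 'h bop) \<Rightarrow> real \<Rightarrow> 'h bop \<Rightarrow> bool"
  where "has_free_ito_integral \<tau> \<F> B X t I \<longleftrightarrow>
    (\<exists>(n :: nat \<Rightarrow> nat) p Y e.
      (\<forall>k. simple_adapted \<F> t (n k) (p k) (Y k)) \<and>
      (\<forall>k. ((\<lambda>s. (norm2 \<tau> (X s - simple_process (n k) (p k) (Y k) s))\<^sup>2) has_integral e k) {0..t}) \<and>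
      e \<longlonglongrightarrow> 0 \<and>
      (\<lambda>k. norm2 \<tau> (I - simple_integral B (n k) (p k) (Y k))) \<longlonglongrightarrow> 0)"

text \<open>
  Unitary adapted solutions, started at \<open>1\<close>, of \<open>dU = i U dB - (1/2) U dt\<close>,
  that is of \<open>U\<^sub>t = 1 + \<integral>\<^sub>0\<^sup>t i U\<^sub>s dB\<^sub>s - (1/2) \<integral>\<^sub>0\<^sup>t U\<^sub>s ds\<close>.
\<close>

definition free_unitary_brownian_motion ::
    "'h::complex_hilbert_space bop set \<Rightarrow> ('h bop \<Rightarrow> complex) \<Rightarrow> (real \<Rightarrow> 'h bop) \<Rightarrow> bool"
  where "free_unitary_brownian_motion A \<tau> U \<longleftrightarrow>
    U 0 = 1 \<and> (\<forall>t\<ge>0. unitary (U t)) \<and>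
    (\<exists>\<F> B. vn_filtration A \<F> \<and> free_brownian_motion \<tau> \<F> B \<and>
      (\<forall>t\<ge>0. U t \<in> \<F> t \<and>
        (\<exists>I J. I \<in> A \<and> has_free_ito_integral \<tau> \<F> B (\<lambda>s. \<i> *\<^sub>C U s) t I \<and>
          (U has_integral J) {0..t} \<and>
          U t = 1 + I - (1 / 2) *\<^sub>R J)))"

end

theory Submission
  imports Defs
begin

text \<open>
  The moments of \<open>R U\<^sub>t S U\<^sub>t\<^sup>*\<close> satisfy a closed system of ordinary differential equations, and the
  partial differential equation is this system written for the generating function.

  Write \<open>U\<^sub>s\<^sub>+\<^sub>h = U\<^sub>s W\<close>. By traciality the \<open>n\<close>-th moment at time \<open>s + h\<close> is the trace of
  \<open>(R' W S W\<^sup>*)\<^sup>n\<close> with \<open>R' = U\<^sub>s\<^sup>* R U\<^sub>s\<close>. The stochastic equation and the freeness of the increments of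
  the Brownian motion from the past give linear differential equations for \<open>\<tau>(c W)\<close>, \<open>\<tau>(c W d W\<^sup>*)\<close>
  and \<open>\<tau>(c W d W)\<close> with \<open>c\<close>, \<open>d\<close> in the past algebra. Their solutions say that \<open>W\<close> and \<open>W\<^sup>*\<close> behave, in
  words with at most two of these letters, as if free from the past. Since \<open>U\<close> is free from \<open>R\<close>, \<open>S\<close>, the
  same formulas hold with \<open>c\<close>, \<open>d\<close> in the algebra of the past of \<open>U\<close> and \<open>R\<close>, \<open>S\<close>. Now expand
  \<open>(R' W S W\<^sup>*)\<^sup>n\<close> in powers of \<open>W - 1\<close>: the terms of order at most two are explicit, and the remaining
  ones are \<open>O(h\<^sup>3\<^sup>/\<^sup>2)\<close>, because \<open>W - 1\<close> is \<open>O(h\<^sup>1\<^sup>/\<^sup>2)\<close> both in \<open>L\<^sup>2\<close> and in \<open>L\<^sup>4\<close>. The traces of odd alternating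
  words in \<open>R'\<close>, \<open>S\<close> collapse to \<open>\<tau>(R)\<close> or \<open>\<tau>(S)\<close> by conjugation and yield the right-hand side.
\<close>

text \<open>Two obstacles shape the argument. The filtration \<open>\<F>\<close> is not assumed free
  from \<open>R\<close> and \<open>S\<close>; only the process \<open>U\<close> is. Covariances of
  \<open>W\<close> are therefore computed with coefficients in \<open>\<F> s\<close>, and pass to
  coefficients containing \<open>R\<close>, \<open>S\<close> only through the intersection of
  \<open>\<F> s\<close> with the algebra generated by \<open>U\<close>. Moreover, a stochastic
  integral defined by L2 limits controls \<open>W - 1\<close> only in L2, while a word with three
  increments calls for an L4 bound. This bound comes from unitarity:
  \<open>adj (W - 1) * (W - 1)\<close> is \<open>2 - W - adj W\<close>, and its L2 norm is a
  combination of the traces of \<open>W\<close> and \<open>W * W\<close>, which are known exactly.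

  The shape of the limit equation can be read off from \<open>W - 1\<close> being close to
  \<open>i\<close> times the increment of \<open>B\<close>, with mean close to
  \<open>- h / 2\<close>. The means of the \<open>2 * n\<close> letters give \<open>-n\<close> times
  the \<open>n\<close>-th moment; pairs of equal letters have the sign \<open>i * i = -1\<close> and
  give the quadratic term; pairs of a letter and its adjoint have the sign
  \<open>i * (-i) = 1\<close> and give the source.\<close>

lemma cmod_le_of_quadratic_nonneg:
  assumes q: "\<And>c. 0 \<le> p + 2 * Re (c * k) + (cmod c)\<^sup>2 * r"
  shows "(cmod k)\<^sup>2 \<le> p * r"
proof -
  \<comment> \<open>The discriminant argument for a complex coefficient:
    \<open>c = - x * cnj k\<close> with real \<open>x\<close> has the phase that makes
    \<open>c * k\<close> real and leaves a real quadratic polynomial in \<open>x\<close>.\<close>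
  have eq: "0 \<le> p - 2 * x * (cmod k)\<^sup>2 + x\<^sup>2 * (cmod k)\<^sup>2 * r" for x :: real
  proof -
    have "Re (- (x * cnj k) * k) = - (x * (cmod k)\<^sup>2)"
      unfolding cmod_power2 by (simp add: algebra_simps power2_eq_square)
    with q [of "- (x * cnj k)"] show ?thesis
      by (simp add: norm_mult power_mult_distrib)
  qed
  have p: "0 \<le> p" using q [of 0] by simp
  have r: "0 \<le> r" 
  proof (rule ccontr)
    assume r: "\<not> 0 \<le> r"
    \<comment> \<open>This makes \<open>p + x\<^sup>2 * r\<close> equal to -1, so the inequalities
      for \<open>c = x\<close> and \<open>c = - x\<close> add up to 0 \<le> -2.\<close>
    define x where "x = sqrt ((p + 1) / - r)"
    have "0 \<le> p + x\<^sup>2 * r + 2 * x * Re k" and "0 \<le> p + x\<^sup>2 * r - 2 * x * Re k"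
      using q [of "of_real x"] q [of "- of_real x"] by (simp_all add: norm_power)
    moreover have "x\<^sup>2 * r = - (p + 1)"
      using r p by (simp add: x_def field_simps)
    ultimately show False by linarith
  qed
  show ?thesis
  proof (cases "r = 0")
    case True
    have "0 \<le> p - 2 * (p + 1) / (cmod k)\<^sup>2 * (cmod k)\<^sup>2"
      using eq [of "(p + 1) / (cmod k)\<^sup>2"] True by simp
    then have "cmod k = 0" using p by (cases "cmod k = 0") auto
    with True show ?thesis by simp
  next
    case False
    with r have "r > 0" by simp
    then show ?thesis
      using eq [of "1 / r"] by (simp add: field_simps power2_eq_square)
  qed
qed

subsection \<open>Hilbert spaces and adjoints\<close>

lemma scaleC_one: "1 *\<^sub>C x = x" and scaleC_minus_left: "(- c) *\<^sub>C x = - (c *\<^sub>C x)"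
  for x :: "'a::complex_vector"
proof -
  show "1 *\<^sub>C x = x" using scaleC_of_real [of 1 x] by simp
  show "(- c) *\<^sub>C x = - (c *\<^sub>C x)"
    using scaleC_of_real [of 0 x] scaleC_add_left [of c "- c" x] by (simp add: eq_neg_iff_add_eq_0 add.commute)
qed

context
  fixes x y z :: "'a::complex_hilbert_space"
begin

lemma cinner_add_right: "cinner x (y + z) = cinner x y + cinner x z"
  by (metis cinner_add_left cinner_commute complex_cnj_add)

lemma cinner_scaleC_right: "cinner x (c *\<^sub>C y) = cnj c * cinner x y"
  by (metis cinner_commute cinner_scaleC_left complex_cnj_mult)

lemma cinner_minus_left: "cinner (- x) y = - cinner x y"
  using cinner_scaleC_left [of "-1" x y] scaleC_minus_left [of 1 x] by (simp add: scaleC_one)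

lemma cinner_minus_right: "cinner x (- y) = - cinner x y"
  using cinner_scaleC_right [of "-1"] scaleC_minus_left [of 1 y] by (simp add: scaleC_one)

end

lemma cinner_diff_right: "cinner x (y - z) = cinner x y - cinner x z"
  for x :: "'a::complex_hilbert_space"
  using cinner_add_right [of x y "- z"] by (simp add: cinner_minus_right)

lemma cinner_diff_left: "cinner (x - y) z = cinner x z - cinner y z"
  for x :: "'a::complex_hilbert_space"
  using cinner_add_left [of x "- y" z] by (simp add: cinner_minus_left)

lemma cinner_self: "cinner x x = complex_of_real ((norm x)\<^sup>2)"
  for x :: "'a::complex_hilbert_space"
proof -
  have "Re (cinner x x) = (norm x)\<^sup>2"
    using norm_ge_zero [of x] by (simp add: norm_eq_sqrt_cinner)
  moreover have "Im (cinner x x) = 0"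
    using cinner_commute [of x x] by (simp add: complex_eq_iff)
  ultimately show ?thesis by (simp add: complex_eq_iff)
qed

lemma norm_add_scaleC_square:
  "(norm (x + c *\<^sub>C y))\<^sup>2 = (norm x)\<^sup>2 + 2 * Re (c * cinner y x) + (cmod c)\<^sup>2 * (norm y)\<^sup>2"
  for x :: "'a::complex_hilbert_space"
proof -
  have "Re (cnj c * cinner x y) = Re (c * cinner y x)"
    by (subst (2) cinner_commute) simp
  moreover have "Re (cnj c * (c * complex_of_real ((norm y)\<^sup>2))) = (cmod c)\<^sup>2 * (norm y)\<^sup>2"
    unfolding cmod_power2 by (simp add: algebra_simps power2_eq_square)
  moreover have "cinner (x + c *\<^sub>C y) (x + c *\<^sub>C y) = complex_of_real ((norm x)\<^sup>2) + c * cinner y x +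
      (cnj c * cinner x y + cnj c * (c * complex_of_real ((norm y)\<^sup>2)))"
    by (simp only: cinner_add_left cinner_add_right cinner_scaleC_left cinner_scaleC_right
        cinner_self [of x] cinner_self [of y] ring_distribs)
  ultimately have "Re (cinner (x + c *\<^sub>C y) (x + c *\<^sub>C y)) =
      (norm x)\<^sup>2 + 2 * Re (c * cinner y x) + (cmod c)\<^sup>2 * (norm y)\<^sup>2"
    by (simp only: plus_complex.sel Re_complex_of_real)
  then show ?thesis unfolding cinner_self by (simp only: Re_complex_of_real)
qed

lemma cinner_Cauchy_Schwarz: "cmod (cinner x y) \<le> norm x * norm y"
  for x :: "'a::complex_hilbert_space"
proof -
  have "(cmod (cinner x y))\<^sup>2 \<le> (norm y)\<^sup>2 * (norm x)\<^sup>2"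
  proof (rule cmod_le_of_quadratic_nonneg)
    show "0 \<le> (norm y)\<^sup>2 + 2 * Re (c * cinner x y) + (cmod c)\<^sup>2 * (norm x)\<^sup>2" for c
      using norm_add_scaleC_square [of y c x] by (metis zero_le_power2)
  qed
  then show ?thesis
    by (metis abs_le_square_iff abs_norm_cancel abs_of_nonneg mult.commute mult_nonneg_nonneg
        norm_ge_zero power_mult_distrib)
qed

lemma cinner_parallelogram: "(norm (x + y))\<^sup>2 + (norm (x - y))\<^sup>2 = 2 * (norm x)\<^sup>2 + 2 * (norm y)\<^sup>2"
  for x :: "'a::complex_hilbert_space"
  using norm_add_scaleC_square [of x 1 y] norm_add_scaleC_square [of x "-1" y]
  by (simp add: scaleC_one scaleC_minus_left)

lemma cinner_ext: "(\<And>x. cinner x y = cinner x z) \<Longrightarrow> y = z"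
  for y :: "'a::complex_hilbert_space"
proof -
  assume "\<And>x. cinner x y = cinner x z"
  then have "cinner (y - z) (y - z) = 0" by (simp add: cinner_diff_right)
  then show "y = z" by (simp add: cinner_self)
qed

text \<open>The representing vector is a multiple of the point of least norm on the affine
  hyperplane \<open>f = 1\<close>. A minimising sequence is Cauchy by the parallelogram law, because
  midpoints stay on the hyperplane.\<close>

lemma Riesz_representation:
  fixes f :: "'a::complex_hilbert_space \<Rightarrow> complex"
  assumes add: "\<And>x y. f (x + y) = f x + f y" and scale: "\<And>c x. f (c *\<^sub>C x) = c * f x"
    and bound: "\<And>x. cmod (f x) \<le> K * norm x"
  obtains y where "\<And>x. f x = cinner x y"
proof (cases "\<forall>x. f x = 0")
  case True
  have "cinner x (0::'a) = 0" for x by (metis cinner_diff_right diff_self)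
  with True that show thesis by metis
next
  case False
  then obtain w where w: "f w \<noteq> 0" by blast
  have diff: "f (x - y) = f x - f y" for x y
    using add [of x "(-1) *\<^sub>C y"] scale [of "-1" y] by (simp add: scaleC_minus_left scaleC_one)
  have blin: "bounded_linear f"
    by (rule bounded_linear_intro [where K = K])
      (use add scale bound in \<open>simp_all flip: scaleC_of_real add: scaleR_conv_of_real mult.commute\<close>)
  define S where "S = {x. f x = 1}"
  define d where "d = Inf (norm ` S)"
  have S: "S \<noteq> {}"
    using scale [of "1 / f w" w] w by (auto simp: S_def)
  have d_le: "d \<le> norm x" if "x \<in> S" for x
    unfolding d_def using that by (intro cInf_lower bdd_belowI [of _ 0]) auto
  have d0: "0 \<le> d" unfolding d_def using S by (intro cInf_greatest) auto
  have "\<exists>x\<in>S. norm x < d + 1 / real (Suc n)" for n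
    using S cInf_lessD [of "norm ` S" "d + 1 / real (Suc n)"] by (auto simp: d_def)
  then obtain X where X: "\<And>n. X n \<in> S" "\<And>n. norm (X n) < d + 1 / real (Suc n)" by metis
  have lim0: "(\<lambda>n. d + 1 / real (Suc n)) \<longlonglongrightarrow> d"
    using tendsto_add [OF tendsto_const LIMSEQ_inverse_real_of_nat, of d] by (simp add: inverse_eq_divide)
  have limX: "(\<lambda>n. norm (X n)) \<longlonglongrightarrow> d"
    using X d_le by (intro tendsto_sandwich [OF _ _ tendsto_const lim0] eventuallyI) (auto intro: less_imp_le)
  have close: "(norm (X m - X n))\<^sup>2 \<le> 2 * ((norm (X m))\<^sup>2 - d\<^sup>2) + 2 * ((norm (X n))\<^sup>2 - d\<^sup>2)" for m n
  proof -
    have "(1/2) *\<^sub>C (X m + X n) \<in> S" using X(1) by (simp add: S_def add scale)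
    from d_le [OF this] have "2 * d \<le> norm (X m + X n)" by (simp add: norm_scaleC)
    then have "4 * d\<^sup>2 \<le> (norm (X m + X n))\<^sup>2" using d0 power_mono [of "2 * d" _ 2] by fastforce
    then show ?thesis using cinner_parallelogram [of "X m" "X n"] by simp
  qed
  have lim2: "(\<lambda>n. (norm (X n))\<^sup>2 - d\<^sup>2) \<longlonglongrightarrow> 0"
    using tendsto_diff [OF tendsto_power [OF limX, of 2] tendsto_const [of "d\<^sup>2"]] by simp
  have "Cauchy X"
  proof (rule CauchyI)
    fix e :: real assume "0 < e"
    then have "\<forall>\<^sub>F n in sequentially. (norm (X n))\<^sup>2 - d\<^sup>2 < e\<^sup>2 / 4"
      by (intro order_tendstoD(2) [OF lim2]) simp
    then obtain M where M: "\<And>n. n \<ge> M \<Longrightarrow> (norm (X n))\<^sup>2 - d\<^sup>2 < e\<^sup>2 / 4"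
      by (auto simp: eventually_sequentially)
    show "\<exists>M. \<forall>m\<ge>M. \<forall>n\<ge>M. norm (X m - X n) < e"
    proof (intro exI allI impI)
      fix m n assume "m \<ge> M" "n \<ge> M"
      then have "(norm (X m - X n))\<^sup>2 < e\<^sup>2" using M [of m] M [of n] close [of m n] by (simp add: field_simps)
      then show "norm (X m - X n) < e" using \<open>0 < e\<close> power_less_imp_less_base by fastforce
    qed
  qed
  then obtain x0 where x0: "X \<longlonglongrightarrow> x0" using Cauchy_convergent convergent_def by blast
  have "(\<lambda>n. f (X n)) \<longlonglongrightarrow> f x0" by (rule bounded_linear.tendsto [OF blin x0])
  moreover have "(\<lambda>n. f (X n)) = (\<lambda>_. 1)" using X(1) by (simp add: S_def)
  ultimately have fx0: "f x0 = 1" by (simp add: LIMSEQ_const_iff)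
  then have x0_nz: "x0 \<noteq> 0" using scale [of 0 "0::'a"] by (auto simp: scaleC_zero_right)
  have norm_x0: "norm x0 = d" using LIMSEQ_unique [OF tendsto_norm [OF x0] limX] .
  \<comment> \<open>Moving \<open>x0\<close> along the kernel of \<open>f\<close> stays in
    \<open>S\<close> and cannot decrease the norm; the quadratic lemma with \<open>p = 0\<close>
    turns this into orthogonality.\<close>
  have orth: "cinner z x0 = 0" if "f z = 0" for z
  proof -
    have "(cmod (cinner z x0))\<^sup>2 \<le> 0 * (norm z)\<^sup>2"
    proof (rule cmod_le_of_quadratic_nonneg)
      fix c
      have "x0 + c *\<^sub>C z \<in> S" using that fx0 by (simp add: S_def add scale)
      from d_le [OF this] have "(norm x0)\<^sup>2 \<le> (norm (x0 + c *\<^sub>C z))\<^sup>2" using norm_x0 d0 by simp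
      then show "0 \<le> 0 + 2 * Re (c * cinner z x0) + (cmod c)\<^sup>2 * (norm z)\<^sup>2"
        by (simp add: norm_add_scaleC_square)
    qed
    then show ?thesis by simp
  qed
  define y where "y = complex_of_real (1 / (norm x0)\<^sup>2) *\<^sub>C x0"
  have "f x = cinner x y" for x
  proof -
    have "cinner (x - f x *\<^sub>C x0) x0 = 0" by (rule orth) (simp add: diff scale fx0)
    then have "cinner x x0 = f x * complex_of_real ((norm x0)\<^sup>2)"
      by (simp add: cinner_diff_left cinner_scaleC_left cinner_self)
    then show ?thesis using x0_nz unfolding y_def cinner_scaleC_right by simp
  qed
  then show thesis by (rule that)
qed

section \<open>Calculus of bounded operators and their adjoints\<close>

lemma bop_eqI: "(\<And>x. bop_apply a x = bop_apply b x) \<Longrightarrow> a = b"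
  by transfer (rule blinfun_eqI)

lemma bop_apply_simps:
  "bop_apply (a + b) x = bop_apply a x + bop_apply b x"
  "bop_apply (a - b) x = bop_apply a x - bop_apply b x"
  "bop_apply (- a) x = - bop_apply a x"
  "bop_apply (a * b) x = bop_apply a (bop_apply b x)"
  "bop_apply 1 x = x"
  "bop_apply 0 x = 0"
  "bop_apply (r *\<^sub>R a) x = r *\<^sub>R bop_apply a x"
  by (transfer; simp add: blinfun.add_left blinfun.diff_left blinfun.minus_left blinfun.scaleR_left)+

lemma bop_apply_right:
  "bop_apply a (x + y) = bop_apply a x + bop_apply a y"
  "bop_apply a (c *\<^sub>C x) = c *\<^sub>C bop_apply a x"
  by (transfer; simp add: blinfun.add_right)+

lemma norm_bop_apply: "norm (bop_apply a x) \<le> norm a * norm x"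
  by transfer (rule norm_blinfun)

lemma norm_bop_le: "0 \<le> K \<Longrightarrow> (\<And>x. norm (bop_apply a x) \<le> K * norm x) \<Longrightarrow> norm a \<le> K"
  by transfer (rule norm_blinfun_bound)

lemma scaleC_mult_left: "(c *\<^sub>C a) * b = c *\<^sub>C (a * b)" for a :: "'h::complex_hilbert_space bop"
  by (rule bop_eqI) (simp add: bop_apply_simps bop_apply_scaleC)

lemma scaleC_mult_right: "a * (c *\<^sub>C b) = c *\<^sub>C (a * b)" for a :: "'h::complex_hilbert_space bop"
  by (rule bop_eqI) (simp add: bop_apply_simps bop_apply_scaleC bop_apply_right)

lemma bop_Ex:
  fixes g :: "'h::complex_hilbert_space \<Rightarrow> 'h"
  assumes "\<And>x y. g (x + y) = g x + g y" "\<And>c x. g (c *\<^sub>C x) = c *\<^sub>C g x"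
    and "\<And>x. norm (g x) \<le> K * norm x"
  obtains b where "\<And>x. bop_apply b x = g x"
proof -
  have "bounded_linear g"
    by (rule bounded_linear_intro [where K = K])
      (use assms in \<open>simp_all flip: scaleC_of_real add: mult.commute\<close>)
  then have "bop_apply (Abs_bop (Blinfun g)) x = g x" for x
    using assms(2) by (simp add: bop_apply_def Abs_bop_inverse bounded_linear_Blinfun_apply)
  then show thesis by (rule that)
qed

text \<open>Riesz yields the value of the adjoint at each \<open>y\<close> separately; linearity
  follows from uniqueness of the representing vector, boundedness from testing with
  \<open>x = g y\<close>.\<close>

lemma adj_exists: "\<exists>b. \<forall>x y. cinner (bop_apply a x) y = cinner x (bop_apply b y)"
proof -
  have "\<exists>z. \<forall>x. cinner (bop_apply a x) y = cinner x z" for y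
  proof (rule Riesz_representation [of "\<lambda>x. cinner (bop_apply a x) y" "norm a * norm y"])
    show "cmod (cinner (bop_apply a x) y) \<le> norm a * norm y * norm x" for x
      using cinner_Cauchy_Schwarz [of "bop_apply a x" y] 
        mult_right_mono [OF norm_bop_apply [of a x] norm_ge_zero [of y]] by (simp add: mult_ac)
  qed (auto simp: bop_apply_right cinner_add_left cinner_scaleC_left)
  then obtain g where g: "\<And>x y. cinner (bop_apply a x) y = cinner x (g y)" by metis
  have bound: "norm (g y) \<le> norm a * norm y" for y
  proof -
    have "(norm (g y))\<^sup>2 = cmod (cinner (bop_apply a (g y)) y)"
      by (simp add: g cinner_self norm_power)
    also have "\<dots> \<le> norm (bop_apply a (g y)) * norm y" by (rule cinner_Cauchy_Schwarz)
    also have "\<dots> \<le> norm a * norm (g y) * norm y" by (intro mult_right_mono norm_bop_apply norm_ge_zero)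
    finally have "norm (g y) * norm (g y) \<le> norm (g y) * (norm a * norm y)"
      by (simp add: power2_eq_square mult_ac)
    then show ?thesis by (cases "norm (g y) = 0") auto
  qed
  have "g (x + y) = g x + g y" for x y
    by (rule cinner_ext) (simp only: g [symmetric] cinner_add_right)
  moreover have "g (c *\<^sub>C x) = c *\<^sub>C g x" for c x
    by (rule cinner_ext) (simp only: g [symmetric] cinner_scaleC_right)
  ultimately obtain b where "\<And>x. bop_apply b x = g x"
    using bop_Ex [of g "norm a"] bound by metis
  with g show ?thesis by metis
qed

lemma adjI:
  assumes "\<And>x y. cinner (bop_apply a x) y = cinner x (bop_apply b y)"
  shows "adj a = b"
  unfolding adj_def
proof (rule the_equality)
  show "c = b" if "\<forall>x y. cinner (bop_apply a x) y = cinner x (bop_apply c y)" for c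
    using assms that by (intro bop_eqI cinner_ext) metis
qed (use assms in blast)

lemma cinner_adj: "cinner (bop_apply a x) y = cinner x (bop_apply (adj a) y)"
  using adj_exists [of a] adjI by metis

lemma cinner_adj': "cinner x (bop_apply a y) = cinner (bop_apply (adj a) x) y"
  by (metis cinner_adj cinner_commute)

lemma adj_simps [simp]:
  "adj (adj a) = a" "adj (a + b) = adj a + adj b" "adj (a - b) = adj a - adj b"
  "adj (- a) = - adj a" "adj (a * b) = adj b * adj a"
  "adj (c *\<^sub>C a) = cnj c *\<^sub>C adj a" "adj (r *\<^sub>R a) = r *\<^sub>R adj a"
proof -
  show sC: "adj (c *\<^sub>C a) = cnj c *\<^sub>C adj a" for c
    by (rule adjI) (simp add: bop_apply_scaleC cinner_scaleC_left cinner_scaleC_right cinner_adj)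
  show "adj (r *\<^sub>R a) = r *\<^sub>R adj a"
    using sC [of "complex_of_real r"] by (simp add: scaleC_of_real)
  show "adj (adj a) = a" by (rule adjI) (rule cinner_adj' [symmetric])
qed (rule adjI; simp add: bop_apply_simps cinner_adj cinner_add_left cinner_add_right
    cinner_diff_left cinner_diff_right cinner_minus_left cinner_minus_right)+

lemma adj_zero_one [simp]: "adj 0 = 0" "adj 1 = 1"
  using adj_simps(7) [of 0] by (simp, intro adjI) (simp add: bop_apply_simps)


lemma norm_adj_le: "norm (adj a) \<le> norm a"
proof (rule norm_bop_le)
  show "norm (bop_apply (adj a) y) \<le> norm a * norm y" for y
  proof -
    have "(norm (bop_apply (adj a) y))\<^sup>2 = cmod (cinner (bop_apply a (bop_apply (adj a) y)) y)"
      by (simp add: cinner_adj cinner_self norm_power)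
    also have "\<dots> \<le> norm (bop_apply a (bop_apply (adj a) y)) * norm y" by (rule cinner_Cauchy_Schwarz)
    also have "\<dots> \<le> norm a * norm (bop_apply (adj a) y) * norm y"
      by (intro mult_right_mono norm_bop_apply norm_ge_zero)
    finally have "norm (bop_apply (adj a) y) * norm (bop_apply (adj a) y)
        \<le> norm (bop_apply (adj a) y) * (norm a * norm y)"
      by (simp add: power2_eq_square mult_ac)
    then show ?thesis by (cases "norm (bop_apply (adj a) y) = 0") auto
  qed
qed simp

lemma norm_adj [simp]: "norm (adj a) = norm a"
  using norm_adj_le [of a] norm_adj_le [of "adj a"] by simp

lemma unitary_norm: assumes "unitary u" shows "norm u \<le> 1"
proof (rule norm_bop_le)
  show "norm (bop_apply u x) \<le> 1 * norm x" for x
  proof -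
    have "complex_of_real ((norm (bop_apply u x))\<^sup>2) = cinner x (bop_apply (adj u * u) x)"
      unfolding bop_apply_simps cinner_self [symmetric] by (rule cinner_adj)
    also have "\<dots> = complex_of_real ((norm x)\<^sup>2)"
      using assms by (simp add: unitary_def bop_apply_simps cinner_self)
    finally have "(norm (bop_apply u x))\<^sup>2 = (norm x)\<^sup>2" by (simp only: of_real_eq_iff)
    then show ?thesis by simp
  qed
qed simp

lemma unitary_one: "unitary 1" and unitary_adj: "unitary u \<Longrightarrow> unitary (adj u)"
  by (simp_all add: unitary_def)

lemma unitary_mult: "unitary u \<Longrightarrow> unitary v \<Longrightarrow> unitary (u * v)"
proof -
  assume "unitary u" "unitary v"
  then have "adj v * (adj u * u) * v = 1" "u * (v * adj v) * adj u = 1" by (simp_all add: unitary_def)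
  then show "unitary (u * v)" by (simp add: unitary_def mult.assoc)
qed

text \<open>Completeness is inherited from the real operator space, since complex linearity survives
  pointwise limits. It serves the fixed point argument for square roots and the integrals of
  operator-valued functions.\<close>

instance bop :: (complex_hilbert_space) banach
proof
  fix X :: "nat \<Rightarrow> 'a bop" assume X: "Cauchy X"
  have dist: "dist a b = norm (blinfun_of_bop a - blinfun_of_bop b)" for a b :: "'a bop"
    unfolding dist_norm by transfer simp
  have "Cauchy (\<lambda>n. blinfun_of_bop (X n))"
    using X by (simp add: Cauchy_def dist dist_norm)
  then obtain L where L: "(\<lambda>n. blinfun_of_bop (X n)) \<longlonglongrightarrow> L"
    using Cauchy_convergent convergent_def by blast
  have app: "(\<lambda>n. bop_apply (X n) x) \<longlonglongrightarrow> blinfun_apply L x" for x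
    unfolding bop_apply.rep_eq by (intro tendsto_intros L)
  have C: "bounded_linear (\<lambda>x::'a. c *\<^sub>C x)" for c
    using bounded_linear_scaleC_blinfun [of c id_blinfun] by simp
  have lin: "blinfun_apply L (c *\<^sub>C x) = c *\<^sub>C blinfun_apply L x" for c x
  proof (rule LIMSEQ_unique)
    show "(\<lambda>n. bop_apply (X n) (c *\<^sub>C x)) \<longlonglongrightarrow> blinfun_apply L (c *\<^sub>C x)" by (rule app)
    show "(\<lambda>n. bop_apply (X n) (c *\<^sub>C x)) \<longlonglongrightarrow> c *\<^sub>C blinfun_apply L x"
      unfolding bop_apply_right by (rule bounded_linear.tendsto [OF C app])
  qed
  have "blinfun_of_bop (Abs_bop L) = L" using lin by (simp add: Abs_bop_inverse)
  then have "X \<longlonglongrightarrow> Abs_bop L"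
    using L by (simp add: tendsto_iff dist dist_norm)
  then show "convergent X" by (auto simp: convergent_def)
qed

section \<open>Von Neumann algebras as bicommutants\<close>

lemma commutant_closed:
  shows "1 \<in> commutant A" "0 \<in> commutant A"
    and "a \<in> commutant A \<Longrightarrow> b \<in> commutant A \<Longrightarrow> a + b \<in> commutant A"
    and "a \<in> commutant A \<Longrightarrow> b \<in> commutant A \<Longrightarrow> a * b \<in> commutant A"
    and "a \<in> commutant A \<Longrightarrow> c *\<^sub>C a \<in> commutant A"
     apply (simp_all add: commutant_def distrib_left distrib_right scaleC_mult_left scaleC_mult_right)
  by (metis mult.assoc)

context
  fixes A :: "'h::complex_hilbert_space bop set"
  assumes A: "von_neumann_algebra A"
begin

lemma vna_commutant: "A = commutant (commutant A)"
  using A by (simp add: von_neumann_algebra_def)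

lemma vna_adj: "a \<in> A \<Longrightarrow> adj a \<in> A"
  using A by (simp add: von_neumann_algebra_def)

lemma vna_one: "1 \<in> A" and vna_zero: "0 \<in> A"
  by (subst vna_commutant, simp add: commutant_closed)+

lemma vna_add: "a \<in> A \<Longrightarrow> b \<in> A \<Longrightarrow> a + b \<in> A"
  and vna_mult: "a \<in> A \<Longrightarrow> b \<in> A \<Longrightarrow> a * b \<in> A"
  and vna_scaleC: "a \<in> A \<Longrightarrow> c *\<^sub>C a \<in> A"
  by (subst vna_commutant, rule commutant_closed; simp flip: vna_commutant)+

lemma vna_scaleR: "a \<in> A \<Longrightarrow> r *\<^sub>R a \<in> A"
  using vna_scaleC [of a "complex_of_real r"] by (simp add: scaleC_of_real)

lemma vna_minus: "a \<in> A \<Longrightarrow> - a \<in> A"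
  using vna_scaleR [of a "-1"] by simp

lemma vna_diff: "a \<in> A \<Longrightarrow> b \<in> A \<Longrightarrow> a - b \<in> A"
  using vna_add [of a "- b"] vna_minus by simp

lemma vna_power: "a \<in> A \<Longrightarrow> a ^ n \<in> A"
  by (induction n) (simp_all add: vna_one vna_mult)

lemma vna_sum: "(\<And>i. i \<in> I \<Longrightarrow> f i \<in> A) \<Longrightarrow> (\<Sum>i\<in>I. f i) \<in> A"
  by (induction I rule: infinite_finite_induct) (simp_all add: vna_zero vna_add)

lemma vna_closed: "closed A"
proof -
  have "A = (\<Inter>b\<in>commutant A. {a. b * a = a * b})"
    by (subst vna_commutant) (auto simp: commutant_def [of "commutant A"])
  moreover have "closed (\<Inter>b\<in>commutant A. {a. b * a = a * b})"
    by (intro closed_INT ballI closed_Collect_eq continuous_intros)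
  ultimately show ?thesis by simp
qed

text \<open>Membership in a bicommutant is a family of linear equations, and each of them passes
  through the integral.\<close>

lemma vna_has_integral:
  assumes f: "(f has_integral J) {a..b}" and mem: "\<And>s. s \<in> {a..b} \<Longrightarrow> f s \<in> A"
  shows "J \<in> A"
proof -
  have "b' * J = J * b'" if b': "b' \<in> commutant A" for b'
  proof -
    have "((\<lambda>s. b' * f s - f s * b') has_integral (b' * J - J * b')) {a..b}"
      by (intro has_integral_diff has_integral_mult_left has_integral_mult_right f)
    moreover have "((\<lambda>s. b' * f s - f s * b') has_integral 0) {a..b}"
      by (rule has_integral_is_0) (use b' mem in \<open>auto simp: commutant_def\<close>)
    ultimately have "b' * J - J * b' = 0" by (rule has_integral_unique)
    then show ?thesis by simp
  qed
  then show ?thesis by (subst vna_commutant) (simp add: commutant_def)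
qed

lemma star_algebra_generated_subset: "X \<subseteq> A \<Longrightarrow> star_algebra_generated X \<subseteq> A"
proof
  fix a assume "X \<subseteq> A" "a \<in> star_algebra_generated X"
  from this(2,1) show "a \<in> A"
    by (induction rule: star_algebra_generated.induct)
      (auto intro: vna_one vna_add vna_scaleC vna_mult vna_adj)
qed

end

subsection \<open>Tracial states\<close>

context wstar_probability_space
begin

lemmas A_intros [simp, intro] = vna_one [OF von_neumann] vna_zero [OF von_neumann]
  vna_add [OF von_neumann] vna_mult [OF von_neumann] vna_scaleC [OF von_neumann]
  vna_scaleR [OF von_neumann] vna_minus [OF von_neumann] vna_diff [OF von_neumann]
  vna_power [OF von_neumann] vna_sum [OF von_neumann] vna_adj [OF von_neumann]

lemma tau_scaleR: "a \<in> A \<Longrightarrow> \<tau> (r *\<^sub>R a) = complex_of_real r * \<tau> a"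
  using scaleC [of a "complex_of_real r"] by (simp add: scaleC_of_real)

lemmas tau_add = add

lemma tau_zero: "\<tau> 0 = 0"
  using tau_scaleR [of 0 0] by simp

lemma tau_minus: "a \<in> A \<Longrightarrow> \<tau> (- a) = - \<tau> a"
  using tau_scaleR [of a "-1"] by simp

lemma tau_diff: "a \<in> A \<Longrightarrow> b \<in> A \<Longrightarrow> \<tau> (a - b) = \<tau> a - \<tau> b"
  using add [of a "- b"] by (simp add: tau_minus)

lemma tau_sum: "(\<And>i. i \<in> I \<Longrightarrow> f i \<in> A) \<Longrightarrow> \<tau> (\<Sum>i\<in>I. f i) = (\<Sum>i\<in>I. \<tau> (f i))"
  by (induction I rule: infinite_finite_induct) (simp_all add: tau_zero add)

lemmas tau_simps = tau_zero unital tau_minus tau_diff add tau_scaleR scaleC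

lemma norm2_square: "a \<in> A \<Longrightarrow> complex_of_real ((norm2 \<tau> a)\<^sup>2) = \<tau> (adj a * a)"
  using positive [of a] by (auto simp: norm2_def complex_nonneg_Reals_iff complex_eq_iff)

lemma norm2_square_Re: "a \<in> A \<Longrightarrow> (norm2 \<tau> a)\<^sup>2 = Re (\<tau> (adj a * a))"
  by (simp flip: norm2_square)

lemma norm2_nonneg: "a \<in> A \<Longrightarrow> 0 \<le> norm2 \<tau> a"
  using positive [of a] by (auto simp: norm2_def complex_nonneg_Reals_iff)

text \<open>Polarisation: positivity makes \<open>\<tau>\<close> real on \<open>adj x * x\<close>
  for \<open>x = 1 + c a\<close>; the choices \<open>c = 1\<close> and \<open>c = i\<close> give the
  real and the imaginary part of the claim.\<close>

lemma tau_adj: assumes a: "a \<in> A" shows "\<tau> (adj a) = cnj (\<tau> a)"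
proof -
  have "Im (\<tau> (adj (1 + c *\<^sub>C a) * (1 + c *\<^sub>C a))) = 0" "Im (\<tau> (adj (c *\<^sub>C a) * (c *\<^sub>C a))) = 0" for c
    using a positive [of "1 + c *\<^sub>C a"] positive [of "c *\<^sub>C a"] by (auto simp: complex_nonneg_Reals_iff)
  moreover have "\<tau> (adj (1 + c *\<^sub>C a) * (1 + c *\<^sub>C a)) =
      1 + c * \<tau> a + (cnj c * \<tau> (adj a) + \<tau> (adj (c *\<^sub>C a) * (c *\<^sub>C a)))" for c
    using a by (simp add: distrib_left distrib_right tau_simps scaleC_mult_left scaleC_mult_right)
  ultimately have "Im (c * \<tau> a + cnj c * \<tau> (adj a)) = 0" for c by simp
  from this [of 1] this [of \<i>] show ?thesis by (simp add: complex_eq_iff)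
qed

lemma norm2_add_square:
  assumes a: "a \<in> A" and b: "b \<in> A"
  shows "(norm2 \<tau> (b + c *\<^sub>C a))\<^sup>2 =
    (norm2 \<tau> b)\<^sup>2 + 2 * Re (c * \<tau> (adj b * a)) + (cmod c)\<^sup>2 * (norm2 \<tau> a)\<^sup>2"
proof -
  have "\<tau> (adj (b + c *\<^sub>C a) * (b + c *\<^sub>C a)) =
      \<tau> (adj b * b) + c * \<tau> (adj b * a) + (cnj c * \<tau> (adj (adj b * a)) + c * (cnj c * \<tau> (adj a * a)))"
    using a b by (simp add: distrib_left distrib_right tau_simps scaleC_mult_left scaleC_mult_right scaleC_scaleC)
  also have "cnj c * \<tau> (adj (adj b * a)) = cnj (c * \<tau> (adj b * a))"
    using a b by (subst tau_adj) auto
  finally have "(norm2 \<tau> (b + c *\<^sub>C a))\<^sup>2 =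
      Re (\<tau> (adj b * b)) + 2 * Re (c * \<tau> (adj b * a)) + Re (c * (cnj c * \<tau> (adj a * a)))"
    using a b by (simp add: norm2_square_Re)
  moreover have "Re (c * (cnj c * \<tau> (adj a * a))) = (cmod c)\<^sup>2 * (norm2 \<tau> a)\<^sup>2"
    unfolding norm2_square [OF a, symmetric] cmod_power2 by (simp add: algebra_simps power2_eq_square)
  ultimately show ?thesis using b by (simp add: norm2_square_Re)
qed

lemma tau_Cauchy_Schwarz:
  assumes a: "a \<in> A" and b: "b \<in> A"
  shows "cmod (\<tau> (adj b * a)) \<le> norm2 \<tau> b * norm2 \<tau> a"
proof -
  have "(cmod (\<tau> (adj b * a)))\<^sup>2 \<le> (norm2 \<tau> b)\<^sup>2 * (norm2 \<tau> a)\<^sup>2"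
    by (rule cmod_le_of_quadratic_nonneg) (simp only: zero_le_power2 flip: norm2_add_square [OF a b])
  then show ?thesis
    using a b by (metis norm2_nonneg mult_nonneg_nonneg power2_le_imp_le power_mult_distrib)
qed

lemma norm2_scaleC: "a \<in> A \<Longrightarrow> norm2 \<tau> (c *\<^sub>C a) = cmod c * norm2 \<tau> a"
proof -
  assume a: "a \<in> A"
  have "(norm2 \<tau> (0 + c *\<^sub>C a))\<^sup>2 = (cmod c * norm2 \<tau> a)\<^sup>2"
    using a by (subst norm2_add_square) (auto simp: norm2_def power_mult_distrib tau_zero)
  then show ?thesis using a by (simp add: norm2_nonneg power2_eq_iff_nonneg)
qed

lemma norm2_triangle: assumes "a \<in> A" "b \<in> A" shows "norm2 \<tau> (a + b) \<le> norm2 \<tau> a + norm2 \<tau> b"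
proof -
  have "(norm2 \<tau> (a + b))\<^sup>2 = (norm2 \<tau> a)\<^sup>2 + 2 * Re (\<tau> (adj a * b)) + (norm2 \<tau> b)\<^sup>2"
    using norm2_add_square [of b a 1] assms by (simp add: scaleC_one)
  also have "Re (\<tau> (adj a * b)) \<le> norm2 \<tau> a * norm2 \<tau> b"
    using tau_Cauchy_Schwarz [of b a] complex_Re_le_cmod [of "\<tau> (adj a * b)"] assms by linarith
  finally have "(norm2 \<tau> (a + b))\<^sup>2 \<le> (norm2 \<tau> a + norm2 \<tau> b)\<^sup>2"
    by (simp add: power2_sum)
  then show ?thesis using assms by (auto intro: power2_le_imp_le simp: norm2_nonneg)
qed

lemma norm2_minus: "norm2 \<tau> (- a) = norm2 \<tau> a"
  by (simp add: norm2_def)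

lemma norm2_minus_commute: "norm2 \<tau> (a - b) = norm2 \<tau> (b - a)"
  by (metis minus_diff_eq norm2_minus)

lemma norm2_triangle_diff: "a \<in> A \<Longrightarrow> b \<in> A \<Longrightarrow> norm2 \<tau> (a - b) \<le> norm2 \<tau> a + norm2 \<tau> b"
  using norm2_triangle [of a "- b"] by (simp add: norm2_minus)

lemma norm2_parallelogram_le:
  assumes "a \<in> A" "b \<in> A" shows "(norm2 \<tau> (a + b))\<^sup>2 \<le> 2 * (norm2 \<tau> a)\<^sup>2 + 2 * (norm2 \<tau> b)\<^sup>2"
  using norm2_add_square [of b a 1] norm2_add_square [of b a "-1"] assms
    zero_le_power2 [of "norm2 \<tau> (a + (- 1) *\<^sub>C b)"] by (simp add: scaleC_one)

lemma norm2_adj: "a \<in> A \<Longrightarrow> norm2 \<tau> (adj a) = norm2 \<tau> a"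
  by (simp add: norm2_def tracial)

lemma norm2_zero: "norm2 \<tau> 0 = 0" and norm2_one: "norm2 \<tau> 1 = 1"
  by (simp_all add: norm2_def tau_simps)

text \<open>A trace is only assumed positive on the elements \<open>a\<^sup>* a\<close>, so its boundedness needs square roots in \<open>A\<close>:
  \<open>1 - sqrt (1 - x)\<close> is the fixed point of the contraction \<open>y \<mapsto> (x + y\<^sup>2) / 2\<close>.\<close>

lemma selfadjoint_sqrt:
  assumes x: "x \<in> A" "adj x = x" "norm x < 1"
  obtains y where "y \<in> A" "adj y = y" "y * y = 1 - x"
proof -
  \<comment> \<open>The smaller root of \<open>r = (norm x + r * r) / 2\<close>: the ball of radius
    \<open>r\<close> is mapped into itself, and \<open>r < 1\<close> is at the same time the
    contraction constant on it.\<close>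
  define r where "r = 1 - sqrt (1 - norm x)"
  define f where "f y = (1/2) *\<^sub>R (x + y * y)" for y
  define s where "s = {y \<in> A. adj y = y \<and> norm y \<le> r}"
  have r: "0 \<le> r" "r < 1" "(norm x + r * r) / 2 = r"
    using x(3) real_sqrt_pow2 [of "1 - norm x"]
    by (auto simp: r_def power2_eq_square field_simps)
  have adj_cont: "continuous_on UNIV (adj :: 'h bop \<Rightarrow> _)"
    by (rule linear_continuous_on) (rule bounded_linear_intro [where K = 1], auto)
  have "closed ({y. adj y = y} \<inter> A \<inter> cball 0 r)"
    by (intro closed_Int closed_Collect_eq adj_cont continuous_intros vna_closed [OF von_neumann] closed_cball)
  moreover have "s = {y. adj y = y} \<inter> A \<inter> cball 0 r" by (auto simp: s_def)
  ultimately have "complete s" by (simp add: complete_eq_closed)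
  moreover have "s \<noteq> {}" using r by (auto simp: s_def intro!: exI [of _ 0])
  moreover have "f ` s \<subseteq> s"
  proof clarify
    fix y assume y: "y \<in> s"
    have "norm (f y) \<le> (norm x + norm y * norm y) / 2"
      using norm_triangle_ineq [of x "y * y"] norm_mult_ineq [of y y] by (simp add: f_def)
    also have "\<dots> \<le> (norm x + r * r) / 2"
      using y r by (intro divide_right_mono add_left_mono mult_mono) (auto simp: s_def)
    finally have "norm (f y) \<le> r" using r by simp
    with y x show "f y \<in> s" by (auto simp: s_def f_def)
  qed
  moreover have "dist (f y) (f z) \<le> r * dist y z" if "y \<in> s" "z \<in> s" for y z
  proof -
    \<comment> \<open>The difference of squares is symmetrised because \<open>y\<close> and
      \<open>z\<close> need not commute.\<close>
    have "f y - f z = (1/4) *\<^sub>R ((y - z) * (y + z) + (y + z) * (y - z))"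
      by (simp add: f_def algebra_simps flip: scaleR_add_left)
    also have "norm \<dots> \<le> (norm ((y - z) * (y + z)) + norm ((y + z) * (y - z))) / 4"
      using norm_triangle_ineq by simp
    also have "\<dots> \<le> (norm (y - z) * norm (y + z) + norm (y + z) * norm (y - z)) / 4"
      by (intro divide_right_mono add_mono norm_mult_ineq) auto
    also have "\<dots> = norm (y + z) / 2 * norm (y - z)" by simp
    also have "\<dots> \<le> r * norm (y - z)"
      using that norm_triangle_ineq [of y z] by (intro mult_right_mono) (auto simp: s_def)
    finally show ?thesis by (simp add: dist_norm)
  qed
  ultimately have "\<exists>!y. y \<in> s \<and> f y = y" 
    using Banach_fix [of s r f] r by blast
  then obtain y where y: "y \<in> s" "f y = y" by blast
  have "x + y * y = 2 *\<^sub>R f y" by (simp add: f_def)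
  with y(2) have "x + y * y = 2 *\<^sub>R y" by simp
  then have "(1 - y) * (1 - y) = 1 - x"
    by (simp add: algebra_simps scaleR_2)
  moreover have "1 - y \<in> A" "adj (1 - y) = 1 - y" using y by (auto simp: s_def)
  ultimately show thesis by (rule that [rotated 2])
qed


text \<open>With \<open>y\<close> a square root of \<open>1 - adj a * a / K^2\<close>, the claim is
  the positivity of \<open>\<tau>\<close> on \<open>adj (y * b) * (y * b)\<close>. The strict bound
  on \<open>norm a\<close> is what the square root asks for; letting \<open>K\<close> decrease to
  \<open>norm a\<close> then removes it.\<close>

lemma norm2_mult_left_less:
  assumes a: "a \<in> A" and b: "b \<in> A" and K: "norm a < K"
  shows "norm2 \<tau> (a * b) \<le> K * norm2 \<tau> b"
proof -
  have K0: "0 < K" using K norm_ge_zero [of a] by linarith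
  define x where "x = (1 / K\<^sup>2) *\<^sub>R (adj a * a)"
  have "norm (adj a * a) \<le> (norm a)\<^sup>2"
    using norm_mult_ineq [of "adj a" a] by (simp add: power2_eq_square)
  also have "\<dots> < K\<^sup>2" using K by (simp add: power_strict_mono)
  finally have "norm x < 1" using K0 by (simp add: x_def)
  moreover have "x \<in> A" "adj x = x" using a by (auto simp: x_def)
  ultimately obtain y where y: "y \<in> A" "adj y = y" "y * y = 1 - x" using selfadjoint_sqrt by metis
  have "adj (y * b) * (y * b) = adj b * (y * y) * b" by (simp add: y(2) mult.assoc)
  also have "\<dots> = adj b * b - (1 / K\<^sup>2) *\<^sub>R (adj (a * b) * (a * b))"
    by (simp add: y x_def algebra_simps mult.assoc)
  finally have "(norm2 \<tau> (y * b))\<^sup>2 = (norm2 \<tau> b)\<^sup>2 - 1 / K\<^sup>2 * (norm2 \<tau> (a * b))\<^sup>2"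
    using a b y by (simp add: norm2_square_Re tau_simps)
  then have "1 / K\<^sup>2 * (norm2 \<tau> (a * b))\<^sup>2 \<le> (norm2 \<tau> b)\<^sup>2"
    using zero_le_power2 [of "norm2 \<tau> (y * b)"] by linarith
  then have "(norm2 \<tau> (a * b))\<^sup>2 \<le> (K * norm2 \<tau> b)\<^sup>2"
    using K0 by (simp add: field_simps)
  then show ?thesis using K0 b by (auto intro: power2_le_imp_le simp: norm2_nonneg)
qed

lemma norm2_mult_left:
  assumes a: "a \<in> A" and b: "b \<in> A"
  shows "norm2 \<tau> (a * b) \<le> norm a * norm2 \<tau> b"
proof (rule tendsto_lowerbound [of "\<lambda>K. K * norm2 \<tau> b" _ "at_right (norm a)"])
  show "((\<lambda>K. K * norm2 \<tau> b) \<longlongrightarrow> norm a * norm2 \<tau> b) (at_right (norm a))"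
    by (intro tendsto_intros)
  show "\<forall>\<^sub>F K in at_right (norm a). norm2 \<tau> (a * b) \<le> K * norm2 \<tau> b"
    using norm2_mult_left_less [OF a b] by (auto simp: eventually_at_filter)
qed auto

lemma norm2_mult_right:
  assumes a: "a \<in> A" and b: "b \<in> A"
  shows "norm2 \<tau> (b * a) \<le> norm2 \<tau> b * norm a"
  using norm2_mult_left [of "adj a" "adj b"] norm2_adj [of "b * a"] norm2_adj [of b] a b
  by (simp add: mult.commute)

lemma norm2_le_norm: "a \<in> A \<Longrightarrow> norm2 \<tau> a \<le> norm a"
  using norm2_mult_left [of a 1] by (simp add: norm2_one)

lemma tau_mult_le:
  assumes "a \<in> A" "b \<in> A" shows "cmod (\<tau> (a * b)) \<le> norm2 \<tau> a * norm2 \<tau> b"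
  using tau_Cauchy_Schwarz [of b "adj a"] assms by (simp add: norm2_adj)

lemma tau_le_norm2: "a \<in> A \<Longrightarrow> cmod (\<tau> a) \<le> norm2 \<tau> a"
  using tau_mult_le [of a 1] by (simp add: norm2_one)

lemma tau_le_norm: "a \<in> A \<Longrightarrow> cmod (\<tau> a) \<le> norm a"
  using tau_le_norm2 norm2_le_norm order_trans by blast

lemma tau_mult4_le:
  assumes "a \<in> A" "b \<in> A" "c \<in> A" "d \<in> A"
  shows "cmod (\<tau> (c * a * d * b)) \<le> norm c * norm d * norm2 \<tau> a * norm2 \<tau> b"
proof -
  have "cmod (\<tau> (c * a * d * b)) \<le> norm2 \<tau> (c * a * d) * norm2 \<tau> b"
    using assms by (intro tau_mult_le) auto
  also have "norm2 \<tau> (c * a * d) \<le> norm2 \<tau> (c * a) * norm d"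
    using assms by (intro norm2_mult_right) auto
  also have "norm2 \<tau> (c * a) \<le> norm c * norm2 \<tau> a"
    using assms by (intro norm2_mult_left) auto
  finally show ?thesis using assms by (simp add: mult_ac mult_left_mono mult_right_mono norm2_nonneg)
qed

lemma unitary_inverse: "unitary u \<Longrightarrow> adj u * u = 1" "unitary u \<Longrightarrow> u * adj u = 1"
  "unitary u \<Longrightarrow> adj u * (u * a) = a" "unitary u \<Longrightarrow> u * (adj u * a) = a"
  by (simp_all add: unitary_def flip: mult.assoc)

lemma norm2_unitary: "unitary u \<Longrightarrow> norm2 \<tau> u = 1"
  by (simp add: norm2_def unitary_inverse unital)

lemma norm2_unitary_mult_left: "unitary u \<Longrightarrow> norm2 \<tau> (u * a) = norm2 \<tau> a"
  by (simp add: norm2_def mult.assoc unitary_inverse)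

lemma norm2_unitary_mult_right: "u \<in> A \<Longrightarrow> a \<in> A \<Longrightarrow> unitary u \<Longrightarrow> norm2 \<tau> (a * u) = norm2 \<tau> a"
  using norm2_unitary_mult_left [of "adj u" "adj a"] norm2_adj [of "a * u"] norm2_adj [of a]
  by (simp add: unitary_adj)

text \<open>Linearity and boundedness of \<open>\<tau>\<close> are known only on \<open>A\<close>,
  so the integral is followed through its Riemann sums; their tags lie in the interval, hence the
  sums lie in \<open>A\<close>.\<close>

lemma tau_has_integral:
  fixes f :: "real \<Rightarrow> 'h bop"
  assumes f: "(f has_integral J) {a..b}" and mem: "\<And>s. s \<in> {a..b} \<Longrightarrow> f s \<in> A"
  shows "((\<lambda>s. \<tau> (f s)) has_integral \<tau> J) {a..b}"
proof -
  have J: "J \<in> A" by (rule vna_has_integral [OF von_neumann f mem])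
  show ?thesis
    unfolding has_integral_real
  proof (intro allI impI)
    fix e :: real assume "0 < e"
    then obtain \<gamma> where \<gamma>: "gauge \<gamma>"
      "\<And>D. D tagged_division_of {a..b} \<and> \<gamma> fine D \<Longrightarrow> norm ((\<Sum>(x,k)\<in>D. measure lborel k *\<^sub>R f x) - J) < e"
      using f [unfolded has_integral_real, rule_format, of e] by metis
    show "\<exists>\<gamma>. gauge \<gamma> \<and> (\<forall>D. D tagged_division_of {a..b} \<and> \<gamma> fine D \<longrightarrow>
        norm ((\<Sum>(x,k)\<in>D. measure lborel k *\<^sub>R \<tau> (f x)) - \<tau> J) < e)"
    proof (intro exI conjI allI impI)
      fix D assume D': "D tagged_division_of {a..b} \<and> \<gamma> fine D"
      then have D: "D tagged_division_of {a..b}" "\<gamma> fine D" by simp_all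
      have fA: "f x \<in> A" if "(x, k) \<in> D" for x k
        using tag_in_interval [OF D(1) that] mem by simp
      have sA: "(\<Sum>(x,k)\<in>D. measure lborel k *\<^sub>R f x) \<in> A" using fA by (intro vna_sum [OF von_neumann]) auto
      have "\<tau> (\<Sum>(x,k)\<in>D. measure lborel k *\<^sub>R f x) = (\<Sum>p\<in>D. \<tau> (case p of (x,k) \<Rightarrow> measure lborel k *\<^sub>R f x))"
        by (rule tau_sum) (use fA in auto)
      also have "\<dots> = (\<Sum>(x,k)\<in>D. measure lborel k *\<^sub>R \<tau> (f x))"
        by (rule sum.cong) (use fA in \<open>auto simp: tau_scaleR scaleR_conv_of_real [where 'a = complex]\<close>)
      finally have "(\<Sum>(x,k)\<in>D. measure lborel k *\<^sub>R \<tau> (f x)) - \<tau> J = \<tau> ((\<Sum>(x,k)\<in>D. measure lborel k *\<^sub>R f x) - J)"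
        using J sA by (simp add: tau_diff)
      also have "cmod \<dots> \<le> norm ((\<Sum>(x,k)\<in>D. measure lborel k *\<^sub>R f x) - J)"
        using sA J by (intro tau_le_norm) auto
      also have "\<dots> < e" by (rule \<gamma>(2) [OF D'])
      finally show "norm ((\<Sum>(x,k)\<in>D. measure lborel k *\<^sub>R \<tau> (f x)) - \<tau> J) < e" .
    qed (rule \<gamma>)
  qed
qed

end

subsection \<open>Moments of the semicircle law\<close>

lemma semicircle_mean:
  "integral {- 2 * sqrt v..2 * sqrt v} (\<lambda>u. u ^ 1 * (sqrt (4 * v - u\<^sup>2) / (2 * pi * v))) = 0"
proof -
  define f where "f u = u ^ 1 * (sqrt (4 * v - u\<^sup>2) / (2 * pi * v))" for u
  have "integral {- 2 * sqrt v..2 * sqrt v} (\<lambda>u. f (- u)) = integral {- 2 * sqrt v..2 * sqrt v} f"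
    using Henstock_Kurzweil_Integration.integral_reflect_real [of "2 * sqrt v" "- 2 * sqrt v" f] by simp
  moreover have "(\<lambda>u. f (- u)) = (\<lambda>u. - f u)" by (simp add: f_def fun_eq_iff)
  ultimately have "integral {- 2 * sqrt v..2 * sqrt v} f = 0" by simp
  then show ?thesis unfolding f_def .
qed

lemma semicircle_variance:
  fixes v :: real assumes v: "0 < v"
  shows "integral {- 2 * sqrt v..2 * sqrt v} (\<lambda>u. u ^ 2 * (sqrt (4 * v - u\<^sup>2) / (2 * pi * v))) = v"
proof -
  \<comment> \<open>The classical antiderivative of \<open>u^2 * sqrt (a^2 - u^2)\<close> for
    \<open>a^2 = 4 * v\<close>, divided by \<open>2 * pi * v\<close>. Its derivative is checked in
    the open interval only, as \<open>sqrt\<close> and \<open>arcsin\<close> are not differentiable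
    at the ends.\<close>
  define G where "G u = (u * (u\<^sup>2 - 2 * v) * sqrt (4 * v - u\<^sup>2) / 4 + 2 * v\<^sup>2 * arcsin (u / (2 * sqrt v))) / (2 * pi * v)" for u
  have end_pt: "(2 * sqrt v)\<^sup>2 = 4 * v" using v by (simp add: power_mult_distrib)
  have "((\<lambda>u. u ^ 2 * (sqrt (4 * v - u\<^sup>2) / (2 * pi * v))) has_integral (G (2 * sqrt v) - G (- 2 * sqrt v)))
      {- 2 * sqrt v..2 * sqrt v}"
  proof (rule fundamental_theorem_of_calculus_interior)
    show "continuous_on {- 2 * sqrt v..2 * sqrt v} G"
      unfolding G_def using v by (intro continuous_intros) (auto simp: field_simps)
    fix u assume u: "u \<in> {- 2 * sqrt v<..<2 * sqrt v}"
    then have u': "\<bar>u\<bar> < 2 * sqrt v" by auto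
    then have "\<bar>u\<bar>\<^sup>2 < (2 * sqrt v)\<^sup>2" by (intro power_strict_mono) auto
    then have pos: "0 < 4 * v - u\<^sup>2" using end_pt by simp
    define q where "q = sqrt (4 * v - u\<^sup>2)"
    have q: "q > 0" "q * q = 4 * v - u\<^sup>2" using pos by (simp_all add: q_def)
    have "1 - (u / (2 * sqrt v))\<^sup>2 = (4 * v - u\<^sup>2) / (4 * v)"
      using v by (simp add: power_divide power_mult_distrib field_simps)
    then have rt: "sqrt (1 - (u / (2 * sqrt v))\<^sup>2) = q / (2 * sqrt v)"
      by (simp add: q_def real_sqrt_divide real_sqrt_mult)
    have in1: "- 1 < u / (2 * sqrt v)" "u / (2 * sqrt v) < 1"
      using u' v by (auto simp: field_simps abs_less_iff)
    have d1: "((\<lambda>u. arcsin (u / (2 * sqrt v))) has_real_derivative 1 / q) (at u)"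
      using DERIV_chain2 [OF DERIV_arcsin [OF in1] DERIV_cdivide [OF DERIV_ident]] v q(1)
      by (simp add: rt)
    have d0: "((\<lambda>u. u * (u\<^sup>2 - 2 * v)) has_real_derivative (u\<^sup>2 - 2 * v + u * (2 * u))) (at u)"
      by (auto intro!: derivative_eq_intros simp: algebra_simps)
    have d2: "((\<lambda>u. sqrt (4 * v - u\<^sup>2)) has_real_derivative - u / q) (at u)"
      using pos by (auto intro!: derivative_eq_intros simp: q_def field_simps)
    have "(G has_real_derivative
        (((u\<^sup>2 - 2 * v + u * (2 * u)) * q + u * (u\<^sup>2 - 2 * v) * (- u / q)) / 4 + 2 * v\<^sup>2 * (1 / q)) / (2 * pi * v)) (at u)"
      unfolding G_def
      by (rule DERIV_cong [OF DERIV_cdivide [OF DERIV_add [OF DERIV_cdivide [OF DERIV_mult [OF d0 d2]]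
              DERIV_cmult [OF d1]]]]) (simp add: q_def algebra_simps)
    moreover have "((u\<^sup>2 - 2 * v + u * (2 * u)) * q + u * (u\<^sup>2 - 2 * v) * (- u / q)) / 4 + 2 * v\<^sup>2 * (1 / q) = u\<^sup>2 * q"
    proof -
      have u2: "u\<^sup>2 = 4 * v - q * q" using q by simp
      have "((u\<^sup>2 - 2 * v + u * (2 * u)) * q + u * (u\<^sup>2 - 2 * v) * (- u / q)) / 4 + 2 * v\<^sup>2 * (1 / q) =
          ((3 * u\<^sup>2 - 2 * v) * (q * q) - u\<^sup>2 * (u\<^sup>2 - 2 * v) + 8 * v\<^sup>2) / (4 * q)"
        using q(1) by (simp add: field_simps power2_eq_square)
      also have "\<dots> = u\<^sup>2 * q" using q(1) unfolding u2 by (simp add: field_simps power2_eq_square)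
      finally show ?thesis .
    qed
    ultimately have "(G has_real_derivative u ^ 2 * (sqrt (4 * v - u\<^sup>2) / (2 * pi * v))) (at u)"
      by (simp add: q_def)
    then show "(G has_vector_derivative u ^ 2 * (sqrt (4 * v - u\<^sup>2) / (2 * pi * v))) (at u)"
      by (simp only: has_real_derivative_iff_has_vector_derivative)
  qed (use v in auto)
  note integral_unique [OF this]
  also have "G (2 * sqrt v) - G (- 2 * sqrt v) = v"
    using end_pt v by (simp add: G_def power2_eq_square)
  finally show ?thesis .
qed

subsection \<open>Free Brownian motion and the Ito isometry\<close>

lemma scaleC_diff_right: "c *\<^sub>C (x - y) = c *\<^sub>C x - c *\<^sub>C y" for x :: "'a::complex_vector"
  using scaleC_add_right [of c x "- y"] by (simp add: scaleC_minus_right)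

locale free_brownian = wstar_probability_space A \<tau>
  for A :: "'h::complex_hilbert_space bop set" and \<tau> +
  fixes \<F> :: "real \<Rightarrow> 'h bop set" and B :: "real \<Rightarrow> 'h bop"
  assumes filtration: "vn_filtration A \<F>" and brownian: "free_brownian_motion \<tau> \<F> B"
begin

lemma F_vna: "0 \<le> t \<Longrightarrow> von_neumann_algebra (\<F> t)"
  and F_subset: "0 \<le> t \<Longrightarrow> a \<in> \<F> t \<Longrightarrow> a \<in> A"
  and F_mono: "0 \<le> s \<Longrightarrow> s \<le> t \<Longrightarrow> a \<in> \<F> s \<Longrightarrow> a \<in> \<F> t"
  using filtration unfolding vn_filtration_def by blast+

lemma B_F: "0 \<le> t \<Longrightarrow> B t \<in> \<F> t" and B_adj: "0 \<le> t \<Longrightarrow> adj (B t) = B t"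
  using brownian by (auto simp: free_brownian_motion_def selfadjoint_def)

lemma B_A: "0 \<le> t \<Longrightarrow> B t \<in> A"
  using B_F F_subset by blast

lemma B_increment_moments:
  assumes "0 \<le> s" "s < t"
  shows "\<tau> (B t - B s) = 0" "\<tau> ((B t - B s) * (B t - B s)) = complex_of_real (t - s)"
proof -
  have m: "\<tau> ((B t - B s) ^ n) = complex_of_real
      (integral {- 2 * sqrt (t - s)..2 * sqrt (t - s)} (\<lambda>u. u ^ n * (sqrt (4 * (t - s) - u\<^sup>2) / (2 * pi * (t - s)))))" for n
    using brownian assms unfolding free_brownian_motion_def semicircular_def by blast
  show "\<tau> (B t - B s) = 0"
    using m [of 1] semicircle_mean [of "t - s"] by (simp only: power_one_right of_real_0)
  show "\<tau> ((B t - B s) * (B t - B s)) = complex_of_real (t - s)"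
    using m [of 2] semicircle_variance [of "t - s"] assms by (simp only: power2_eq_square [of "B t - B s"] diff_gt_0_iff_gt)
qed

lemma B_increment_free:
  assumes "0 \<le> s" "s < t" "w \<noteq> []" "distinct_adj (map fst w)"
    and "\<forall>(b, a)\<in>set w. \<tau> a = 0 \<and> (if b then a = B t - B s else a \<in> \<F> s)"
  shows "\<tau> (prod_list (map snd w)) = 0"
proof -
  have "freely_independent \<tau> {B t - B s} (\<F> s)"
    using brownian assms unfolding free_brownian_motion_def by blast
  moreover have "\<forall>(b, a)\<in>set w. a \<in> star_algebra_generated (if b then {B t - B s} else \<F> s) \<and> \<tau> a = 0"
    using assms(5) by (fastforce intro: star_algebra_generated.base)
  ultimately show ?thesis using assms(3,4) unfolding freely_independent_def by blast
qed

lemma tau_mult_increment: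
  assumes "0 \<le> s" "s \<le> t" "c \<in> \<F> s"
  shows "\<tau> (c * (B t - B s)) = 0"
proof (cases "s = t")
  case False
  with assms have st: "s < t" by simp
  note cA = F_subset [OF assms(1,3)]
  note BA = B_A [OF assms(1)] B_A [of t]
  define c0 where "c0 = c - \<tau> c *\<^sub>C 1"
  have c0: "c0 \<in> \<F> s" "\<tau> c0 = 0"
    using assms cA F_vna [OF assms(1)] by (auto simp: c0_def tau_simps intro: vna_diff vna_scaleC vna_one)
  have "\<tau> (c0 * (B t - B s)) = 0"
    using B_increment_free [OF assms(1) st, of "[(False, c0), (True, B t - B s)]"] c0
      B_increment_moments(1) [OF assms(1) st] by simp
  moreover have "c * (B t - B s) = c0 * (B t - B s) + \<tau> c *\<^sub>C (B t - B s)"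
    by (simp add: c0_def algebra_simps scaleC_mult_left scaleC_diff_right)
  ultimately show ?thesis
    using assms cA BA c0(1) F_subset [OF assms(1)] B_increment_moments(1) [OF assms(1) st]
    by (simp add: add scaleC)
qed (simp add: tau_zero)

text \<open>Split \<open>c\<close> and \<open>d\<close> into scalars and centred parts. Freeness
  kills every term with a centred part and leaves the variance of the increment. All later
  covariances originate here.\<close>

lemma tau_mult_increment_mult_increment:
  assumes "0 \<le> s" "s \<le> t" "c \<in> \<F> s" "d \<in> \<F> s"
  shows "\<tau> (c * (B t - B s) * d * (B t - B s)) = complex_of_real (t - s) * \<tau> c * \<tau> d"
proof (cases "s = t")
  case False
  with assms have st: "s < t" by simp
  note cA = F_subset [OF assms(1,3)] F_subset [OF assms(1,4)]
  define D where "D = B t - B s"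
  have DA: "D \<in> A" using B_A assms by (auto simp: D_def)
  note D = B_increment_moments [OF assms(1) st, folded D_def]
  define c0 where "c0 = c - \<tau> c *\<^sub>C 1"
  define d0 where "d0 = d - \<tau> d *\<^sub>C 1"
  have c0: "c0 \<in> \<F> s" "\<tau> c0 = 0" and d0: "d0 \<in> \<F> s" "\<tau> d0 = 0"
    using assms cA F_vna [OF assms(1)] by (auto simp: c0_def d0_def tau_simps intro: vna_diff vna_scaleC vna_one)
  have c0A: "c0 \<in> A" "d0 \<in> A" using c0 d0 F_subset assms by blast+
  note free = B_increment_free [OF assms(1) st, folded D_def]
  have 1: "\<tau> (c0 * D * d0 * D) = 0"
    using free [of "[(False, c0), (True, D), (False, d0), (True, D)]"] c0 d0 D(1)
    by (simp add: mult.assoc)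
  have 2: "\<tau> (D * d0 * D) = 0"
    using free [of "[(True, D), (False, d0), (True, D)]"] d0 D(1)
    by (simp add: mult.assoc)
  \<comment> \<open>\<open>D * D\<close> is not centred, but after a cyclic rotation the two factors
    are separated by \<open>c0\<close> and the word alternates.\<close>
  have 3: "\<tau> (c0 * (D * D)) = 0"
  proof -
    have "\<tau> (D * c0 * D) = 0"
      using free [of "[(True, D), (False, c0), (True, D)]"] c0 D(1)
      by (simp add: mult.assoc)
    then show ?thesis using tracial [of D "c0 * D"] DA c0A by (simp add: mult.assoc)
  qed
  have "c * D * d * D = c0 * D * d0 * D + \<tau> c *\<^sub>C (D * d0 * D) + (\<tau> d *\<^sub>C (c0 * (D * D)) + (\<tau> c * \<tau> d) *\<^sub>C (D * D))"
    by (simp add: c0_def d0_def algebra_simps scaleC_mult_left scaleC_mult_right scaleC_scaleC mult.assoc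
        scaleC_diff_right)
  then have "\<tau> (c * D * d * D) = \<tau> c * \<tau> d * complex_of_real (t - s)"
    using c0A DA 1 2 3 D by (simp add: add scaleC)
  then show ?thesis by (simp add: D_def mult_ac)
qed (simp add: tau_zero)

section \<open>Simple processes and the Ito isometry\<close>

definition elementary_integral :: "real \<times> real \<times> 'h bop \<Rightarrow> 'h bop"
  where "elementary_integral = (\<lambda>(u, v, Y). Y * (B v - B u))"

definition elementary_process :: "real \<times> real \<times> 'h bop \<Rightarrow> real \<Rightarrow> 'h bop"
  where "elementary_process = (\<lambda>(u, v, Y) r. indicat_real {u..<v} r *\<^sub>R Y)"

definition elementary_adapted :: "real \<Rightarrow> real \<Rightarrow> real \<times> real \<times> 'h bop \<Rightarrow> bool"
  where "elementary_adapted a b = (\<lambda>(u, v, Y). a \<le> u \<and> u \<le> v \<and> v \<le> b \<and> Y \<in> \<F> u)"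

text \<open>A simple process is recoded as a list of triples \<open>(u, v, Y)\<close> whose
  intervals may overlap or be empty. Differences and restrictions of processes are then plain list
  operations, without common refinements of partitions.\<close>

definition list_integral :: "(real \<times> real \<times> 'h bop) list \<Rightarrow> 'h bop"
  where "list_integral l = sum_list (map elementary_integral l)"

definition list_process :: "(real \<times> real \<times> 'h bop) list \<Rightarrow> real \<Rightarrow> 'h bop"
  where "list_process l r = sum_list (map (\<lambda>x. elementary_process x r) l)"

definition list_adapted :: "real \<Rightarrow> real \<Rightarrow> (real \<times> real \<times> 'h bop) list \<Rightarrow> bool"
  where "list_adapted a b l \<longleftrightarrow> (\<forall>x\<in>set l. elementary_adapted a b x)"

definition list_neg :: "(real \<times> real \<times> 'h bop) list \<Rightarrow> (real \<times> real \<times> 'h bop) list"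
  where "list_neg = map (\<lambda>(u, v, Y). (u, v, - Y))"

lemma list_simps [simp]:
  "list_integral [] = 0" "list_integral (x # l) = elementary_integral x + list_integral l"
  "list_integral (l @ l') = list_integral l + list_integral l'"
  "list_process [] r = 0" "list_process (x # l) r = elementary_process x r + list_process l r"
  "list_process (l @ l') r = list_process l r + list_process l' r"
  "list_adapted a b []" "list_adapted a b (x # l) \<longleftrightarrow> elementary_adapted a b x \<and> list_adapted a b l"
  "list_adapted a b (l @ l') \<longleftrightarrow> list_adapted a b l \<and> list_adapted a b l'"
  by (auto simp: list_integral_def list_process_def list_adapted_def)

lemma list_neg_simps:
  "list_integral (list_neg l) = - list_integral l" "list_process (list_neg l) r = - list_process l r"
  by (induction l) (auto simp: list_neg_def elementary_integral_def elementary_process_def)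

lemma list_neg_adapted: "0 \<le> a \<Longrightarrow> list_adapted a b l \<Longrightarrow> list_adapted a b (list_neg l)"
  unfolding list_adapted_def list_neg_def elementary_adapted_def
  by (force intro: vna_minus [OF F_vna])

lemma elementary_A:
  assumes "0 \<le> a" "elementary_adapted a b x"
  shows "elementary_integral x \<in> A" "elementary_process x r \<in> A"
proof -
  obtain u v Y where x: "x = (u, v, Y)" by (metis prod_cases3)
  with assms have "0 \<le> u" "0 \<le> v" "Y \<in> \<F> u" by (auto simp: elementary_adapted_def)
  then show "elementary_integral x \<in> A" "elementary_process x r \<in> A"
    using F_subset [of u Y] B_A [of u] B_A [of v]
    by (auto simp: elementary_integral_def elementary_process_def x)
qed

lemma list_A:
  assumes "0 \<le> a" "list_adapted a b l"
  shows "list_integral l \<in> A" "list_process l r \<in> A"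
  using assms(2) by (induction l) (use assms(1) elementary_A in auto)

text \<open>Everything to the left of the later increment is already known at its starting time
  \<open>u'\<close>.\<close>

lemma elementary_pair_disjoint:
  assumes "0 \<le> u" "u \<le> v" "v \<le> u'" "u' \<le> v'" "Y \<in> \<F> u" "Y' \<in> \<F> u'"
  shows "\<tau> (adj (Y * (B v - B u)) * (Y' * (B v' - B u'))) = 0"
proof -
  have "(B v - B u) * adj Y * Y' \<in> \<F> u'"
    using assms by (intro vna_mult vna_diff vna_adj F_vna; (intro F_mono [OF _ _ B_F])?; (intro F_mono [of u u' Y])?) auto
  from tau_mult_increment [OF _ assms(4) this] show ?thesis
    using assms B_adj by (simp add: mult.assoc)
qed

lemma elementary_pair_commute:
  assumes "a \<in> A" "b \<in> A" shows "\<tau> (adj a * b) = cnj (\<tau> (adj b * a))"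
  using tau_adj [of "adj b * a"] assms by simp

lemma elementary_pair_same:
  assumes "0 \<le> u" "u \<le> v" "Y \<in> \<F> u" "Y' \<in> \<F> u"
  shows "\<tau> (adj (Y * (B v - B u)) * (Y' * (B v - B u))) = complex_of_real (v - u) * \<tau> (adj Y * Y')"
proof -
  have "\<tau> (1 * (B v - B u) * (adj Y * Y') * (B v - B u)) = complex_of_real (v - u) * \<tau> 1 * \<tau> (adj Y * Y')"
    using assms by (intro tau_mult_increment_mult_increment vna_mult vna_adj vna_one F_vna) auto
  then show ?thesis using assms B_adj by (simp add: mult.assoc unital)
qed

lemma elementary_pair_same_start:
  assumes "0 \<le> u" "u \<le> v" "v \<le> v'" "Y \<in> \<F> u" "Y' \<in> \<F> u"
  shows "\<tau> (adj (Y * (B v - B u)) * (Y' * (B v' - B u))) = complex_of_real (v - u) * \<tau> (adj Y * Y')"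
proof -
  have Y: "Y \<in> A" "Y' \<in> A" "B u \<in> A" "B v \<in> A" "B v' \<in> A" using assms F_subset B_A by auto
  have "Y' * (B v' - B u) = Y' * (B v - B u) + Y' * (B v' - B v)" by (simp add: algebra_simps)
  then have "\<tau> (adj (Y * (B v - B u)) * (Y' * (B v' - B u))) =
      \<tau> (adj (Y * (B v - B u)) * (Y' * (B v - B u))) + \<tau> (adj (Y * (B v - B u)) * (Y' * (B v' - B v)))"
    using Y by (simp only: distrib_left) (subst add; auto)
  also have "\<tau> (adj (Y * (B v - B u)) * (Y' * (B v' - B v))) = 0"
    using assms F_mono [of u v Y'] by (intro elementary_pair_disjoint) auto
  finally show ?thesis using elementary_pair_same [of u v Y Y'] assms by simp
qed

text \<open>The part of the first interval before \<open>u'\<close> contributes nothing; the rest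
  starts at the same point as the second interval, and only the overlap of the two remains.\<close>

lemma elementary_pair_ordered:
  assumes "0 \<le> u" "u \<le> v" "u \<le> u'" "u' \<le> v'" "Y \<in> \<F> u" "Y' \<in> \<F> u'"
  shows "\<tau> (adj (Y * (B v - B u)) * (Y' * (B v' - B u'))) =
    complex_of_real (max 0 (min v v' - max u u')) * \<tau> (adj Y * Y')"
proof (cases "v \<le> u'")
  case True
  then show ?thesis using assms elementary_pair_disjoint by simp
next
  case False
  have Y: "Y \<in> A" "Y' \<in> A" "B u \<in> A" "B v \<in> A" "B v' \<in> A" "B u' \<in> A"
    using assms F_subset [of u Y] F_subset [of u' Y'] B_A by auto
  have Yu': "Y \<in> \<F> u'" using assms F_mono by blast
  have "Y * (B v - B u) = Y * (B u' - B u) + Y * (B v - B u')" by (simp add: algebra_simps)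
  then have "\<tau> (adj (Y * (B v - B u)) * (Y' * (B v' - B u'))) =
      \<tau> (adj (Y * (B u' - B u)) * (Y' * (B v' - B u'))) + \<tau> (adj (Y * (B v - B u')) * (Y' * (B v' - B u')))"
    using Y by (simp only: adj_simps(2) distrib_right) (subst add; auto)
  also have "\<tau> (adj (Y * (B u' - B u)) * (Y' * (B v' - B u'))) = 0"
    using assms by (intro elementary_pair_disjoint) auto
  also have "\<tau> (adj (Y * (B v - B u')) * (Y' * (B v' - B u'))) =
      complex_of_real (min v v' - u') * \<tau> (adj Y * Y')"
  proof (cases "v \<le> v'")
    case True
    then show ?thesis using False assms Yu' elementary_pair_same_start [of u' v v' Y Y'] by simp
  next
    case F: False
    have 1: "\<tau> (adj (Y' * (B v' - B u')) * (Y * (B v - B u'))) = complex_of_real (v' - u') * \<tau> (adj Y' * Y)"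
      using False F assms Yu' by (intro elementary_pair_same_start) auto
    have "\<tau> (adj (Y * (B v - B u')) * (Y' * (B v' - B u'))) =
        cnj (\<tau> (adj (Y' * (B v' - B u')) * (Y * (B v - B u'))))"
      by (rule elementary_pair_commute) (use Y in auto)
    also have "\<dots> = complex_of_real (v' - u') * cnj (\<tau> (adj Y' * Y))"
      by (simp only: 1 complex_cnj_mult complex_cnj_complex_of_real)
    also have "cnj (\<tau> (adj Y' * Y)) = \<tau> (adj Y * Y')"
      by (rule elementary_pair_commute [symmetric]) (use Y in auto)
    finally show ?thesis using F by simp
  qed
  finally show ?thesis using assms False by (simp add: max_def min_def)
qed

lemma elementary_pair:
  assumes "0 \<le> u" "u \<le> v" "0 \<le> u'" "u' \<le> v'" "Y \<in> \<F> u" "Y' \<in> \<F> u'"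
  shows "\<tau> (adj (Y * (B v - B u)) * (Y' * (B v' - B u'))) =
    complex_of_real (max 0 (min v v' - max u u')) * \<tau> (adj Y * Y')"
proof (cases "u \<le> u'")
  case True
  then show ?thesis using assms elementary_pair_ordered by simp
next
  case False
  have Y: "Y \<in> A" "Y' \<in> A" "B u \<in> A" "B v \<in> A" "B v' \<in> A" "B u' \<in> A"
    using assms F_subset [of u Y] F_subset [of u' Y'] B_A by auto
  have 1: "\<tau> (adj (Y' * (B v' - B u')) * (Y * (B v - B u))) =
    complex_of_real (max 0 (min v' v - max u' u)) * \<tau> (adj Y' * Y)"
    using False assms by (intro elementary_pair_ordered) auto
  have "\<tau> (adj (Y * (B v - B u)) * (Y' * (B v' - B u'))) =
      cnj (\<tau> (adj (Y' * (B v' - B u')) * (Y * (B v - B u))))"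
    by (rule elementary_pair_commute) (use Y in auto)
  also have "\<dots> = complex_of_real (max 0 (min v' v - max u' u)) * cnj (\<tau> (adj Y' * Y))"
    by (simp only: 1 complex_cnj_mult complex_cnj_complex_of_real)
  also have "cnj (\<tau> (adj Y' * Y)) = \<tau> (adj Y * Y')"
    by (rule elementary_pair_commute [symmetric]) (use Y in auto)
  finally show ?thesis by (simp only: min.commute [of v'] max.commute [of u'])
qed

lemma has_integral_indicat_interval:
  fixes a b u v :: real
  assumes "a \<le> u" "v \<le> b"
  shows "(indicat_real {u..<v} has_integral max 0 (v - u)) {a..b}"
proof (cases "u \<le> v")
  case True
  have "((\<lambda>x. 1::real) has_integral (v - u)) {u..v}"
    using has_integral_const_real [of "1::real" u v] True by simp
  then have "((\<lambda>x. if x \<in> {u..v} then 1 else 0::real) has_integral (v - u)) {a..b}"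
    using assms True by (subst has_integral_restrict) auto
  then have "(indicat_real {u..<v} has_integral (v - u)) {a..b}"
    by (rule has_integral_spike_finite [of "{v}", rotated 2]) (auto simp: indicator_def)
  then show ?thesis using True by simp
next
  case False
  then show ?thesis by (simp add: has_integral_is_0)
qed

lemma elementary_isometry:
  assumes a: "0 \<le> a" and x: "elementary_adapted a b x" and y: "elementary_adapted a b y"
  shows "((\<lambda>r. \<tau> (adj (elementary_process x r) * elementary_process y r)) has_integral
    \<tau> (adj (elementary_integral x) * elementary_integral y)) {a..b}"
proof -
  obtain u v Y u' v' Y' where xy: "x = (u, v, Y)" "y = (u', v', Y')" by (metis prod_cases3)
  note H = x [unfolded xy elementary_adapted_def, simplified] y [unfolded xy elementary_adapted_def, simplified]
  have YA: "Y \<in> A" "Y' \<in> A" using H a F_subset [of u Y] F_subset [of u' Y'] by auto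
  have "((\<lambda>r. complex_of_real (indicat_real {max u u'..<min v v'} r) * \<tau> (adj Y * Y')) has_integral
      complex_of_real (max 0 (min v v' - max u u')) * \<tau> (adj Y * Y')) {a..b}"
    using H by (intro has_integral_mult_left has_integral_of_real has_integral_indicat_interval) auto
  also have "(\<lambda>r. complex_of_real (indicat_real {max u u'..<min v v'} r) * \<tau> (adj Y * Y')) =
      (\<lambda>r. \<tau> (adj (elementary_process x r) * elementary_process y r))"
    using YA by (auto simp: fun_eq_iff elementary_process_def xy indicator_def tau_zero)
  finally show ?thesis
    using elementary_pair [of u v u' v' Y Y'] H a by (simp add: xy elementary_integral_def)
qed

lemma list_isometry:
  assumes a: "0 \<le> a" and l: "list_adapted a b l" and l': "list_adapted a b l'"
  shows "((\<lambda>r. \<tau> (adj (list_process l r) * list_process l' r)) has_integral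
    \<tau> (adj (list_integral l) * list_integral l')) {a..b}"
  using l
proof (induction l)
  case (Cons x l)
  have x: "elementary_adapted a b x" and l: "list_adapted a b l" using Cons.prems by simp_all
  have "((\<lambda>r. \<tau> (adj (elementary_process x r) * list_process l' r)) has_integral
      \<tau> (adj (elementary_integral x) * list_integral l')) {a..b}"
    using l'
  proof (induction l')
    case (Cons y l')
    have y: "elementary_adapted a b y" and l': "list_adapted a b l'" using Cons.prems by simp_all
    show ?case
      using has_integral_add [OF elementary_isometry [OF a x y] Cons.IH [OF l']]
        elementary_A [OF a x] elementary_A [OF a y] list_A [OF a l']
      by (simp add: distrib_left add)
  qed (simp add: tau_zero)
  from has_integral_add [OF this Cons.IH [OF l]] show ?case
    using elementary_A [OF a x] list_A [OF a l] list_A [OF a l'] by (simp add: distrib_right add)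
qed (simp add: tau_zero)

lemma list_norm2_isometry:
  assumes a: "0 \<le> a" and l: "list_adapted a b l"
  shows "((\<lambda>r. (norm2 \<tau> (list_process l r))\<^sup>2) has_integral (norm2 \<tau> (list_integral l))\<^sup>2) {a..b}"
  using has_integral_Re [OF list_isometry [OF a l l]] list_A [OF a l] by (simp add: norm2_square_Re)

lemma tau_mult_list_integral:
  assumes a: "0 \<le> a" and l: "list_adapted a b l" and c: "c \<in> \<F> a"
  shows "\<tau> (c * list_integral l) = 0"
  using l
proof (induction l)
  case (Cons x l)
  obtain u v Y where x: "x = (u, v, Y)" by (metis prod_cases3)
  have H: "a \<le> u" "u \<le> v" "v \<le> b" "Y \<in> \<F> u" "list_adapted a b l"
    using Cons.prems by (auto simp: x elementary_adapted_def)
  have cY: "c * Y \<in> \<F> u" using H a c F_mono [of a u c] F_vna [of u] by (auto intro: vna_mult)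
  have "\<tau> (c * Y * (B v - B u)) = 0" using H a cY by (intro tau_mult_increment) auto
  then show ?case
    using Cons.IH [OF H(5)] list_A [OF a H(5)] elementary_A(1) [OF a, of b x] Cons.prems F_subset [OF a c]
    by (simp add: distrib_left add) (simp add: x elementary_integral_def mult.assoc)
qed (simp add: tau_zero)

text \<open>The stochastic integral in the list encoding and over \<open>[s, t]\<close> rather than
  \<open>[0, t]\<close>, so that increments of a stochastic integral are covered too.\<close>

definition ito_limit :: "real \<Rightarrow> real \<Rightarrow> (real \<Rightarrow> 'h bop) \<Rightarrow> 'h bop \<Rightarrow> bool"
  where "ito_limit s t Z M \<longleftrightarrow> (\<exists>L e. (\<forall>k::nat. list_adapted s t (L k)) \<and>
    (\<forall>k. ((\<lambda>r. (norm2 \<tau> (Z r - list_process (L k) r))\<^sup>2) has_integral e k) {s..t}) \<and>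
    e \<longlonglongrightarrow> 0 \<and> (\<lambda>k. norm2 \<tau> (M - list_integral (L k))) \<longlonglongrightarrow> 0)"

lemma ito_limit_of_free_ito_integral:
  assumes "has_free_ito_integral \<tau> \<F> B Z t I"
  shows "ito_limit 0 t Z I"
proof -
  obtain n :: "nat \<Rightarrow> nat" and p Y e where
    ad: "\<And>k. simple_adapted \<F> t (n k) (p k) (Y k)" and
    int: "\<And>k. ((\<lambda>s. (norm2 \<tau> (Z s - simple_process (n k) (p k) (Y k) s))\<^sup>2) has_integral e k) {0..t}" and
    e: "e \<longlonglongrightarrow> 0" and lim: "(\<lambda>k. norm2 \<tau> (I - simple_integral B (n k) (p k) (Y k))) \<longlonglongrightarrow> 0"
    using assms unfolding has_free_ito_integral_def by blast
  define L where "L k = map (\<lambda>i. (p k i, p k (Suc i), Y k i)) [0..<n k]" for k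
  have "list_adapted 0 t (L k)" for k
  proof -
    from ad [of k] have p0: "p k 0 = 0" and pn: "p k (n k) = t" and pY: "\<And>i. i < n k \<Longrightarrow> p k i < p k (Suc i) \<and> Y k i \<in> \<F> (p k i)"
      by (auto simp: simple_adapted_def)
    have mono: "p k i \<le> p k j" if "i \<le> j" "j \<le> n k" for i j
      using that
    proof (induction j rule: dec_induct)
      case (step m)
      then show ?case using pY [of m] by simp
    qed simp
    show ?thesis
      using mono [of 0] mono [of _ "n k"] pY p0 pn
      by (auto simp: L_def list_adapted_def elementary_adapted_def less_imp_le Suc_le_eq)
  qed
  moreover have "list_process (L k) = simple_process (n k) (p k) (Y k)" for k
    by (rule ext) (simp add: L_def list_process_def simple_process_def elementary_process_def o_def
        interv_sum_list_conv_sum_set_nat atLeast0LessThan)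
  moreover have "list_integral (L k) = simple_integral B (n k) (p k) (Y k)" for k
    by (simp add: L_def list_integral_def simple_integral_def elementary_integral_def o_def
        interv_sum_list_conv_sum_set_nat atLeast0LessThan)
  ultimately show ?thesis
    unfolding ito_limit_def using int e lim by (intro exI [of _ L] exI [of _ e]) simp
qed

definition clip_above :: "real \<Rightarrow> (real \<times> real \<times> 'h bop) list \<Rightarrow> (real \<times> real \<times> 'h bop) list"
  where "clip_above s = map (\<lambda>(u, v, Y). (max s u, max s v, Y))"

text \<open>An interval to the right of \<open>s\<close> collapses to the point \<open>s\<close>, where its value need not be
  adapted; the value is irrelevant and is replaced by zero.\<close>

definition clip_below :: "real \<Rightarrow> (real \<times> real \<times> 'h bop) list \<Rightarrow> (real \<times> real \<times> 'h bop) list"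
  where "clip_below s = map (\<lambda>(u, v, Y). (min s u, min s v, if u \<le> s then Y else 0))"

lemma clip_adapted:
  assumes "0 \<le> s" "s \<le> t" "list_adapted 0 t l"
  shows "list_adapted s t (clip_above s l)" "list_adapted 0 s (clip_below s l)"
proof -
  have "elementary_adapted s t (max s u, max s v, Y)"
    "elementary_adapted 0 s (min s u, min s v, if u \<le> s then Y else 0)"
    if "elementary_adapted 0 t (u, v, Y)" for u v Y
    using that assms(1,2) F_mono [of u "max s u" Y] vna_zero [OF F_vna [of s]]
    by (auto simp: elementary_adapted_def min_def)
  with assms(3) show "list_adapted s t (clip_above s l)" "list_adapted 0 s (clip_below s l)"
    unfolding list_adapted_def clip_above_def clip_below_def by (force, force)
qed

text \<open>The intervals are half open, so the cutting point \<open>s\<close> itself belongs to the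
  upper part.\<close>

lemma clip_process:
  "s \<le> r \<Longrightarrow> list_process (clip_above s l) r = list_process l r"
  "r < s \<Longrightarrow> list_process (clip_below s l) r = list_process l r"
  by (induction l) (auto simp: clip_above_def clip_below_def elementary_process_def indicator_def)

lemma clip_integral:
  assumes "list_adapted 0 t l"
  shows "list_integral l = list_integral (clip_below s l) + list_integral (clip_above s l)"
  using assms
proof (induction l)
  case (Cons x l)
  obtain u v Y where x: "x = (u, v, Y)" by (metis prod_cases3)
  have "u \<le> v" using Cons.prems by (simp add: x elementary_adapted_def)
  then have "Y * (B v - B u) =
      (if u \<le> s then Y else 0) * (B (min s v) - B (min s u)) + Y * (B (max s v) - B (max s u))"
    by (auto simp: min_def max_def algebra_simps)
  then show ?case
    using Cons by (simp add: x clip_below_def clip_above_def elementary_integral_def)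
qed (simp add: clip_below_def clip_above_def)

text \<open>The isometry as an estimate: any integrable majorant of the squared distance of the
  processes bounds that of the integrals. The right end point is left out because half-open
  intervals do not reach it, and one point does not affect the integral.\<close>

lemma list_integral_approx:
  assumes a: "0 \<le> a" "a \<le> b" and l: "list_adapted a b l" "list_adapted a b l'"
    and g: "(g has_integral c) {a..b}"
    and le: "\<And>r. a \<le> r \<Longrightarrow> r < b \<Longrightarrow> (norm2 \<tau> (list_process l r - list_process l' r))\<^sup>2 \<le> g r"
  shows "(norm2 \<tau> (list_integral l - list_integral l'))\<^sup>2 \<le> c"
proof -
  have "list_adapted a b (l @ list_neg l')" using l list_neg_adapted [OF a(1)] by simp
  from list_norm2_isometry [OF a(1) this]
  have "((\<lambda>r. (norm2 \<tau> (list_process l r - list_process l' r))\<^sup>2) has_integral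
      (norm2 \<tau> (list_integral l - list_integral l'))\<^sup>2) {a..b}"
    by (simp add: list_neg_simps)
  then have "((\<lambda>r. if r = b then g b else (norm2 \<tau> (list_process l r - list_process l' r))\<^sup>2) has_integral
      (norm2 \<tau> (list_integral l - list_integral l'))\<^sup>2) {a..b}"
    by (rule has_integral_spike_finite [of "{b}", rotated 2]) auto
  then show ?thesis using g by (rule has_integral_le) (auto intro: le)
qed

lemma norm2_diff_square_le:
  assumes "x \<in> A" "y \<in> A" "z \<in> A"
  shows "(norm2 \<tau> (x - y))\<^sup>2 \<le> 2 * (norm2 \<tau> (z - x))\<^sup>2 + 2 * (norm2 \<tau> (z - y))\<^sup>2"
  using norm2_parallelogram_le [of "x - z" "z - y"] assms norm2_minus_commute [of x z] by simp

lemma norm2_diff_triangle: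
  assumes "x \<in> A" "y \<in> A" "z \<in> A"
  shows "norm2 \<tau> (x - z) \<le> norm2 \<tau> (x - y) + norm2 \<tau> (y - z)"
  using norm2_triangle [of "x - y" "y - z"] assms by simp

text \<open>Cut the approximants of \<open>I'\<close> at \<open>s\<close>. Their lower parts
  approximate the same process as the approximants of \<open>I\<close>, so by the isometry the two
  integrals merge in the limit; the upper parts are left to converge to
  \<open>I' - I\<close>.\<close>

lemma ito_limit_increment:
  assumes st: "0 \<le> s" "s \<le> t" and Z: "\<And>r. 0 \<le> r \<Longrightarrow> r \<le> t \<Longrightarrow> Z r \<in> A"
    and I: "I \<in> A" "I' \<in> A" and lim: "ito_limit 0 s Z I" and lim': "ito_limit 0 t Z I'"
  shows "ito_limit s t Z (I' - I)"
proof -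
  obtain L e where L: "\<And>k::nat. list_adapted 0 s (L k)"
    "\<And>k. ((\<lambda>r. (norm2 \<tau> (Z r - list_process (L k) r))\<^sup>2) has_integral e k) {0..s}"
    and e: "e \<longlonglongrightarrow> 0" and LI: "(\<lambda>k. norm2 \<tau> (I - list_integral (L k))) \<longlonglongrightarrow> 0"
    using lim unfolding ito_limit_def by blast
  obtain L' e' where L': "\<And>k::nat. list_adapted 0 t (L' k)"
    "\<And>k. ((\<lambda>r. (norm2 \<tau> (Z r - list_process (L' k) r))\<^sup>2) has_integral e' k) {0..t}"
    and e': "e' \<longlonglongrightarrow> 0" and LI': "(\<lambda>k. norm2 \<tau> (I' - list_integral (L' k))) \<longlonglongrightarrow> 0"
    using lim' unfolding ito_limit_def by blast
  let ?P = "\<lambda>k. list_integral (L k)" and ?P' = "\<lambda>k. list_integral (L' k)"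
    and ?Q = "\<lambda>k. list_integral (clip_below s (L' k))" and ?Q' = "\<lambda>k. list_integral (clip_above s (L' k))"
  define f where "f k r = (norm2 \<tau> (Z r - list_process (L' k) r))\<^sup>2" for k r
  have fint: "f k integrable_on {a..b}" if "0 \<le> a" "b \<le> t" for k a b
    by (rule integrable_on_subinterval [of _ "{0..t}"])
      (use L'(2) that in \<open>auto simp: f_def [abs_def] integrable_on_def\<close>)
  have e'_eq: "integral {0..t} (f k) = e' k" for k
    using L'(2) [of k] by (simp add: f_def [abs_def] integral_unique)
  have fle: "integral {a..b} (f k) \<le> e' k" if "0 \<le> a" "b \<le> t" for k a b
    unfolding e'_eq [symmetric] by (rule integral_subset_le) (use fint that st in \<open>auto simp: f_def\<close>)
  have f0: "0 \<le> integral {a..b} (f k)" if "0 \<le> a" "b \<le> t" for k a b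
    by (rule integral_nonneg) (use fint that in \<open>auto simp: f_def\<close>)
  have LA: "?P k \<in> A" "list_process (L k) r \<in> A" "?P' k \<in> A" "list_process (L' k) r \<in> A"
    for k r using list_A [OF order_refl L(1)] list_A [OF order_refl L'(1)] by auto
  note clipA = clip_adapted [OF st L'(1)]
  have clA: "?Q k \<in> A" "?Q' k \<in> A" for k
    using list_A(1) [OF order_refl clipA(2)] list_A(1) [OF st(1) clipA(1)] by auto
  have diff: "(norm2 \<tau> (?P k - ?Q k))\<^sup>2 \<le> 2 * e k + 2 * e' k" for k
  proof -
    have "(norm2 \<tau> (?P k - ?Q k))\<^sup>2 \<le>
        2 * e k + 2 * integral {0..s} (f k)"
    proof (rule list_integral_approx [OF order_refl st(1) L(1) clipA(2)])
      show "((\<lambda>r. 2 * (norm2 \<tau> (Z r - list_process (L k) r))\<^sup>2 + 2 * f k r) has_integral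
          2 * e k + 2 * integral {0..s} (f k)) {0..s}"
        using fint [of 0 s k] st L(2) [of k]
        by (intro has_integral_add has_integral_mult_right) (auto simp: has_integral_integral)
      show "(norm2 \<tau> (list_process (L k) r - list_process (clip_below s (L' k)) r))\<^sup>2
          \<le> 2 * (norm2 \<tau> (Z r - list_process (L k) r))\<^sup>2 + 2 * f k r" if "0 \<le> r" "r < s" for r
        using that st Z [of r] LA by (simp add: clip_process f_def norm2_diff_square_le)
    qed
    with fle [of 0 s k] st show ?thesis by linarith
  qed
  have lim_diff: "(\<lambda>k. norm2 \<tau> (?P k - ?Q k)) \<longlonglongrightarrow> 0"
  proof (rule tendsto_sandwich [OF _ _ tendsto_const])
    show "(\<lambda>k. sqrt (2 * e k + 2 * e' k)) \<longlonglongrightarrow> 0"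
      using tendsto_real_sqrt [OF tendsto_add [OF tendsto_mult_right_zero [OF e, of 2] tendsto_mult_right_zero [OF e', of 2]]]
      by simp
    show "\<forall>\<^sub>F k in sequentially. norm2 \<tau> (?P k - ?Q k)
        \<le> sqrt (2 * e k + 2 * e' k)"
      by (rule always_eventually, rule allI, rule real_le_rsqrt, rule diff)
  qed (use LA clA in \<open>auto intro!: always_eventually norm2_nonneg\<close>)
  have "(\<lambda>k. norm2 \<tau> (I' - I - ?Q' k)) \<longlonglongrightarrow> 0"
  proof (rule tendsto_sandwich [OF _ _ tendsto_const])
    show "(\<lambda>k. norm2 \<tau> (I' - ?P' k) + (norm2 \<tau> (I - ?P k) +
        norm2 \<tau> (?P k - ?Q k))) \<longlonglongrightarrow> 0"
      using tendsto_add [OF LI' tendsto_add [OF LI lim_diff]] by simp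
    show "\<forall>\<^sub>F k in sequentially. norm2 \<tau> (I' - I - ?Q' k) \<le>
        norm2 \<tau> (I' - ?P' k) + (norm2 \<tau> (I - ?P k) + norm2 \<tau> (?P k - ?Q k))"
    proof (intro always_eventually allI)
      fix k
      have "I' - I - ?Q' k = (I' - ?P' k) - (I - ?Q k)"
        using clip_integral [OF L'(1), of k s] by simp
      also have "norm2 \<tau> \<dots> \<le> norm2 \<tau> (I' - ?P' k) + norm2 \<tau> (I - ?Q k)"
        by (rule norm2_triangle_diff) (use I LA clA in auto)
      also have "norm2 \<tau> (I - ?Q k) \<le>
          norm2 \<tau> (I - ?P k) + norm2 \<tau> (?P k - ?Q k)"
        by (rule norm2_diff_triangle) (use I LA clA in auto)
      finally show "norm2 \<tau> (I' - I - ?Q' k) \<le>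
          norm2 \<tau> (I' - ?P' k) + (norm2 \<tau> (I - ?P k) + norm2 \<tau> (?P k - ?Q k))" by simp
    qed
  qed (use I clA in \<open>auto intro!: always_eventually norm2_nonneg\<close>)
  moreover have "(\<lambda>k. integral {s..t} (f k)) \<longlonglongrightarrow> 0"
    by (rule tendsto_sandwich [OF _ _ tendsto_const e']) (use fle f0 st in auto)
  moreover have "((\<lambda>r. (norm2 \<tau> (Z r - list_process (clip_above s (L' k)) r))\<^sup>2) has_integral integral {s..t} (f k)) {s..t}" for k
    by (rule has_integral_eq [OF _ integrable_integral [OF fint]]) (use st in \<open>auto simp: f_def clip_process\<close>)
  ultimately show ?thesis
    unfolding ito_limit_def using clipA(1) by (intro exI [of _ "\<lambda>k. clip_above s (L' k)"] exI [of _ "\<lambda>k. integral {s..t} (f k)"]) simp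
qed

text \<open>The martingale property, which holds for simple integrals and survives L2 limits by
  Cauchy-Schwarz.\<close>

lemma tau_mult_ito_limit:
  assumes s: "0 \<le> s" and M: "M \<in> A" "ito_limit s t Z M" and c: "c \<in> \<F> s"
  shows "\<tau> (c * M) = 0"
proof -
  obtain L where L: "\<And>k::nat. list_adapted s t (L k)" "(\<lambda>k. norm2 \<tau> (M - list_integral (L k))) \<longlonglongrightarrow> 0"
    using M(2) unfolding ito_limit_def by blast
  note cA = F_subset [OF s c]
  have "cmod (\<tau> (c * M)) \<le> norm2 \<tau> c * norm2 \<tau> (M - list_integral (L k))" for k
  proof -
    have "\<tau> (c * (M - list_integral (L k))) = \<tau> (c * M)"
      using tau_mult_list_integral [OF s L(1) c, of k] cA M(1) list_A(1) [OF s L(1), of k]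
      by (simp add: right_diff_distrib tau_diff)
    then show ?thesis
      using tau_mult_le [OF cA, of "M - list_integral (L k)"] M(1) list_A(1) [OF s L(1), of k] by simp
  qed
  then have "cmod (\<tau> (c * M)) \<le> 0"
    by (intro LIMSEQ_le_const [OF tendsto_mult_right_zero [OF L(2), of "norm2 \<tau> c"]]) auto
  then show ?thesis by simp
qed

text \<open>Freezing the integrand at its initial value means comparing with the process of a single
  interval. The factor 2 arises from inserting \<open>Z r\<close> between the approximant and
  \<open>Z s\<close>.\<close>

lemma ito_limit_approx:
  assumes s: "0 \<le> s" "s \<le> t" and M: "M \<in> A" "ito_limit s t Z M"
    and Z: "\<And>r. s \<le> r \<Longrightarrow> r \<le> t \<Longrightarrow> Z r \<in> A" and Zs: "Z s \<in> \<F> s"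
    and K: "\<And>r. s \<le> r \<Longrightarrow> r \<le> t \<Longrightarrow> (norm2 \<tau> (Z r - Z s))\<^sup>2 \<le> K"
  shows "(norm2 \<tau> (M - Z s * (B t - B s)))\<^sup>2 \<le> 2 * K * (t - s)"
proof -
  obtain L e where L: "\<And>k::nat. list_adapted s t (L k)"
      "\<And>k. ((\<lambda>r. (norm2 \<tau> (Z r - list_process (L k) r))\<^sup>2) has_integral e k) {s..t}" "e \<longlonglongrightarrow> 0"
      and lim: "(\<lambda>k. norm2 \<tau> (M - list_integral (L k))) \<longlonglongrightarrow> 0"
    using M(2) unfolding ito_limit_def by blast
  note ZsA = F_subset [OF s(1) Zs]
  define l where "l = [(s, t, Z s)]"
  have l: "list_adapted s t l" using s Zs by (simp add: l_def elementary_adapted_def)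
  have lI: "list_integral l = Z s * (B t - B s)" by (simp add: l_def elementary_integral_def)
  have lA: "list_integral l \<in> A" using list_A(1) [OF s(1) l] .
  have bnd: "(norm2 \<tau> (list_integral (L k) - list_integral l))\<^sup>2 \<le> 2 * e k + 2 * K * (t - s)" for k
  proof (rule list_integral_approx [OF s L(1) l])
    have "((\<lambda>r. 2 * K) has_integral 2 * K * (t - s)) {s..t}"
      using has_integral_const_real [of "2 * K" s t] s by (simp add: mult_ac)
    then show "((\<lambda>r. 2 * (norm2 \<tau> (Z r - list_process (L k) r))\<^sup>2 + 2 * K) has_integral 2 * e k + 2 * K * (t - s)) {s..t}"
      by (intro has_integral_add has_integral_mult_right L(2))
    fix r assume r: "s \<le> r" "r < t"
    then have "list_process l r = Z s" by (simp add: l_def elementary_process_def)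
    then show "(norm2 \<tau> (list_process (L k) r - list_process l r))\<^sup>2 \<le> 2 * (norm2 \<tau> (Z r - list_process (L k) r))\<^sup>2 + 2 * K"
      using norm2_diff_square_le [of "list_process (L k) r" "Z s" "Z r"] K [of r] r Z [of r] ZsA
        list_A(2) [OF s(1) L(1), of k r] by simp
  qed
  have "norm2 \<tau> (M - list_integral l) \<le> norm2 \<tau> (M - list_integral (L k)) + sqrt (2 * e k + 2 * K * (t - s))" for k
    using norm2_diff_triangle [of M "list_integral (L k)" "list_integral l"] M(1) lA list_A(1) [OF s(1) L(1), of k]
      real_le_rsqrt [OF bnd [of k]] by simp
  moreover have "(\<lambda>k. norm2 \<tau> (M - list_integral (L k)) + sqrt (2 * e k + 2 * K * (t - s))) \<longlonglongrightarrow>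
      0 + sqrt (2 * 0 + 2 * K * (t - s))"
    by (intro tendsto_intros lim L(3))
  ultimately have "norm2 \<tau> (M - list_integral l) \<le> 0 + sqrt (2 * 0 + 2 * K * (t - s))"
    by (intro LIMSEQ_le_const) auto
  then have "(norm2 \<tau> (M - list_integral l))\<^sup>2 \<le> (sqrt (2 * K * (t - s)))\<^sup>2"
    using M(1) lA by (intro power_mono) (auto intro: norm2_nonneg)
  moreover have "0 \<le> 2 * K * (t - s)"
    using K [of s] s by (intro mult_nonneg_nonneg) (auto simp: norm2_zero)
  ultimately show ?thesis by (simp add: lI)
qed

end

subsection \<open>Differential equations from one-sided increments\<close>

text \<open>Only forward increments are estimated, but uniformly in the starting point. A left
  difference quotient at \<open>t\<close> is a forward one from some \<open>y < t\<close>, with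
  \<open>g y\<close> in place of \<open>g t\<close>; continuity of \<open>g\<close> repairs
  this.\<close>

lemma has_vector_derivative_of_increments:
  fixes f g :: "real \<Rightarrow> complex"
  assumes inc: "\<And>s h. a \<le> s \<Longrightarrow> 0 \<le> h \<Longrightarrow> h \<le> 1 \<Longrightarrow> norm (f (s + h) - f s - h *\<^sub>R g s) \<le> K * h * sqrt h"
    and g: "continuous_on {a..} g" and t: "a \<le> t"
  shows "(f has_vector_derivative g t) (at t within {a..})"
  unfolding has_vector_derivative_def has_derivative_within_alt
proof (intro conjI allI impI)
  show "bounded_linear (\<lambda>x. x *\<^sub>R g t)" by (rule bounded_linear_scaleR_left)
  fix e :: real assume e: "0 < e"
  define K' where "K' = \<bar>K\<bar> + 1"
  have K': "K' > 0" "K \<le> K'" by (auto simp: K'_def)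
  obtain d0 where d0: "0 < d0" "\<And>y. a \<le> y \<Longrightarrow> \<bar>y - t\<bar> < d0 \<Longrightarrow> norm (g y - g t) < e / 2"
    using g [unfolded continuous_on_iff, rule_format, of t "e / 2"] t e by (auto simp: dist_norm)
  \<comment> \<open>Below \<open>d\<close> the error \<open>K * h * sqrt h\<close> is at most
    \<open>e / 2 * h\<close>; the other half of \<open>e\<close> pays for the variation of
    \<open>g\<close>.\<close>
  define d where "d = min 1 (min d0 ((e / (2 * K'))\<^sup>2))"
  have d: "0 < d" using d0(1) e K' by (simp add: d_def)
  have small: "K * h * sqrt h \<le> e / 2 * h" if "0 \<le> h" "h < d" for h
  proof -
    have "sqrt h \<le> e / (2 * K')" using that e K' by (intro real_le_lsqrt) (auto simp: d_def)
    then have "K' * sqrt h \<le> e / 2" using K' by (simp add: field_simps)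
    moreover have "K * sqrt h \<le> K' * sqrt h" using K' that by (intro mult_right_mono) auto
    ultimately have "h * (K * sqrt h) \<le> h * (e / 2)" using that by (intro mult_left_mono) auto
    then show ?thesis by (simp add: mult_ac)
  qed
  show "\<exists>d>0. \<forall>y\<in>{a..}. norm (y - t) < d \<longrightarrow> norm (f y - f t - (y - t) *\<^sub>R g t) \<le> e * norm (y - t)"
  proof (intro exI [of _ d] conjI ballI impI d)
    fix y assume y: "y \<in> {a..}" "norm (y - t) < d"
    show "norm (f y - f t - (y - t) *\<^sub>R g t) \<le> e * norm (y - t)"
    proof (cases "t \<le> y")
      case True
      have "norm (f y - f t - (y - t) *\<^sub>R g t) \<le> K * (y - t) * sqrt (y - t)"
        using inc [OF t, of "y - t"] True y by (simp add: d_def)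
      also have "\<dots> \<le> e / 2 * (y - t)" using small [of "y - t"] y True by simp
      also have "\<dots> \<le> e * (y - t)" using e True by simp
      finally show ?thesis using True by simp
    next
      case False
      define h where "h = t - y"
      have h: "0 \<le> h" "h < d" "h \<le> 1" using False y by (auto simp: h_def d_def)
      have "f y - f t - (y - t) *\<^sub>R g t = - (f (y + h) - f y - h *\<^sub>R g y) - h *\<^sub>R (g y - g t)"
        by (simp add: h_def algebra_simps)
      also have "norm \<dots> \<le> norm (f (y + h) - f y - h *\<^sub>R g y) + norm (h *\<^sub>R (g y - g t))"
        using norm_triangle_ineq4 [of "- (f (y + h) - f y - h *\<^sub>R g y)" "h *\<^sub>R (g y - g t)"]
        by (simp only: norm_minus_cancel)
      also have "norm (f (y + h) - f y - h *\<^sub>R g y) \<le> e / 2 * h"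
        using inc [of y h] small [of h] y h by force
      also have "norm (h *\<^sub>R (g y - g t)) \<le> h * (e / 2)"
        using d0(2) [of y] y h mult_left_mono [of "norm (g y - g t)" "e / 2" h] by (simp add: d_def)
      finally show ?thesis using False by (simp add: h_def mult_ac)
    qed
  qed
qed

text \<open>Bootstraps the continuity asked for above: in the applications \<open>g\<close> is an
  expression in functions of the same kind as \<open>f\<close>, a priori only bounded, and
  boundedness already makes \<open>f\<close> Lipschitz over short times.\<close>

lemma continuous_on_of_increments:
  fixes f :: "real \<Rightarrow> complex"
  assumes inc: "\<And>s h. a \<le> s \<Longrightarrow> 0 \<le> h \<Longrightarrow> h \<le> 1 \<Longrightarrow> norm (f (s + h) - f s - h *\<^sub>R g s) \<le> K * h * sqrt h"
    and C: "\<And>s. a \<le> s \<Longrightarrow> norm (g s) \<le> C"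
  shows "continuous_on {a..} f"
proof -
  define K' where "K' = \<bar>K\<bar> + C + 1"
  have "0 \<le> C" using C [of a] norm_ge_zero order_trans by blast
  then have K': "0 < K'" by (simp add: K'_def)
  have lip: "norm (f (s + h) - f s) \<le> K' * h" if "a \<le> s" "0 \<le> h" "h \<le> 1" for s h
  proof -
    have "norm (f (s + h) - f s) \<le> norm (f (s + h) - f s - h *\<^sub>R g s) + norm (h *\<^sub>R g s)"
      using norm_triangle_ineq [of "f (s + h) - f s - h *\<^sub>R g s" "h *\<^sub>R g s"] by simp
    also have "norm (f (s + h) - f s - h *\<^sub>R g s) \<le> \<bar>K\<bar> * h * 1"
    proof (rule order_trans [OF inc [OF that]])
      show "K * h * sqrt h \<le> \<bar>K\<bar> * h * 1" using that by (intro mult_mono) auto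
    qed
    also have "norm (h *\<^sub>R g s) \<le> C * h" using C [of s] that mult_right_mono [of "norm (g s)" C h] by (simp add: mult.commute)
    finally show ?thesis using that by (simp add: K'_def algebra_simps)
  qed
  show ?thesis
    unfolding continuous_on_iff
  proof (intro ballI allI impI)
    fix x e :: real assume x: "x \<in> {a..}" and e: "0 < e"
    show "\<exists>d>0. \<forall>x'\<in>{a..}. dist x' x < d \<longrightarrow> dist (f x') (f x) < e"
    proof (intro exI [of _ "min 1 (e / K')"] conjI ballI impI)
      fix y assume y: "y \<in> {a..}" "dist y x < min 1 (e / K')"
      have "norm (f y - f x) \<le> K' * \<bar>y - x\<bar>"
        using lip [of x "y - x"] lip [of y "x - y"] x y norm_minus_commute [of "f x" "f y"]
        by (cases "x \<le> y") (auto simp: dist_norm)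
      also have "\<dots> < e" using y(2) K' by (simp add: dist_norm field_simps)
      finally show "dist (f y) (f x) < e" by (simp add: dist_norm)
    qed (use e K' in auto)
  qed
qed

lemma linear_ode_of_increments:
  fixes f r :: "real \<Rightarrow> complex"
  assumes inc: "\<And>s h. a \<le> s \<Longrightarrow> 0 \<le> h \<Longrightarrow> h \<le> 1 \<Longrightarrow>
      norm (f (s + h) - f s - h *\<^sub>R (l * f s + r s)) \<le> K * h * sqrt h"
    and f: "\<And>s. a \<le> s \<Longrightarrow> norm (f s) \<le> C" and r: "continuous_on {a..} r" "\<And>s. a \<le> s \<Longrightarrow> norm (r s) \<le> C'"
    and t: "a \<le> t"
  shows "(f has_vector_derivative l * f t + r t) (at t within {a..})"
proof (rule has_vector_derivative_of_increments [OF inc _ t])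
  have "norm (l * f s + r s) \<le> norm l * C + C'" if "a \<le> s" for s
    using norm_triangle_ineq [of "l * f s" "r s"] f [OF that] r(2) [OF that]
      mult_left_mono [OF f [OF that] norm_ge_zero [of l]] by (simp add: norm_mult)
  with inc have "continuous_on {a..} f" by (rule continuous_on_of_increments)
  then show "continuous_on {a..} (\<lambda>s. l * f s + r s)" by (intro continuous_intros r(1))
qed

text \<open>The difference of two solutions, multiplied by the integrating factor
  \<open>exp (- l t)\<close>, has derivative zero.\<close>

lemma linear_ode_unique:
  fixes f y r :: "real \<Rightarrow> complex"
  assumes f: "\<And>t. a \<le> t \<Longrightarrow> (f has_vector_derivative l * f t + r t) (at t within {a..})"
    and y: "\<And>t. a \<le> t \<Longrightarrow> (y has_vector_derivative l * y t + r t) (at t within {a..})"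
    and "f a = y a" and t: "a \<le> t"
  shows "f t = y t"
proof -
  define w where "w s = exp (- l * complex_of_real s) * (f s - y s)" for s
  have "(w has_vector_derivative 0) (at s within {a..})" if "s \<in> {a..}" for s
  proof -
    have "((\<lambda>x. exp (- l * x)) has_field_derivative - l * exp (- l * complex_of_real s)) (at (complex_of_real s))"
      by (auto intro!: derivative_eq_intros)
    then have "((\<lambda>s. exp (- l * complex_of_real s)) has_vector_derivative - l * exp (- l * complex_of_real s)) (at s within {a..})"
      using has_vector_derivative_real_field has_vector_derivative_at_within by blast
    from has_vector_derivative_mult [OF this has_vector_derivative_diff [OF f y, of s]] that
    show ?thesis unfolding w_def by (simp add: algebra_simps)
  qed
  then obtain c where c: "\<And>s. s \<in> {a..} \<Longrightarrow> w s = c"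
    using has_vector_derivative_zero_constant [of "{a..}" w] by (metis convex_real_interval(1))
  from c [of a] assms(3) have "c = 0" by (simp add: w_def)
  with c [of t] t show ?thesis by (simp add: w_def)
qed

lemma has_integral_interval_bound:
  fixes f :: "real \<Rightarrow> 'a::real_normed_vector"
  assumes "(f has_integral i) {x..x + h}" "0 \<le> C" "0 \<le> h" "\<And>r. r \<in> {x..x + h} \<Longrightarrow> norm (f r) \<le> C"
  shows "norm i \<le> C * h"
  using has_integral_bound_real [of C "{}" f i x "x + h"] assms by simp

subsection \<open>Free unitary Brownian motion\<close>

locale free_unitary_brownian = free_brownian A \<tau> \<F> B
  for A :: "'h::complex_hilbert_space bop set" and \<tau> \<F> B +
  fixes U :: "real \<Rightarrow> 'h bop"
  assumes U_unitary: "0 \<le> t \<Longrightarrow> unitary (U t)" and U_F: "0 \<le> t \<Longrightarrow> U t \<in> \<F> t"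
    and U_sde: "0 \<le> t \<Longrightarrow> \<exists>I J. I \<in> A \<and> has_free_ito_integral \<tau> \<F> B (\<lambda>s. \<i> *\<^sub>C U s) t I \<and>
      (U has_integral J) {0..t} \<and> U t = 1 + I - (1 / 2) *\<^sub>R J"
begin

lemma U_A: "0 \<le> t \<Longrightarrow> U t \<in> A"
  using U_F F_subset by blast

text \<open>The equation on \<open>[s, t]\<close> is the difference of the equations at
  \<open>t\<close> and at \<open>s\<close>.\<close>

lemma U_increment:
  assumes "0 \<le> s" "s \<le> t"
  obtains M J where "M \<in> A" "ito_limit s t (\<lambda>r. \<i> *\<^sub>C U r) M" "(U has_integral J) {s..t}"
    "U t = U s + M - (1 / 2) *\<^sub>R J" "J \<in> A"
proof -
  obtain I J where I: "I \<in> A" "has_free_ito_integral \<tau> \<F> B (\<lambda>r. \<i> *\<^sub>C U r) s I"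
    "(U has_integral J) {0..s}" "U s = 1 + I - (1 / 2) *\<^sub>R J"
    using U_sde [OF assms(1)] by blast
  obtain I' J' where I': "I' \<in> A" "has_free_ito_integral \<tau> \<F> B (\<lambda>r. \<i> *\<^sub>C U r) t I'"
    "(U has_integral J') {0..t}" "U t = 1 + I' - (1 / 2) *\<^sub>R J'"
    using U_sde [of t] assms by auto
  have "U integrable_on {s..t}"
    by (rule integrable_on_subinterval [of _ "{0..t}"]) (use I'(3) assms in auto)
  then obtain J2 where J2: "(U has_integral J2) {s..t}" by blast
  have "J' = J + J2"
    using has_integral_unique [OF I'(3) has_integral_combine [OF assms I(3) J2]] .
  show thesis
  proof (rule that)
    show "I' - I \<in> A" using I I' by simp
    show "ito_limit s t (\<lambda>r. \<i> *\<^sub>C U r) (I' - I)"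
      using assms I I' U_A by (intro ito_limit_increment ito_limit_of_free_ito_integral) auto
    show "U t = U s + (I' - I) - (1 / 2) *\<^sub>R J2"
      using I(4) I'(4) \<open>J' = J + J2\<close> by (simp add: scaleR_add_right)
    show "J2 \<in> A" by (rule vna_has_integral [OF von_neumann J2]) (use assms U_A in auto)
  qed (rule J2)
qed

lemma tau_mult_U_bound: "0 \<le> t \<Longrightarrow> c \<in> A \<Longrightarrow> norm (\<tau> (c * U t)) \<le> norm2 \<tau> c"
  using tau_mult_le [of c "U t"] U_A norm2_unitary U_unitary by simp

text \<open>A past element \<open>c\<close> annihilates the martingale part, so
  \<open>\<tau> (c * U t)\<close> solves \<open>y' = - y / 2\<close>.\<close>

lemma tau_mult_U:
  assumes s: "0 \<le> s" "s \<le> t" and c: "c \<in> \<F> s"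
  shows "\<tau> (c * U t) = complex_of_real (exp (- (t - s) / 2)) * \<tau> (c * U s)"
proof -
  note cA = F_subset [OF s(1) c]
  define C where "C = norm2 \<tau> c"
  have C0: "0 \<le> C" using cA by (simp add: C_def norm2_nonneg)
  have inc: "((\<lambda>r. \<tau> (c * U r)) has_integral 2 * (\<tau> (c * U x) - \<tau> (c * U (x + h)))) {x..x + h}"
    if "s \<le> x" "0 \<le> h" for x h
  proof -
    have x: "0 \<le> x" "x \<le> x + h" using that s by auto
    obtain M J where M: "M \<in> A" "ito_limit x (x + h) (\<lambda>r. \<i> *\<^sub>C U r) M" "(U has_integral J) {x..x + h}"
      "U (x + h) = U x + M - (1 / 2) *\<^sub>R J" "J \<in> A"
      by (rule U_increment [OF x])
    have "\<tau> (c * M) = 0" using tau_mult_ito_limit [OF x(1) M(1,2)] F_mono [OF s(1) that(1) c] .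
    then have "\<tau> (c * U (x + h)) = \<tau> (c * U x) - 1 / 2 * \<tau> (c * J)"
      using cA U_A [OF x(1)] M by (simp add: distrib_left right_diff_distrib tau_simps)
    then have "2 * (\<tau> (c * U x) - \<tau> (c * U (x + h))) = \<tau> (c * J)" by simp
    moreover have "((\<lambda>r. \<tau> (c * U r)) has_integral \<tau> (c * J)) {x..x + h}"
      by (rule tau_has_integral) (use M(3) cA U_A x in \<open>auto intro: has_integral_mult_right\<close>)
    ultimately show ?thesis by simp
  qed
  \<comment> \<open>The integral equation first yields a Lipschitz bound; fed back into the same
    equation it gives the error \<open>C * h * h\<close>, which is better than the required
    \<open>h * sqrt h\<close>.\<close>
  have lip: "norm (\<tau> (c * U (x + h)) - \<tau> (c * U x)) \<le> C * h" if "s \<le> x" "0 \<le> h" for x h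
  proof -
    have "norm (2 * (\<tau> (c * U x) - \<tau> (c * U (x + h)))) \<le> C * h"
      by (rule has_integral_interval_bound [OF inc [OF that] C0]) (use that s cA in \<open>auto simp: C_def tau_mult_U_bound\<close>)
    then have "2 * norm (\<tau> (c * U (x + h)) - \<tau> (c * U x)) \<le> C * h"
      by (simp only: norm_mult norm_numeral norm_minus_commute)
    moreover have "0 \<le> C * h" using C0 that by simp
    ultimately show ?thesis by simp
  qed
  have "((\<lambda>t. \<tau> (c * U t)) has_vector_derivative (- 1 / 2) * \<tau> (c * U t) + 0) (at t within {s..})" if "s \<le> t" for t
  proof (rule linear_ode_of_increments [of s _ "- 1 / 2" "\<lambda>_. 0" C C 0, OF _ _ _ _ that])
    fix x h :: real assume xh: "s \<le> x" "0 \<le> h" "h \<le> 1"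
    have "((\<lambda>r. \<tau> (c * U r) - \<tau> (c * U x)) has_integral
        2 * (\<tau> (c * U x) - \<tau> (c * U (x + h))) - h *\<^sub>R \<tau> (c * U x)) {x..x + h}"
      using has_integral_diff [OF inc [OF xh(1,2)] has_integral_const_real [of "\<tau> (c * U x)" x "x + h"]] xh by simp
    moreover have "norm (\<tau> (c * U r) - \<tau> (c * U x)) \<le> C * h" if "r \<in> {x..x + h}" for r
    proof -
      have "norm (\<tau> (c * U r) - \<tau> (c * U x)) \<le> C * (r - x)" using lip [OF xh(1), of "r - x"] that by simp
      also have "\<dots> \<le> C * h" using that C0 by (intro mult_left_mono) auto
      finally show ?thesis .
    qed
    moreover have "0 \<le> C * h" using C0 xh by simp
    ultimately have "norm (2 * (\<tau> (c * U x) - \<tau> (c * U (x + h))) - h *\<^sub>R \<tau> (c * U x)) \<le> C * h * h"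
      using has_integral_interval_bound xh by blast
    moreover have "2 * (\<tau> (c * U x) - \<tau> (c * U (x + h))) - h *\<^sub>R \<tau> (c * U x) =
        (- 2) * (\<tau> (c * U (x + h)) - \<tau> (c * U x) - h *\<^sub>R ((- 1 / 2) * \<tau> (c * U x) + 0))"
      by (simp add: algebra_simps scaleR_conv_of_real)
    ultimately have "2 * norm (\<tau> (c * U (x + h)) - \<tau> (c * U x) - h *\<^sub>R ((- 1 / 2) * \<tau> (c * U x) + 0)) \<le> C * h * h"
      by (simp only: norm_mult norm_minus_cancel norm_numeral)
    moreover have "C * h * h \<le> C * h * sqrt h"
    proof (intro mult_left_mono)
      show "h \<le> sqrt h" using xh by (intro real_le_rsqrt) (simp add: power2_eq_square mult_left_le)
    qed (use C0 xh in auto)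
    moreover have "0 \<le> C * h * h" using C0 xh by simp
    ultimately show "norm (\<tau> (c * U (x + h)) - \<tau> (c * U x) - h *\<^sub>R ((- 1 / 2) * \<tau> (c * U x) + 0)) \<le> C * h * sqrt h"
      by linarith
  qed (use s cA in \<open>auto simp: C_def tau_mult_U_bound\<close>)
  moreover have "((\<lambda>t. complex_of_real (exp (- (t - s) / 2)) * \<tau> (c * U s)) has_vector_derivative
      (- 1 / 2) * (complex_of_real (exp (- (t - s) / 2)) * \<tau> (c * U s)) + 0) (at t within {s..})" for t
  proof -
    have "((\<lambda>t. exp (- (t - s) / 2)) has_real_derivative (- 1 / 2) * exp (- (t - s) / 2)) (at t within {s..})"
      by (auto intro!: derivative_eq_intros)
    from has_vector_derivative_mult_left [OF has_vector_derivative_of_real [OF this], of "\<tau> (c * U s)"]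
    show ?thesis by (simp add: mult.assoc)
  qed
  ultimately show ?thesis
    by (rule linear_ode_unique) (use s in auto)
qed

end

lemma exp_minus_bounds:
  fixes x :: real assumes "0 \<le> x"
  shows "1 - x \<le> exp (- x)" "exp (- x) \<le> 1 - x + x\<^sup>2 / 2"
proof -
  show "1 - x \<le> exp (- x)" using exp_ge_add_one_self [of "- x"] by simp
  define g where "g y = 1 - y + y\<^sup>2 / 2 - exp (- y)" for y :: real
  have "g 0 \<le> g x"
  proof (rule DERIV_nonneg_imp_nondecreasing [OF assms])
    fix y :: real
    have "(g has_real_derivative - 1 + y + exp (- y)) (at y)"
      unfolding g_def by (auto intro!: derivative_eq_intros)
    moreover have "0 \<le> - 1 + y + exp (- y)" using exp_ge_add_one_self [of "- y"] by simp
    ultimately show "\<exists>z. (g has_real_derivative z) (at y) \<and> 0 \<le> z" by blast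
  qed
  then show "exp (- x) \<le> 1 - x + x\<^sup>2 / 2" by (simp add: g_def)
qed

lemma square_le_mult_sqrt: "0 \<le> h \<Longrightarrow> h \<le> 1 \<Longrightarrow> h\<^sup>2 \<le> h * sqrt h"
  unfolding power2_eq_square
  by (rule mult_left_mono) (auto intro!: real_le_rsqrt simp: power2_eq_square mult_left_le)

text \<open>One flag treats a letter and its adjoint alike; in the moment words it will be the
  parity of the position.\<close>

definition star_if :: "bool \<Rightarrow> 'h::complex_hilbert_space bop \<Rightarrow> 'h bop"
  where "star_if e a = (if e then adj a else a)"

lemma star_if_simps: "star_if e 1 = 1" "star_if e (a + b) = star_if e a + star_if e b"
  "star_if e (a - b) = star_if e a - star_if e b" "star_if e (c *\<^sub>C a) = (if e then cnj c else c) *\<^sub>C star_if e a"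
  by (simp_all add: star_if_def)

text \<open>The factor \<open>k\<close> in \<open>\<tau>(c X d X') = k \<tau>(c) \<tau>(d)\<close>, where \<open>X\<close>, \<open>X'\<close> are the centred increment over a time
  \<open>h\<close> or, where the flag is set, its adjoint.\<close>

definition increment_covariance :: "real \<Rightarrow> bool \<Rightarrow> bool \<Rightarrow> complex"
  where "increment_covariance h e e' = of_real (if e = e' then - (h * exp (- h)) else 1 - exp (- h))"

context free_unitary_brownian
begin

lemma star_if_A: "a \<in> A \<Longrightarrow> star_if e a \<in> A" and norm2_star_if: "a \<in> A \<Longrightarrow> norm2 \<tau> (star_if e a) = norm2 \<tau> a"
  by (simp_all add: star_if_def norm2_adj)

section \<open>Multiplicative increments of the unitary process\<close>

definition W :: "real \<Rightarrow> real \<Rightarrow> 'h bop"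
  where "W s h = adj (U s) * U (s + h)"

context
  fixes s h :: real
  assumes s: "0 \<le> s" and h: "0 \<le> h"
begin

lemma U_facts: "U s \<in> A" "U (s + h) \<in> A" "unitary (U s)" "unitary (U (s + h))"
  using s h U_A U_unitary by auto

lemma W_A: "W s h \<in> A"
  using U_facts by (simp add: W_def)

lemma W_unitary: "unitary (W s h)"
  using U_facts by (auto simp: W_def intro: unitary_mult unitary_adj)

lemma U_shift: "U (s + h) = U s * W s h"
  using U_facts by (simp add: W_def unitary_inverse)

lemma tau_mult_W: "c \<in> \<F> s \<Longrightarrow> \<tau> (c * W s h) = complex_of_real (exp (- h / 2)) * \<tau> c"
proof -
  assume c: "c \<in> \<F> s"
  have "c * adj (U s) \<in> \<F> s"
    using s c U_F by (auto intro: vna_mult vna_adj F_vna)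
  from tau_mult_U [OF s _ this, of "s + h"] show ?thesis
    using s h U_facts(3) by (simp add: W_def mult.assoc unitary_inverse)
qed

lemma tau_mult_W_minus_one:
  "c \<in> \<F> s \<Longrightarrow> \<tau> (c * (W s h - 1)) = complex_of_real (exp (- h / 2) - 1) * \<tau> c"
  using tau_mult_W [of c] F_subset [OF s] W_A by (simp add: right_diff_distrib left_diff_distrib tau_diff)

lemma tau_mult_star_W_minus_one:
  assumes c: "c \<in> \<F> s" shows "\<tau> (c * star_if e (W s h - 1)) = complex_of_real (exp (- h / 2) - 1) * \<tau> c"
proof (cases e)
  case True
  note cA = F_subset [OF s c]
  have "\<tau> (c * adj (W s h - 1)) = cnj (\<tau> ((W s h - 1) * adj c))"
    using tau_adj [of "(W s h - 1) * adj c"] cA W_A by simp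
  also have "\<tau> ((W s h - 1) * adj c) = \<tau> (adj c * (W s h - 1))"
    using cA W_A by (intro tracial) auto
  also have "\<dots> = complex_of_real (exp (- h / 2) - 1) * \<tau> (adj c)"
    using c s by (intro tau_mult_W_minus_one vna_adj F_vna)
  finally show ?thesis using True tau_adj [OF cA] by (simp add: star_if_def)
qed (simp add: star_if_def tau_mult_W_minus_one c)

lemma norm2_W_minus_one_square: "(norm2 \<tau> (W s h - 1))\<^sup>2 = 2 - 2 * exp (- h / 2)"
proof -
  have "adj (W s h - 1) * (W s h - 1) = 2 *\<^sub>R 1 - W s h - adj (W s h)"
    using W_unitary by (simp add: algebra_simps unitary_inverse scaleR_2)
  moreover have "\<tau> (W s h) = complex_of_real (exp (- h / 2))"
    using tau_mult_W [of 1] s by (simp add: vna_one F_vna unital)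
  ultimately show ?thesis using W_A by (simp add: norm2_square_Re tau_simps tau_adj)
qed

lemma norm2_W_minus_one_square_le: "(norm2 \<tau> (W s h - 1))\<^sup>2 \<le> h"
  unfolding norm2_W_minus_one_square using exp_minus_bounds(1) [of "h / 2"] h by simp

lemma norm2_W_minus_one_le: "norm2 \<tau> (W s h - 1) \<le> sqrt h"
  using norm2_W_minus_one_square_le by (rule real_le_rsqrt)

lemma U_diff: "U (s + h) - U s = U s * (W s h - 1)"
  by (simp add: U_shift right_diff_distrib)

end

lemma norm2_U_diff_square_le:
  assumes "0 \<le> s" "s \<le> t" shows "(norm2 \<tau> (U t - U s))\<^sup>2 \<le> t - s"
proof -
  have "U t - U s = U s * (W s (t - s) - 1)" using U_diff [of s "t - s"] assms by simp
  then show ?thesis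
    using norm2_W_minus_one_square_le [of s "t - s"] norm2_unitary_mult_left U_unitary assms by simp
qed

text \<open>Freezing the integrand at time \<open>s\<close> costs O(h) in L2, since \<open>U\<close>
  moves by at most \<open>sqrt h\<close> in L2 over that time, and the drift integral is O(h) in
  norm. Left multiplication by the unitary \<open>U s\<close> is isometric in L2, so the comparison
  is made for \<open>U (s + h) - U s\<close>.\<close>

lemma W_approx:
  assumes s: "0 \<le> s" and h: "0 \<le> h"
  shows "norm2 \<tau> (W s h - 1 - \<i> *\<^sub>C (B (s + h) - B s)) \<le> 2 * h"
proof -
  have sh: "s \<le> s + h" using h by simp
  note UA = U_facts [OF s h]
  obtain M J where M: "M \<in> A" "ito_limit s (s + h) (\<lambda>r. \<i> *\<^sub>C U r) M" "(U has_integral J) {s..s + h}"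
    "U (s + h) = U s + M - (1 / 2) *\<^sub>R J" "J \<in> A"
    by (rule U_increment [OF s sh])
  define D where "D = B (s + h) - B s"
  have DA: "D \<in> A" using B_A s h by (simp add: D_def)
  have "(norm2 \<tau> (M - (\<i> *\<^sub>C U s) * (B (s + h) - B s)))\<^sup>2 \<le> 2 * h * (s + h - s)"
  proof (rule ito_limit_approx [OF s sh M(1,2)])
    show "(norm2 \<tau> (\<i> *\<^sub>C U r - \<i> *\<^sub>C U s))\<^sup>2 \<le> h" if "s \<le> r" "r \<le> s + h" for r
      using norm2_U_diff_square_le [OF s that(1)] that s UA U_A [of r]
        norm2_scaleC [of "U r - U s" \<i>] by (simp add: scaleC_diff_right)
    show "\<i> *\<^sub>C U s \<in> \<F> s" using s U_F F_vna by (auto intro: vna_scaleC)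
  qed (use s U_A in auto)
  then have "(norm2 \<tau> (M - \<i> *\<^sub>C (U s * D)))\<^sup>2 \<le> 2 * h\<^sup>2"
    by (simp add: D_def scaleC_mult_left power2_eq_square)
  \<comment> \<open>A rational bound for the square root of 2; with \<open>h / 2\<close> from the
    drift it adds up to \<open>2 * h\<close>.\<close>
  also have "\<dots> \<le> (3 / 2 * h)\<^sup>2" by (simp add: power_mult_distrib field_simps)
  finally have 1: "norm2 \<tau> (M - \<i> *\<^sub>C (U s * D)) \<le> 3 / 2 * h"
    by (rule power2_le_imp_le) (use h in simp)
  have "norm J \<le> 1 * h"
    by (rule has_integral_interval_bound [OF M(3)]) (use s h in \<open>auto intro!: unitary_norm U_unitary\<close>)
  then have 2: "norm2 \<tau> ((1 / 2) *\<^sub>R J) \<le> h / 2" 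
    using norm2_le_norm [of "(1 / 2) *\<^sub>R J"] M(5) by simp
  have "U s * (W s h - 1 - \<i> *\<^sub>C D) = (M - \<i> *\<^sub>C (U s * D)) - (1 / 2) *\<^sub>R J"
    using U_diff [OF s h] M(4) by (simp add: right_diff_distrib scaleC_mult_right algebra_simps)
  then have "norm2 \<tau> (W s h - 1 - \<i> *\<^sub>C D) = norm2 \<tau> ((M - \<i> *\<^sub>C (U s * D)) - (1 / 2) *\<^sub>R J)"
    using norm2_unitary_mult_left [OF UA(3), of "W s h - 1 - \<i> *\<^sub>C D"] by simp
  also have "\<dots> \<le> norm2 \<tau> (M - \<i> *\<^sub>C (U s * D)) + norm2 \<tau> ((1 / 2) *\<^sub>R J)"
    using M UA DA by (intro norm2_triangle_diff) auto
  also have "\<dots> \<le> 2 * h" using 1 2 by simp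
  finally show ?thesis by (simp add: D_def)
qed

lemma tau_bilinear_diff:
  assumes "c \<in> A" "d \<in> A" "Y \<in> A" "Y' \<in> A" "P \<in> A" "P' \<in> A"
  shows "cmod (\<tau> (c * Y * d * Y') - \<tau> (c * P * d * P')) \<le>
    norm c * norm d * (norm2 \<tau> (Y - P) * norm2 \<tau> Y' + norm2 \<tau> P * norm2 \<tau> (Y' - P'))"
proof -
  have "\<tau> (c * Y * d * Y') - \<tau> (c * P * d * P') = \<tau> (c * (Y - P) * d * Y') + \<tau> (c * P * d * (Y' - P'))"
    using assms by (simp add: right_diff_distrib left_diff_distrib tau_diff)
  also have "cmod \<dots> \<le> norm c * norm d * norm2 \<tau> (Y - P) * norm2 \<tau> Y' +
      norm c * norm d * norm2 \<tau> P * norm2 \<tau> (Y' - P')"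
    by (intro order_trans [OF norm_triangle_ineq add_mono] tau_mult4_le) (use assms in auto)
  finally show ?thesis by (simp add: algebra_simps)
qed

text \<open>Both factors are replaced by \<open>i\<close> times the Brownian increment. Each
  replacement costs \<open>2 * h\<close> in L2 against a factor of size \<open>sqrt h\<close>, and
  the sign is \<open>i * i\<close> or \<open>i * (-i)\<close>.\<close>

lemma W_step:
  assumes s: "0 \<le> s" and h: "0 \<le> h" and c: "c \<in> \<F> s" and d: "d \<in> \<F> s"
  shows "cmod (\<tau> (c * (W s h - 1) * d * star_if e (W s h - 1)) - h *\<^sub>R ((if e then 1 else - 1) * (\<tau> c * \<tau> d)))
    \<le> norm c * norm d * (4 * h * sqrt h)"
proof -
  note cA = F_subset [OF s c] F_subset [OF s d]
  define D where "D = B (s + h) - B s"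
  define X where "X = W s h - 1"
  have DA: "D \<in> A" "adj D = D" using B_A B_adj s h by (simp_all add: D_def)
  have XA: "X \<in> A" using W_A [OF s h] by (simp add: X_def)
  have DD: "\<tau> (p * D * q * D) = h *\<^sub>R (\<tau> p * \<tau> q)" if "p \<in> \<F> s" "q \<in> \<F> s" for p q
    using tau_mult_increment_mult_increment [OF s _ that, of "s + h"] h by (simp add: D_def scaleR_conv_of_real)
  have "(norm2 \<tau> D)\<^sup>2 = h" using DA DD [of 1 1] s by (simp add: norm2_square_Re unital vna_one F_vna)
  then have nD: "norm2 \<tau> (\<i> *\<^sub>C D) = sqrt h"
    using norm2_nonneg [OF DA(1)] DA by (simp add: norm2_scaleC real_sqrt_unique)
  have nX: "norm2 \<tau> X \<le> sqrt h" using norm2_W_minus_one_le [OF s h] by (simp add: X_def)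
  have nE: "norm2 \<tau> (X - \<i> *\<^sub>C D) \<le> 2 * h" using W_approx [OF s h] by (simp add: X_def D_def)
  have "cmod (\<tau> (c * X * d * star_if e X) - \<tau> (c * (\<i> *\<^sub>C D) * d * star_if e (\<i> *\<^sub>C D))) \<le>
      norm c * norm d * (norm2 \<tau> (X - \<i> *\<^sub>C D) * norm2 \<tau> X + norm2 \<tau> (\<i> *\<^sub>C D) * norm2 \<tau> (X - \<i> *\<^sub>C D))"
    using tau_bilinear_diff [of c d X "star_if e X" "\<i> *\<^sub>C D" "star_if e (\<i> *\<^sub>C D)"] cA DA XA
    by (simp add: star_if_A norm2_star_if flip: star_if_simps(3))
  also have "\<dots> \<le> norm c * norm d * ((2 * h) * sqrt h + sqrt h * (2 * h))"
    unfolding nD using nX nE h XA norm2_nonneg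
    by (intro mult_left_mono add_mono mult_mono) auto
  also have "\<dots> = norm c * norm d * (4 * h * sqrt h)" by simp
  moreover have "\<tau> (c * (\<i> *\<^sub>C D) * d * star_if e (\<i> *\<^sub>C D)) = h *\<^sub>R ((if e then 1 else - 1) * (\<tau> c * \<tau> d))"
    using DD [OF c d] cA DA
    by (cases e) (simp_all add: star_if_def scaleC_mult_left scaleC_mult_right scaleC_scaleC scaleC)
  ultimately show ?thesis by (simp add: X_def)
qed

text \<open>\<open>2 * (exp (- h / 2) - 1) + h\<close> is of order \<open>h^2\<close>, hence at most
  \<open>h * sqrt h\<close>; with the 4 coming from \<open>e\<close> this makes 5.\<close>

lemma step_error_combine:
  fixes F T e :: complex
  assumes h: "0 \<le> h" "h \<le> 1" and F: "cmod F \<le> C" and e: "cmod e \<le> C * (4 * h * sqrt h)"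
  shows "cmod (2 * (complex_of_real (exp (- h / 2) - 1) * F) + h *\<^sub>R F + e) \<le> 5 * C * h * sqrt h"
proof -
  have C0: "0 \<le> C" using F norm_ge_zero order_trans by blast
  define q where "q = 2 * (exp (- h / 2) - 1) + h"
  have q: "\<bar>q\<bar> \<le> h * sqrt h"
    using exp_minus_bounds [of "h / 2"] h square_le_mult_sqrt [OF h] zero_le_power2 [of h]
    unfolding q_def by (simp add: abs_le_iff power_divide field_simps)
  have "2 * (complex_of_real (exp (- h / 2) - 1) * F) + h *\<^sub>R F = complex_of_real q * F"
    by (simp add: q_def algebra_simps scaleR_conv_of_real)
  then have "cmod (2 * (complex_of_real (exp (- h / 2) - 1) * F) + h *\<^sub>R F + e) \<le> \<bar>q\<bar> * cmod F + cmod e"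
    using norm_triangle_ineq [of "complex_of_real q * F" e] by (simp add: norm_mult)
  also have "\<bar>q\<bar> * cmod F \<le> (h * sqrt h) * C"
    using q F h by (intro mult_mono) auto
  finally show ?thesis using e by (simp add: algebra_simps)
qed

lemma norm_mult_unitary_le:
  "unitary u \<Longrightarrow> norm (u * c) \<le> norm c" "unitary u \<Longrightarrow> norm (c * u) \<le> norm c"
  using norm_mult_ineq [of u c] norm_mult_ineq [of c u] unitary_norm [of u]
    mult_right_mono [of "norm u" 1 "norm c"] mult_left_mono [of "norm u" 1 "norm c"] by auto

lemma W_quadratic_step:
  assumes s: "0 \<le> s" and h: "0 \<le> h" "h \<le> 1" and c: "c \<in> \<F> s" and d: "d \<in> \<F> s" and C: "norm c * norm d \<le> C"
  shows "cmod (\<tau> (c * W s h * d * star_if e (W s h)) - \<tau> (c * d) -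
    h *\<^sub>R ((- 1) * \<tau> (c * d) + (if e then 1 else - 1) * (\<tau> c * \<tau> d))) \<le> 5 * C * h * sqrt h"
proof -
  note cA = F_subset [OF s c] F_subset [OF s d]
  define X where "X = W s h - 1"
  define \<mu> where "\<mu> = complex_of_real (exp (- h / 2) - 1)"
  define g where "g = h *\<^sub>R ((if e then 1 else - 1) * (\<tau> c * \<tau> d))"
  have XA: "X \<in> A" "star_if e X \<in> A" using W_A [OF s h(1)] by (auto simp: X_def intro: star_if_A)
  have W: "W s h = 1 + X" by (simp add: X_def)
  have cd: "c * d \<in> \<F> s" "d * c \<in> \<F> s" using c d F_vna [OF s] by (auto intro: vna_mult)
  have "\<tau> (c * W s h * d * star_if e (W s h)) =
      \<tau> (c * d) + \<tau> (c * d * star_if e X) + (\<tau> (c * X * d) + \<tau> (c * X * d * star_if e X))"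
    using cA XA unfolding W by (simp add: star_if_simps distrib_left distrib_right add)
  also have "\<tau> (c * d * star_if e X) = \<mu> * \<tau> (c * d)"
    unfolding X_def \<mu>_def by (rule tau_mult_star_W_minus_one [OF s h(1) cd(1)])
  also have "\<tau> (c * X * d) = \<tau> (d * c * X)" using tracial [of "c * X" d] XA cA by (simp add: mult.assoc)
  also have "\<dots> = \<mu> * \<tau> (c * d)"
    using tau_mult_W_minus_one [OF s h(1) cd(2)] tracial [OF cA] by (simp add: X_def \<mu>_def)
  finally have "\<tau> (c * W s h * d * star_if e (W s h)) - \<tau> (c * d) -
      h *\<^sub>R ((- 1) * \<tau> (c * d) + (if e then 1 else - 1) * (\<tau> c * \<tau> d)) =
      2 * (\<mu> * \<tau> (c * d)) + h *\<^sub>R \<tau> (c * d) + (\<tau> (c * X * d * star_if e X) - g)"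
    by (simp add: g_def algebra_simps)
  also have "cmod \<dots> \<le> 5 * C * h * sqrt h"
    unfolding \<mu>_def
  proof (rule step_error_combine [OF h])
    show "cmod (\<tau> (c * d)) \<le> C" using tau_le_norm [of "c * d"] norm_mult_ineq [of c d] cA C by simp
    have "cmod (\<tau> (c * X * d * star_if e X) - g) \<le> norm c * norm d * (4 * h * sqrt h)"
      unfolding X_def g_def by (rule W_step [OF s h(1) c d])
    also have "\<dots> \<le> C * (4 * h * sqrt h)" using C h by (intro mult_right_mono) auto
    finally show "cmod (\<tau> (c * X * d * star_if e X) - g) \<le> C * (4 * h * sqrt h)" .
  qed
  finally show ?thesis .
qed

lemma W_add: "0 \<le> s \<Longrightarrow> 0 \<le> h \<Longrightarrow> W s (h + k) = W s h * W (s + h) k"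
  using U_facts(4) [of s h] by (simp add: W_def mult.assoc add.assoc unitary_inverse)

lemma W_F: "0 \<le> s \<Longrightarrow> 0 \<le> h \<Longrightarrow> W s h \<in> \<F> (s + h)"
  unfolding W_def using U_F [of s] U_F [of "s + h"] F_mono [of s "s + h" "U s"]
  by (auto intro!: vna_mult vna_adj F_vna)

lemma exp_minus_has_vector_derivative:
  "((\<lambda>t. complex_of_real (exp (- t))) has_vector_derivative - complex_of_real (exp (- t))) (at t within T)"
proof -
  have "((\<lambda>t. exp (- t)) has_real_derivative - exp (- t)) (at t within T)"
    by (auto intro!: derivative_eq_intros)
  from has_vector_derivative_of_real [OF this, where 'a = complex] show ?thesis by simp
qed

text \<open>Since \<open>W s (t + k) = W s t * W (s + t) k\<close>, absorbing \<open>W s t\<close>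
  into the coefficients reduces every increment in \<open>t\<close> to the one-step estimate at time
  \<open>s + t\<close>. The outcome is the equation \<open>f' = - f + r\<close>, with
  \<open>r\<close> constant if the second letter is an adjoint; otherwise the means of both letters
  enter and \<open>r\<close> decays like \<open>exp (- t)\<close>.\<close>

lemma tau_W_quadratic:
  assumes s: "0 \<le> s" and h: "0 \<le> h" and c: "c \<in> \<F> s" and d: "d \<in> \<F> s"
  shows "\<tau> (c * W s h * d * star_if e (W s h)) =
    complex_of_real (exp (- h)) * \<tau> (c * d) + increment_covariance h False e * (\<tau> c * \<tau> d)"
proof -
  define f where "f t = \<tau> (c * W s t * d * star_if e (W s t))" for t
  define E where "E t = complex_of_real (exp (- t))" for t
  define r where "r t = (if e then \<tau> c * \<tau> d else - (E t * (\<tau> c * \<tau> d)))" for t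
  define y where "y t = E t * \<tau> (c * d) + increment_covariance t False e * (\<tau> c * \<tau> d)" for t
  note cA = F_subset [OF s c] F_subset [OF s d]
  \<comment> \<open>The new coefficients. In the case of an adjoint, \<open>adj (W s t)\<close>
    appears at the right end of the word and is carried to the front by traciality.\<close>
  define p where "p t = (if e then adj (W s t) * c * W s t else c * W s t)" for t
  define q where "q t = (if e then d else d * W s t)" for t
  have pq: "p t \<in> \<F> (s + t)" "q t \<in> \<F> (s + t)" "norm (p t) * norm (q t) \<le> norm c * norm d"
    "\<tau> (p t) * \<tau> (q t) * (if e then 1 else - 1) = r t" 
    "\<And>V. V \<in> A \<Longrightarrow> \<tau> (c * (W s t * V) * d * star_if e (W s t * V)) = \<tau> (p t * V * q t * star_if e V)"
    if t: "0 \<le> t" for t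
  proof -
    note W = W_A [OF s t] W_unitary [OF s t] W_F [OF s t]
    have cd: "c \<in> \<F> (s + t)" "d \<in> \<F> (s + t)" using c d F_mono [OF s _ c, of "s + t"] F_mono [OF s _ d, of "s + t"] t by auto
    show "p t \<in> \<F> (s + t)" "q t \<in> \<F> (s + t)"
      using W(3) cd F_vna [of "s + t"] s t by (auto simp: p_def q_def intro: vna_mult vna_adj)
    have "norm (p t) \<le> norm c" "norm (q t) \<le> norm d"
      using norm_mult_unitary_le(2) [OF W(2), of c] norm_mult_unitary_le(2) [OF W(2), of d]
        norm_mult_unitary_le(1) [OF unitary_adj [OF W(2)], of "c * W s t"] by (auto simp: p_def q_def mult.assoc)
    then show "norm (p t) * norm (q t) \<le> norm c * norm d" by (intro mult_mono) auto
    have "\<tau> (adj (W s t) * c * W s t) = \<tau> c"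
      using tracial [of "adj (W s t)" "c * W s t"] cA W by (simp add: mult.assoc unitary_inverse)
    moreover have "E t = complex_of_real (exp (- t / 2)) * complex_of_real (exp (- t / 2))"
      unfolding E_def of_real_mult [symmetric] exp_add [symmetric] by simp
    ultimately show "\<tau> (p t) * \<tau> (q t) * (if e then 1 else - 1) = r t"
      using tau_mult_W [OF s t c] tau_mult_W [OF s t d] by (simp add: p_def q_def r_def)
    show "\<tau> (c * (W s t * V) * d * star_if e (W s t * V)) = \<tau> (p t * V * q t * star_if e V)" if "V \<in> A" for V
      using tracial [of "c * W s t * V * d * adj V" "adj (W s t)"] cA W that
      by (simp add: p_def q_def star_if_def mult.assoc)
  qed
  have f_pq: "f t = \<tau> (p t * q t)" if "0 \<le> t" for t
    using pq(5) [OF that, of 1] by (simp add: f_def star_if_simps)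
  have E: "(E has_vector_derivative - E t) (at t within {0..})" for t
    unfolding E_def [abs_def] by (rule exp_minus_has_vector_derivative)
  have "(f has_vector_derivative (- 1) * f t + r t) (at t within {0..})" if "0 \<le> t" for t
  proof (rule linear_ode_of_increments [of 0 _ "- 1" r "5 * (norm c * norm d)" "norm c * norm d" "cmod (\<tau> c * \<tau> d)", OF _ _ _ _ that])
    show "continuous_on {0..} r" unfolding r_def [abs_def] E_def by (cases e) (auto intro!: continuous_intros)
    fix t :: real assume t: "0 \<le> t"
    show "cmod (r t) \<le> cmod (\<tau> c * \<tau> d)"
      using t by (simp add: r_def E_def norm_mult mult_left_le_one_le)
    have "p t * q t \<in> A" using pq(1,2) [OF t] F_subset [of "s + t"] s t by auto
    then show "cmod (f t) \<le> norm c * norm d"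
      using tau_le_norm [of "p t * q t"] norm_mult_ineq [of "p t" "q t"] pq(3) [OF t] f_pq [OF t] by simp
    fix k :: real assume k: "0 \<le> k" "k \<le> 1"
    have st: "0 \<le> s + t" using s t by simp
    have "f (t + k) = \<tau> (p t * W (s + t) k * q t * star_if e (W (s + t) k))"
      unfolding f_def W_add [OF s t] using W_A [OF st k(1)] by (rule pq(5) [OF t])
    then show "norm (f (t + k) - f t - k *\<^sub>R ((- 1) * f t + r t)) \<le> 5 * (norm c * norm d) * k * sqrt k"
      using W_quadratic_step [OF st k pq(1-3) [OF t], of e] pq(4) [OF t, symmetric] f_pq [OF t]
      by (simp only: mult.commute)
  qed
  moreover have "(y has_vector_derivative (- 1) * y t + r t) (at t within {0..})" for t
  proof -
    have "((\<lambda>t. E t * \<tau> (c * d) + (1 - E t) * (\<tau> c * \<tau> d)) has_vector_derivative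
        - E t * \<tau> (c * d) + (0 - - E t) * (\<tau> c * \<tau> d)) (at t within {0..})"
      by (intro derivative_intros E has_vector_derivative_add has_vector_derivative_mult_left has_vector_derivative_diff)
    moreover have "((\<lambda>t. E t * \<tau> (c * d) + - (complex_of_real t * E t) * (\<tau> c * \<tau> d)) has_vector_derivative
        - E t * \<tau> (c * d) + - (complex_of_real t * (- E t) + 1 * E t) * (\<tau> c * \<tau> d)) (at t within {0..})"
      by (intro has_vector_derivative_add has_vector_derivative_mult_left has_vector_derivative_minus has_vector_derivative_mult E)
        (auto intro!: derivative_eq_intros)
    ultimately show ?thesis
      unfolding y_def [abs_def] r_def increment_covariance_def by (cases e) (simp_all add: E_def algebra_simps)
  qed
  ultimately have "f h = y h"
    by (rule linear_ode_unique)
      (use s h U_unitary [OF s] in \<open>auto simp: f_def y_def E_def W_def unitary_inverse star_if_simps increment_covariance_def\<close>)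
  then show ?thesis by (simp add: f_def y_def E_def)
qed

end

subsection \<open>Free independence of the increments from the past and the two symmetries\<close>

locale free_unitary_brownian_symmetries = free_unitary_brownian A \<tau> \<F> B U
  for A :: "'h::complex_hilbert_space bop set" and \<tau> \<F> B U +
  fixes R S :: "'h bop"
  assumes R_A: "R \<in> A" and R_symmetry: "symmetry R" and S_A: "S \<in> A" and S_symmetry: "symmetry S"
    and free_RS: "freely_independent \<tau> (U ` {0..}) {R, S}"
begin

abbreviation "UA \<equiv> star_algebra_generated (U ` {0..})"
abbreviation "QA \<equiv> star_algebra_generated {R, S}"

lemma UA_A: "g \<in> UA \<Longrightarrow> g \<in> A" and QA_A: "q \<in> QA \<Longrightarrow> q \<in> A"
  using star_algebra_generated_subset [OF von_neumann, of "U ` {0..}"]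
    star_algebra_generated_subset [OF von_neumann, of "{R, S}"] U_A R_A S_A by auto

lemma generated_diff:
  assumes "a \<in> star_algebra_generated X" "b \<in> star_algebra_generated X"
  shows "a - b \<in> star_algebra_generated X"
  using star_algebra_generated.add [OF assms(1) star_algebra_generated.scaleC [OF assms(2), of "-1"]]
  by (simp add: scaleC_minus_left scaleC_one)

lemmas generated_intros = star_algebra_generated.intros generated_diff

lemma tau_center: "a \<in> A \<Longrightarrow> \<tau> (a - \<tau> a *\<^sub>C 1) = 0"
  by (simp add: tau_simps)

text \<open>Elements for which both sources of information apply: as part of the past
  \<open>\<F> s\<close> they obey the covariance formulas, and as part of \<open>UA\<close> they are
  free from \<open>R\<close>, \<open>S\<close>. The algebra \<open>UA\<close> itself also contains
  the future of \<open>U\<close>.\<close>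

abbreviation "UF s \<equiv> \<F> s \<inter> UA"

lemma UF_intros:
  assumes s: "0 \<le> s"
  shows "1 \<in> UF s" "g \<in> UF s \<Longrightarrow> g' \<in> UF s \<Longrightarrow> g * g' \<in> UF s" "g \<in> UF s \<Longrightarrow> c *\<^sub>C g \<in> UF s"
    "g \<in> UF s \<Longrightarrow> g' \<in> UF s \<Longrightarrow> g - g' \<in> UF s" "g \<in> UF s \<Longrightarrow> adj g \<in> UF s" "U s \<in> UF s"
  using s F_vna [OF s] U_F [OF s]
  by (auto intro: generated_intros vna_one vna_mult vna_scaleC vna_diff vna_adj)

text \<open>Centred words that begin and end in \<open>QA\<close>: any element of \<open>UA\<close>
  can then be put next to them, once it is centred.\<close>

inductive_set alternating :: "real \<Rightarrow> 'h bop set" for s where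
  single: "q \<in> QA \<Longrightarrow> \<tau> q = 0 \<Longrightarrow> q \<in> alternating s"
| step: "q \<in> QA \<Longrightarrow> \<tau> q = 0 \<Longrightarrow> g \<in> UF s \<Longrightarrow> \<tau> g = 0 \<Longrightarrow> k \<in> alternating s \<Longrightarrow> q * g * k \<in> alternating s"

definition centred_word :: "(bool \<times> 'h bop) list \<Rightarrow> bool"
  where "centred_word w \<longleftrightarrow> distinct_adj (map fst w) \<and>
    (\<forall>(b, a)\<in>set w. a \<in> star_algebra_generated (if b then U ` {0..} else {R, S}) \<and> \<tau> a = 0)"

lemma tau_centred_word: "centred_word w \<Longrightarrow> w \<noteq> [] \<Longrightarrow> \<tau> (prod_list (map snd w)) = 0"
  using free_RS unfolding freely_independent_def centred_word_def by blast

lemma centred_word_append: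
  "centred_word (v @ w) \<longleftrightarrow> centred_word v \<and> centred_word w \<and> (v = [] \<or> w = [] \<or> fst (last v) \<noteq> fst (hd w))"
  by (auto simp: centred_word_def distinct_adj_append_iff last_map hd_map)

lemma alternating_word:
  assumes "k \<in> alternating s"
  obtains w where "centred_word w" "w \<noteq> []" "\<not> fst (hd w)" "\<not> fst (last w)" "prod_list (map snd w) = k"
  using assms
proof (induction arbitrary: thesis rule: alternating.induct)
  case (single q)
  show ?case by (rule single.prems [of "[(False, q)]"]) (use single in \<open>auto simp: centred_word_def\<close>)
next
  case (step q g k)
  obtain w where w: "centred_word w" "w \<noteq> []" "\<not> fst (hd w)" "\<not> fst (last w)" "prod_list (map snd w) = k"
    using step.IH by blast
  show ?case
  proof (rule step.prems [of "[(False, q), (True, g)] @ w"])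
    show "centred_word ([(False, q), (True, g)] @ w)"
      unfolding centred_word_append using w step.hyps by (auto simp: centred_word_def)
  qed (use w in \<open>auto simp: mult.assoc\<close>)
qed

lemma alternating_A: "k \<in> alternating s \<Longrightarrow> k \<in> A"
  by (induction rule: alternating.induct) (auto intro: QA_A UA_A)

text \<open>\<open>y\<close> need not be centred: its scalar part is multiplied by
  \<open>\<tau> k\<close>, which vanishes as well.\<close>

lemma tau_alternating_mult:
  assumes k: "k \<in> alternating s" and y: "y \<in> UA"
  shows "\<tau> (k * y) = 0"
proof -
  obtain w where w: "centred_word w" "w \<noteq> []" "\<not> fst (last w)" "prod_list (map snd w) = k"
    using alternating_word [OF k] by metis
  define y0 where "y0 = y - \<tau> y *\<^sub>C 1"
  have y0: "y0 \<in> UA" "\<tau> y0 = 0" using y tau_center UA_A by (auto simp: y0_def intro: generated_intros)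
  have "centred_word (w @ [(True, y0)])"
    unfolding centred_word_append using w y0 by (simp add: centred_word_def)
  then have "\<tau> (k * y0) = 0" using tau_centred_word w by fastforce
  moreover have "\<tau> k = 0" using tau_centred_word w by blast
  moreover have "k * y = k * y0 + \<tau> y *\<^sub>C k" by (simp add: y0_def right_diff_distrib scaleC_mult_right)
  ultimately show ?thesis using alternating_A [OF k] UA_A [OF y0(1)] by (simp add: add scaleC)
qed

lemma tau_alternating_mult4:
  assumes "k \<in> alternating s" "k' \<in> alternating s" "y \<in> UA" "\<tau> y = 0" "y' \<in> UA" "\<tau> y' = 0"
  shows "\<tau> (k * y * k' * y') = 0"
proof -
  obtain w where w: "centred_word w" "w \<noteq> []" "\<not> fst (last w)" "prod_list (map snd w) = k"
    using alternating_word [OF assms(1)] by metis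
  obtain w' where w': "centred_word w'" "w' \<noteq> []" "\<not> fst (hd w')" "\<not> fst (last w')" "prod_list (map snd w') = k'"
    using alternating_word [OF assms(2)] by metis
  have "centred_word ([(True, y')])" "centred_word [(True, y)]"
    using assms by (simp_all add: centred_word_def)
  then have "centred_word (w @ [(True, y)] @ w' @ [(True, y')])"
    unfolding centred_word_append using w w' by simp
  from tau_centred_word [OF this] show ?thesis using w w' by (simp add: mult.assoc)
qed

text \<open>The algebra generated by \<open>UF s\<close> and \<open>QA\<close>. The outer factors \<open>g\<close>, \<open>g'\<close> of a long word need not be
  centred: in a trace they are absorbed by the neighbouring increments.\<close>

inductive_set span_words :: "real \<Rightarrow> 'h bop set" for s where
  short: "g \<in> UF s \<Longrightarrow> g \<in> span_words s"
| long: "g \<in> UF s \<Longrightarrow> k \<in> alternating s \<Longrightarrow> g' \<in> UF s \<Longrightarrow> g * k * g' \<in> span_words s"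
| add: "a \<in> span_words s \<Longrightarrow> b \<in> span_words s \<Longrightarrow> a + b \<in> span_words s"

lemma span_words_A: "a \<in> span_words s \<Longrightarrow> a \<in> A"
  by (induction rule: span_words.induct) (auto intro: UA_A alternating_A)

lemma span_words_mult_UF:
  assumes s: "0 \<le> s" and g: "g \<in> UF s" and a: "a \<in> span_words s"
  shows "g * a \<in> span_words s"
  using a
proof (induction rule: span_words.induct)
  case (short g')
  then show ?case using UF_intros(2) [OF s g] span_words.short by blast
next
  case (long g1 k g2)
  then show ?case using UF_intros(2) [OF s g] span_words.long [of "g * g1" s k g2] by (simp add: mult.assoc)
qed (simp add: distrib_left span_words.add)

text \<open>The product of \<open>q\<close> with the first letter need not be centred. Its centred
  part starts an alternating word again; its scalar part drops the letter and leaves a shorter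
  word.\<close>

lemma alternating_mult_QA:
  assumes s: "0 \<le> s" and q: "q \<in> QA" and k: "k \<in> alternating s" and g: "g \<in> UF s"
  shows "q * k * g \<in> span_words s"
proof -
  note one = UF_intros(1) [OF s]
  have main: "q * (q1 * r) * g \<in> span_words s"
    if q1: "q1 \<in> QA" and r: "r * g \<in> span_words s" "\<And>p. p \<in> QA \<Longrightarrow> \<tau> p = 0 \<Longrightarrow> p * r \<in> alternating s" for q1 r
  proof -
    define p where "p = q * q1 - \<tau> (q * q1) *\<^sub>C 1"
    have qq: "q * q1 \<in> QA" using q q1 by (rule generated_intros)
    then have "p \<in> QA" "\<tau> p = 0" using tau_center QA_A by (auto simp: p_def intro: generated_intros)
    then have "1 * (p * r) * g \<in> span_words s" using r(2) one g by (intro span_words.long)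
    moreover have "(\<tau> (q * q1) *\<^sub>C 1) * (r * g) \<in> span_words s"
      by (rule span_words_mult_UF [OF s UF_intros(3) [OF s one] r(1)])
    moreover have "q * (q1 * r) * g = 1 * (p * r) * g + (\<tau> (q * q1) *\<^sub>C 1) * (r * g)"
      by (simp add: p_def left_diff_distrib mult.assoc)
    ultimately show ?thesis by (metis span_words.add)
  qed
  from k show ?thesis
  proof (cases rule: alternating.cases)
    case single
    with main [of k 1] g show ?thesis by (simp add: alternating.single span_words.short)
  next
    case (step q1 g1 k1)
    have "q * (q1 * (g1 * k1)) * g \<in> span_words s"
    proof (rule main [OF step(2)])
      show "p * (g1 * k1) \<in> alternating s" if "p \<in> QA" "\<tau> p = 0" for p
        using alternating.step [OF that step(4,5,6)] by (simp add: mult.assoc)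
      show "g1 * k1 * g \<in> span_words s"
        using step(4,6) g by (rule span_words.long)
    qed
    then show ?thesis by (simp add: step mult.assoc)
  qed
qed

lemma span_words_scaleC:
  assumes s: "0 \<le> s" and a: "a \<in> span_words s" shows "c *\<^sub>C a \<in> span_words s"
  using span_words_mult_UF [OF s UF_intros(3) [OF s UF_intros(1) [OF s]] a, of c]
  by (simp add: scaleC_mult_left)

text \<open>Together with \<open>span_words_mult_UF\<close> this places every word in the letters in
  the span, building it up from its right end. In the long case the left factor \<open>g1\<close>
  has to be centred before \<open>q\<close> can extend the alternating word.\<close>

lemma span_words_mult_QA:
  assumes s: "0 \<le> s" and q: "q \<in> QA" and a: "a \<in> span_words s"
  shows "q * a \<in> span_words s"
proof -
  note one = UF_intros(1) [OF s]
  define p where "p = q - \<tau> q *\<^sub>C 1"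
  have p: "p \<in> QA" "\<tau> p = 0" using q tau_center QA_A by (auto simp: p_def intro: generated_intros)
  have split: "q * b = p * b + \<tau> q *\<^sub>C b" for b by (simp add: p_def left_diff_distrib scaleC_mult_left)
  show ?thesis
    using a
  proof (induction rule: span_words.induct)
    case (short g)
    have "1 * p * g \<in> span_words s" using one alternating.single [OF p] short by (rule span_words.long)
    moreover have "\<tau> q *\<^sub>C g \<in> span_words s" using short by (intro span_words_scaleC [OF s] span_words.short)
    ultimately show ?case unfolding split [of g] mult_1 by (rule span_words.add)
  next
    case (long g1 k g2)
    define g0 where "g0 = g1 - \<tau> g1 *\<^sub>C 1"
    have g0: "g0 \<in> UF s" using long(1) UF_intros [OF s] by (simp add: g0_def)
    have t0: "\<tau> g0 = 0" using long(1) tau_center UA_A by (simp add: g0_def)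
    have "1 * (p * g0 * k) * g2 \<in> span_words s"
      using one alternating.step [OF p g0 t0 long(2)] long(3) by (rule span_words.long)
    moreover have "\<tau> q *\<^sub>C (g0 * k * g2) \<in> span_words s"
      using g0 long by (intro span_words_scaleC [OF s] span_words.long)
    moreover have "\<tau> g1 *\<^sub>C (q * k * g2) \<in> span_words s"
      using long q by (intro span_words_scaleC [OF s] alternating_mult_QA [OF s])
    moreover have "q * (g1 * k * g2) = (1 * (p * g0 * k) * g2 + \<tau> q *\<^sub>C (g0 * k * g2)) + \<tau> g1 *\<^sub>C (q * k * g2)"
    proof -
      have "q * (g1 * k * g2) = q * (g0 * k * g2) + \<tau> g1 *\<^sub>C (q * k * g2)"
        by (simp add: g0_def left_diff_distrib right_diff_distrib scaleC_mult_left scaleC_mult_right mult.assoc)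
      then show ?thesis using split [of "g0 * k * g2"] by (simp add: mult.assoc)
    qed
    ultimately show ?case by (metis span_words.add)
  qed (simp add: distrib_left span_words.add)
qed

lemma tau_conj_centred:
  assumes "0 \<le> s" and Y: "Y \<in> UA" "\<And>g. g \<in> UF s \<Longrightarrow> \<tau> (g * Y) = 0" and g: "g \<in> UF s" "g' \<in> UF s"
  shows "\<tau> (g * Y * g') = 0"
proof -
  have "\<tau> (g * Y * g') = \<tau> (g' * g * Y)"
    using tracial [of "g * Y" g'] g Y UA_A by (simp add: mult.assoc)
  then show ?thesis using Y(2) [OF UF_intros(2) [OF assms(1) g(2,1)]] by simp
qed

lemma tau_span_words_mult:
  assumes s: "0 \<le> s" and Y: "Y \<in> UA" "\<And>g. g \<in> UF s \<Longrightarrow> \<tau> (g * Y) = 0" and a: "a \<in> span_words s"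
  shows "\<tau> (a * Y) = 0"
  using a
proof (induction rule: span_words.induct)
  case (long g k g')
  have "\<tau> (g * k * g' * Y) = \<tau> (k * (g' * Y * g))"
    using tracial [of g "k * g' * Y"] long alternating_A Y UA_A by (simp add: mult.assoc)
  also have "\<dots> = 0" using long Y by (intro tau_alternating_mult) (auto intro: generated_intros)
  finally show ?case .
next
  case (add a b)
  then show ?case using span_words_A UA_A [OF Y(1)] by (simp add: distrib_right tau_add)
qed (use Y in simp)

text \<open>If \<open>a\<close> and \<open>b\<close> are short, this is the hypothesis on
  \<open>UF s\<close>. If one of them is long, both sides vanish: rotated cyclically, the trace is
  that of an alternating word times an element of \<open>UA\<close>. If both are long, the two
  blocks between the alternating words are centred because \<open>Y\<close> and \<open>Y'\<close>
  are orthogonal to \<open>UF s\<close>.\<close>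

lemma tau_span_words_mult_mult:
  assumes s: "0 \<le> s" and Y: "Y \<in> UA" "\<And>g. g \<in> UF s \<Longrightarrow> \<tau> (g * Y) = 0"
    and Y': "Y' \<in> UA" "\<And>g. g \<in> UF s \<Longrightarrow> \<tau> (g * Y') = 0"
    and YY': "\<And>g g'. g \<in> UF s \<Longrightarrow> g' \<in> UF s \<Longrightarrow> \<tau> (g * Y * g' * Y') = r * \<tau> g * \<tau> g'"
    and a: "a \<in> span_words s" and b: "b \<in> span_words s"
  shows "\<tau> (a * Y * b * Y') = r * \<tau> a * \<tau> b"
proof -
  have YA: "Y \<in> A" "Y' \<in> A" using Y Y' UA_A by auto
  have long0: "\<tau> (g * k * g') = 0" if "g \<in> UF s" "k \<in> alternating s" "g' \<in> UF s" for g k g'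
  proof -
    have "\<tau> (g * k * g') = \<tau> (k * (g' * g))"
      using tracial [of g "k * g'"] that alternating_A UA_A by (simp add: mult.assoc)
    then show ?thesis using that by (simp add: tau_alternating_mult generated_intros)
  qed
  from a show ?thesis
  proof (induction rule: span_words.induct)
    case (short g)
    from b show ?case
    proof (induction rule: span_words.induct)
      case (short g')
      then show ?case using YY' \<open>g \<in> UF s\<close> by blast
    next
      case (long g1 k g2)
      have "\<tau> (g * Y * (g1 * k * g2) * Y') = \<tau> (k * (g2 * Y' * (g * Y * g1)))"
        using tracial [of "g * Y * g1" "k * g2 * Y'"] long short YA alternating_A UA_A by (simp add: mult.assoc)
      also have "\<dots> = 0"
        using long short Y Y' by (intro tau_alternating_mult) (auto intro: generated_intros)
      finally show ?case using long0 [OF long] by simp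
    next
      case (add b b')
      then show ?case using span_words_A UA_A short YA by (simp add: distrib_left distrib_right tau_add)
    qed
  next
    case (long g1 k g2)
    from b show ?case
    proof (induction rule: span_words.induct)
      case (short g)
      have "\<tau> (g1 * k * g2 * Y * g * Y') = \<tau> (k * (g2 * Y * g * Y' * g1))"
        using tracial [of g1 "k * g2 * Y * g * Y'"] long short YA alternating_A UA_A by (simp add: mult.assoc)
      also have "\<dots> = 0"
        using long short Y Y' by (intro tau_alternating_mult) (auto intro: generated_intros)
      finally show ?case using long0 [OF long] by simp
    next
      case (long h1 k' h2)
      note gk = \<open>g1 \<in> UF s\<close> \<open>k \<in> alternating s\<close> \<open>g2 \<in> UF s\<close>
      have "\<tau> (g1 * k * g2 * Y * (h1 * k' * h2) * Y') = \<tau> (k * (g2 * Y * h1) * k' * (h2 * Y' * g1))"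
        using tracial [of g1 "k * g2 * Y * (h1 * k' * h2) * Y'"] gk long YA alternating_A UA_A
        by (simp add: mult.assoc)
      also have "\<dots> = 0"
        using gk long Y Y' tau_conj_centred [OF s Y gk(3) long(1)] tau_conj_centred [OF s Y' long(3) gk(1)]
        by (intro tau_alternating_mult4) (auto intro: generated_intros)
      finally show ?case using long0 [OF gk] by simp
    next
      case (add b b')
      then show ?case using span_words_A UA_A long YA alternating_A by (simp add: distrib_left distrib_right tau_add)
    qed
  next
    case (add a a')
    then show ?case using span_words_A [OF b] span_words_A YA by (simp add: distrib_left distrib_right tau_add)
  qed
qed

text \<open>Subtracting the mean removes the term with \<open>\<tau> (c * d)\<close> from
  \<open>tau_W_quadratic\<close>, since the square of the mean is \<open>exp (- h)\<close>. What
  remains has the product form that transfers from \<open>UF s\<close> to words containing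
  \<open>R\<close> and \<open>S\<close>.\<close>

lemma tau_span_words_increment:
  assumes s: "0 \<le> s" and h: "0 \<le> h" and a: "a \<in> span_words s" and b: "b \<in> span_words s"
  defines "X \<equiv> W s h - complex_of_real (exp (- h / 2)) *\<^sub>C 1"
  shows "\<tau> (a * star_if e X) = 0"
    and "\<tau> (a * star_if e X * b * star_if e' X) = increment_covariance h e e' * \<tau> a * \<tau> b"
proof -
  define m where "m = complex_of_real (exp (- h / 2))"
  note WA = W_A [OF s h] star_if_A [OF W_A [OF s h]]
  have XA: "X \<in> A" using WA by (simp add: X_def)
  have starX: "star_if e X = star_if e (W s h) - m *\<^sub>C 1" for e
    by (simp add: X_def m_def star_if_simps)
  have "W s h \<in> UA" unfolding W_def
    by (intro star_algebra_generated.mult star_algebra_generated.adj star_algebra_generated.base) (use s h in auto)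
  then have X: "X \<in> UA" unfolding X_def
    by (intro generated_diff star_algebra_generated.scaleC star_algebra_generated.one)
  have mm: "m * m = complex_of_real (exp (- h))"
    unfolding m_def of_real_mult [symmetric] exp_add [symmetric] by simp
  have lin: "\<tau> (g * star_if e (W s h)) = m * \<tau> g" if g: "g \<in> \<F> s" for g e
    using tau_mult_star_W_minus_one [OF s h g, of e] F_subset [OF s g] WA
    by (simp add: m_def star_if_simps right_diff_distrib left_diff_distrib tau_diff)
  have lin0: "\<tau> (g * star_if e X) = 0" if "g \<in> UF s" for g e
    using lin [of g e] that F_subset [OF s, of g] WA
    by (simp add: starX right_diff_distrib tau_diff scaleC scaleC_mult_right)
  have q1: "\<tau> (g * X * g' * star_if e X) = increment_covariance h False e * \<tau> g * \<tau> g'"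
    if g: "g \<in> UF s" "g' \<in> UF s" for g g' e
  proof -
    have gF: "g \<in> \<F> s" "g' \<in> \<F> s" and gA: "g \<in> A" "g' \<in> A" using g F_subset s by auto
    have gg: "g * g' \<in> \<F> s" "g' * g \<in> \<F> s" using gF F_vna [OF s] by (auto intro: vna_mult)
    have "\<tau> (g * W s h * g') = \<tau> (g' * g * W s h)"
      using tracial [of "g * W s h" g'] gA WA by (simp add: mult.assoc)
    also have "\<dots> = m * \<tau> (g * g')" using lin [OF gg(2), of False] tracial [OF gA] by (simp add: star_if_def)
    finally have 1: "\<tau> (g * W s h * g') = m * \<tau> (g * g')" .
    have "g * X * g' * star_if e X = g * W s h * g' * star_if e (W s h) - m *\<^sub>C (g * W s h * g')
        - (m *\<^sub>C (g * g' * star_if e (W s h)) - (m * m) *\<^sub>C (g * g'))"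
      unfolding starX by (simp add: X_def m_def algebra_simps scaleC_mult_left scaleC_mult_right scaleC_scaleC
          scaleC_diff_right)
    then have "\<tau> (g * X * g' * star_if e X) = \<tau> (g * W s h * g' * star_if e (W s h)) - m * \<tau> (g * W s h * g')
        - (m * \<tau> (g * g' * star_if e (W s h)) - (m * m) * \<tau> (g * g'))"
      using gA WA by (simp add: tau_diff scaleC)
    then show ?thesis
      unfolding 1 lin [OF gg(1)] tau_W_quadratic [OF s h gF] by (simp add: mult.assoc flip: mm)
  qed
  \<comment> \<open>The remaining combinations of flags follow by rotating or conjugating the trace,
    as the covariance is real and symmetric in the flags.\<close>
  have q2: "\<tau> (g * adj X * g' * X) = increment_covariance h True False * \<tau> g * \<tau> g'"
    if g: "g \<in> UF s" "g' \<in> UF s" for g g'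
    using tracial [of "g * adj X" "g' * X"] q1 [OF g(2,1), of True] g UA_A XA
    by (simp add: star_if_def mult.assoc increment_covariance_def mult.left_commute mult.commute)
  have q3: "\<tau> (g * adj X * g' * adj X) = increment_covariance h True True * \<tau> g * \<tau> g'"
    if g: "g \<in> UF s" "g' \<in> UF s" for g g'
  proof -
    have gA: "g \<in> A" "g' \<in> A" using g UA_A by auto
    have "\<tau> (g * adj X * g' * adj X) = cnj (\<tau> (X * (adj g' * X * adj g)))"
      using tau_adj [of "X * (adj g' * X * adj g)"] gA XA by (simp add: mult.assoc)
    also have "\<tau> (X * (adj g' * X * adj g)) = \<tau> (adj g' * X * adj g * X)"
      using gA XA by (intro tracial) auto
    also have "\<dots> = increment_covariance h False False * \<tau> (adj g') * \<tau> (adj g)"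
      using q1 [of "adj g'" "adj g" False] g UF_intros(5) [OF s] by (simp add: star_if_def)
    finally show ?thesis using gA by (simp add: tau_adj increment_covariance_def mult_ac)
  qed
  have Z: "star_if e X \<in> UA" for e using X by (auto simp: star_if_def intro: generated_intros)
  have ZZ: "\<tau> (g * star_if e X * g' * star_if e' X) = increment_covariance h e e' * \<tau> g * \<tau> g'"
    if "g \<in> UF s" "g' \<in> UF s" for g g'
    using q1 [OF that, of e'] q2 [OF that] q3 [OF that] by (cases e; cases e') (simp_all add: star_if_def)
  show "\<tau> (a * star_if e X) = 0"
    by (rule tau_span_words_mult [OF s Z lin0 a])
  show "\<tau> (a * star_if e X * b * star_if e' X) = increment_covariance h e e' * \<tau> a * \<tau> b"
    by (rule tau_span_words_mult_mult [OF s Z lin0 Z lin0 ZZ a b])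
qed

subsection \<open>Second-order expansion of the moments\<close>

text \<open>Numbering the letters by position lets one parity decide both the symmetry and whether
  it is followed by \<open>W\<close> or by its adjoint, and makes words periodic under shifts by
  two.\<close>

definition letter :: "real \<Rightarrow> nat \<Rightarrow> 'h bop"
  where "letter s j = (if even j then adj (U s) * R * U s else S)"

definition letters :: "real \<Rightarrow> nat \<Rightarrow> nat \<Rightarrow> 'h bop"
  where "letters s i j = prod_list (map (letter s) [i..<j])"

definition moved_word :: "real \<Rightarrow> real \<Rightarrow> nat \<Rightarrow> 'h bop"
  where "moved_word s h k = prod_list (map (\<lambda>j. letter s j * star_if (odd j) (W s h)) [0..<k])"

lemma symmetry_inverse: "R * R = 1" "R * (R * a) = a" "S * S = 1" "S * (S * a) = a" "adj R = R" "adj S = S"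
  using R_symmetry S_symmetry by (auto simp: symmetry_def selfadjoint_def unitary_def simp flip: mult.assoc)

lemma tau_unitary_le: "u \<in> A \<Longrightarrow> unitary u \<Longrightarrow> cmod (\<tau> u) \<le> 1"
  using tau_le_norm unitary_norm order_trans by blast

lemma moment_moved_word:
  assumes s: "0 \<le> s" and h: "0 \<le> h"
  shows "\<tau> ((R * U (s + h) * S * adj (U (s + h))) ^ n) = \<tau> (moved_word s h (2 * n))"
proof -
  define y where "y = adj (U s) * R * U s * W s h * S * adj (W s h)"
  note Us = U_A [OF s] U_unitary [OF s]
  have yA: "y \<in> A" using Us R_A S_A W_A [OF s h] by (simp add: y_def)
  have "moved_word s h (2 * n) = y ^ n"
    by (induction n) (simp_all add: moved_word_def y_def letter_def star_if_def mult.assoc power_commutes)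
  moreover have "(R * U (s + h) * S * adj (U (s + h))) ^ n = U s * y ^ n * adj (U s)"
  proof (induction n)
    case (Suc n)
    have "R * U (s + h) * S * adj (U (s + h)) = U s * y * adj (U s)"
      using Us by (simp add: U_shift [OF s h] y_def mult.assoc unitary_inverse)
    then show ?case using Suc Us by (simp add: mult.assoc unitary_inverse)
  qed (use Us in \<open>simp add: unitary_inverse\<close>)
  moreover have "\<tau> (U s * y ^ n * adj (U s)) = \<tau> (y ^ n)"
    using tracial [of "U s * y ^ n" "adj (U s)"] Us yA by (simp add: unitary_inverse mult.assoc)
  ultimately show ?thesis by simp
qed

context
  fixes s :: real
  assumes s: "0 \<le> s"
begin

lemma letter_A: "letter s j \<in> A" and letter_unitary: "unitary (letter s j)"
  and letter_square: "letter s j * letter s j = 1" "letter s j * (letter s j * a) = a"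
proof -
  note Us = U_A [OF s] U_unitary [OF s]
  show "letter s j \<in> A" using Us R_A S_A by (simp add: letter_def)
  show "unitary (letter s j)" using Us R_symmetry S_symmetry
    by (auto simp: letter_def symmetry_def intro: unitary_mult unitary_adj)
  show "letter s j * letter s j = 1" using Us
    by (simp add: letter_def mult.assoc unitary_inverse symmetry_inverse)
  then show "letter s j * (letter s j * a) = a" by (simp flip: mult.assoc)
qed

lemma letters_simps: "letters s i i = 1" "i \<le> j \<Longrightarrow> letters s i (Suc j) = letters s i j * letter s j"
  by (simp_all add: letters_def)

lemma letters_append: "i \<le> j \<Longrightarrow> j \<le> k \<Longrightarrow> letters s i j * letters s j k = letters s i k"
proof -
  assume "i \<le> j" "j \<le> k"
  then have "[i..<k] = [i..<j] @ [j..<k]" by (metis le_add_diff_inverse upt_add_eq_append)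
  then show ?thesis by (simp add: letters_def)
qed

lemma letters_A: "letters s i j \<in> A" and letters_unitary: "unitary (letters s i j)"
proof -
  have "prod_list (map (letter s) xs) \<in> A \<and> unitary (prod_list (map (letter s) xs))" for xs
    by (induction xs) (auto intro: letter_A letter_unitary unitary_mult unitary_one)
  then show "letters s i j \<in> A" "unitary (letters s i j)" by (simp_all add: letters_def)
qed

lemma letter_mult_span: "a \<in> span_words s \<Longrightarrow> letter s j * a \<in> span_words s"
proof -
  assume a: "a \<in> span_words s"
  have RS: "R \<in> QA" "S \<in> QA" by (auto intro: star_algebra_generated.base)
  have "adj (U s) * (R * (U s * a)) \<in> span_words s"
    using UF_intros(5,6) [OF s] by (intro span_words_mult_UF [OF s] span_words_mult_QA [OF s] RS a)
  then show ?thesis using span_words_mult_QA [OF s RS(2) a] by (simp add: letter_def mult.assoc)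
qed

lemma letters_mult_span: "a \<in> span_words s \<Longrightarrow> letters s i j * a \<in> span_words s"
proof -
  assume a: "a \<in> span_words s"
  have "prod_list (map (letter s) xs) * a \<in> span_words s" for xs
    by (induction xs) (auto simp: a mult.assoc intro: letter_mult_span)
  then show ?thesis by (simp add: letters_def)
qed

lemma letters_span: "letters s i j \<in> span_words s"
  using letters_mult_span [OF span_words.short [OF UF_intros(1) [OF s]]] by simp

end

context
  fixes s h :: real
  assumes s: "0 \<le> s" and h: "0 \<le> h" "h \<le> 1"
begin

section \<open>Terms of order one, two and higher in the increments\<close>

definition increment :: "nat \<Rightarrow> 'h bop"
  where "increment j = star_if (odd j) (W s h - 1)"

definition first_order :: "nat \<Rightarrow> 'h bop"
  where "first_order k = (\<Sum>p<k. letters s 0 (Suc p) * increment p * letters s (Suc p) k)"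

definition second_order :: "nat \<Rightarrow> 'h bop"
  where "second_order k = (\<Sum>q<k. \<Sum>p<q. letters s 0 (Suc p) * increment p * letters s (Suc p) (Suc q) *
    increment q * letters s (Suc q) k)"

definition remainder :: "nat \<Rightarrow> 'h bop"
  where "remainder k = moved_word s h k - letters s 0 k - first_order k - second_order k"

lemma increment_A: "increment j \<in> A"
  using W_A [OF s h(1)] by (simp add: increment_def star_if_def)

lemma one_plus_increment: "1 + increment j = star_if (odd j) (W s h)"
  by (simp add: increment_def star_if_def)

text \<open>Three or more increments either occur already among the first \<open>k\<close> places,
  and then the last factor is kept unexpanded as a unitary, or exactly two occur there and the third
  is the last one. This avoids enumerating all terms of higher order.\<close>

lemma remainder_Suc:
  "remainder (Suc k) = remainder k * (letter s k * star_if (odd k) (W s h)) + second_order k * letter s k * increment k"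
proof -
  have F: "first_order (Suc k) = first_order k * letter s k + letters s 0 k * letter s k * increment k"
    by (simp add: first_order_def letters_simps [OF s] sum_distrib_right mult.assoc)
  have G: "second_order (Suc k) = second_order k * letter s k + first_order k * letter s k * increment k"
    by (simp add: second_order_def first_order_def letters_simps [OF s] sum_distrib_right mult.assoc)
  have M: "moved_word s h (Suc k) = moved_word s h k * (letter s k * (1 + increment k))"
    by (simp add: moved_word_def one_plus_increment)
  show ?thesis
    unfolding remainder_def F G M one_plus_increment [symmetric]
    by (simp add: letters_simps [OF s] algebra_simps)
qed

lemma norm2_increment: "norm2 \<tau> (increment j) \<le> sqrt h"
  using norm2_W_minus_one_le [OF s h(1)] norm2_adj [of "W s h - 1"] W_A [OF s h(1)]
  by (simp add: increment_def star_if_def)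

lemma increment_square:
  "adj (increment j) * increment j = 2 *\<^sub>R 1 - W s h - adj (W s h)"
  "increment j * adj (increment j) = 2 *\<^sub>R 1 - W s h - adj (W s h)"
  using W_unitary [OF s h(1)]
  by (auto simp: increment_def star_if_def algebra_simps unitary_inverse scaleR_2)

text \<open>This is the L4 bound: the operator is the square of the modulus of \<open>W - 1\<close>,
  so its L2 norm is the square of the L4 norm of \<open>W - 1\<close>.\<close>

lemma norm2_increment_square: "norm2 \<tau> (2 *\<^sub>R 1 - W s h - adj (W s h)) \<le> 2 * h"
proof -
  define q where "q = exp (- h)"
  define m where "m = exp (- h / 2)"
  define w where "w = W s h"
  have wA: "w \<in> A" and wu: "unitary w" using W_A [OF s h(1)] W_unitary [OF s h(1)] by (simp_all add: w_def)
  have w1: "\<tau> w = complex_of_real m"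
    using tau_mult_W [OF s h(1), of 1] s by (simp add: vna_one F_vna unital w_def m_def)
  have w2: "\<tau> (w * w) = complex_of_real (q * (1 - h))"
    using tau_W_quadratic [OF s h(1), of 1 1 False] s
    by (simp add: vna_one F_vna unital w_def q_def star_if_def increment_covariance_def algebra_simps)
  define P where "P = 2 *\<^sub>R 1 - w - adj w"
  have PA: "P \<in> A" "adj P = P" using wA by (simp_all add: P_def)
  have "\<tau> P = complex_of_real (2 - 2 * m)"
    using wA by (simp add: P_def tau_simps tau_adj w1)
  moreover have "w * P = 2 *\<^sub>R w - w * w - 1" "adj w * P = 2 *\<^sub>R adj w - 1 - adj (w * w)"
    using wu by (simp_all add: P_def right_diff_distrib unitary_inverse)
  then have "\<tau> (w * P) = complex_of_real (2 * m - q * (1 - h) - 1)"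
    "\<tau> (adj w * P) = complex_of_real (2 * m - 1 - q * (1 - h))"
    using wA by (simp_all add: tau_simps tau_adj w1 w2 del: adj_simps(5))
  moreover have "P * P = 2 *\<^sub>R P - w * P - adj w * P"
    by (subst (1) P_def) (simp add: left_diff_distrib)
  ultimately have "\<tau> (P * P) = complex_of_real (6 - 8 * m + 2 * (q * (1 - h)))"
    using PA wA by (simp add: tau_simps)
  then have "(norm2 \<tau> P)\<^sup>2 = 6 - 8 * m + 2 * (q * (1 - h))"
    using PA by (simp add: norm2_square_Re)
  \<comment> \<open>Terms of order 0 and 1 in \<open>h\<close> cancel, so \<open>exp (- h)\<close>
    is needed to second order from above, but \<open>exp (- h / 2)\<close> only to first order from
    below.\<close>
  also have "\<dots> \<le> 6 - 8 * (1 - h / 2) + 2 * ((1 - h + h\<^sup>2 / 2) * (1 - h))"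
    using exp_minus_bounds(1) [of "h / 2"] exp_minus_bounds(2) [of h] h
    unfolding q_def m_def by (intro add_mono diff_mono mult_left_mono mult_right_mono) auto
  also have "\<dots> = 3 * h\<^sup>2 - h * h\<^sup>2" by (simp add: field_simps power2_eq_square)
  also have "\<dots> \<le> (2 * h)\<^sup>2" using h by (simp add: power_mult_distrib) (smt (verit) mult_nonneg_nonneg zero_le_power2)
  finally have "norm2 \<tau> P \<le> 2 * h"
    by (rule power2_le_imp_le) (use h in simp)
  then show ?thesis by (simp add: P_def w_def)
qed

text \<open>Cauchy-Schwarz with two increments on one side, of size \<open>2 * h\<close> by the L4
  bound, and the third on the other, of size \<open>sqrt h\<close>.\<close>

lemma tau_three_increments:
  assumes u: "u \<in> A" "unitary u" "v \<in> A" "unitary v" "w \<in> A" "unitary w"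
  shows "cmod (\<tau> (u * increment i * v * increment j * w * increment k)) \<le> 2 * h * sqrt h"
proof -
  define P where "P = 2 *\<^sub>R 1 - W s h - adj (W s h)"
  note YA = increment_A
  have PA: "P \<in> A" using W_A [OF s h(1)] by (simp add: P_def)
  have "(norm2 \<tau> (increment i * v * increment j))\<^sup>2 = Re (\<tau> (adj (increment j) * (adj v * P * v * increment j)))"
    using YA [of i] YA [of j] u increment_square(1) [of i]
    by (simp add: norm2_square_Re mult.assoc P_def flip: mult.assoc [of "adj (increment i)"])
  \<comment> \<open>Rotated so that \<open>increment j\<close> meets its adjoint: for the unitary
    \<open>W\<close> both orders of the product are \<open>P\<close>.\<close>
  also have "\<tau> (adj (increment j) * (adj v * P * v * increment j)) = \<tau> (adj v * P * v * increment j * adj (increment j))"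
    using u YA PA by (intro tracial) auto
  also have "\<dots> = \<tau> ((adj v * P * v) * P)" using increment_square(2) [of j] by (simp add: mult.assoc P_def)
  also have "Re \<dots> \<le> cmod \<dots>" by (rule complex_Re_le_cmod)
  also have "\<dots> \<le> norm2 \<tau> (adj v * P * v) * norm2 \<tau> P" using u PA by (intro tau_mult_le) auto
  also have "norm2 \<tau> (adj v * P * v) = norm2 \<tau> P"
    using norm2_unitary_mult_left [OF unitary_adj [OF u(4)], of "P * v"] norm2_unitary_mult_right [OF u(3) PA u(4)]
    by (simp add: mult.assoc)
  finally have "(norm2 \<tau> (increment i * v * increment j))\<^sup>2 \<le> (norm2 \<tau> P)\<^sup>2" by (simp add: power2_eq_square)
  then have "norm2 \<tau> (increment i * v * increment j) \<le> norm2 \<tau> P"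
    by (rule power2_le_imp_le) (simp add: norm2_nonneg PA)
  then have 1: "norm2 \<tau> (increment i * v * increment j) \<le> 2 * h"
    using norm2_increment_square by (simp add: P_def)
  have "cmod (\<tau> ((u * (increment i * v * increment j)) * (w * increment k))) \<le>
      norm2 \<tau> (u * (increment i * v * increment j)) * norm2 \<tau> (w * increment k)"
    using u YA by (intro tau_mult_le) auto
  also have "\<dots> \<le> (2 * h) * sqrt h"
    unfolding norm2_unitary_mult_left [OF u(2)] norm2_unitary_mult_left [OF u(6)]
    using 1 norm2_increment h YA norm2_nonneg by (intro mult_mono) auto
  finally show ?thesis by (simp add: mult.assoc)
qed

lemma first_second_order_A: "first_order k \<in> A" "second_order k \<in> A"
  unfolding first_order_def second_order_def
  by (intro vna_sum [OF von_neumann] vna_mult [OF von_neumann] letters_A s increment_A)+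

lemma remainder_A: "remainder k \<in> A"
proof -
  have "moved_word s h k \<in> A"
    by (induction k) (auto simp: moved_word_def star_if_def intro: letter_A s W_A [OF s h(1)])
  then show ?thesis unfolding remainder_def using first_second_order_A letters_A [OF s] by auto
qed

text \<open>The unitary \<open>v\<close> is general because the last factor of the recursion is
  carried into it by traciality. The cube comes from the recursion: \<open>k^3\<close> plus at most
  \<open>k^2\<close> new triples stays below \<open>(k + 1)^3\<close>.\<close>

lemma remainder_bound:
  assumes "v \<in> A" "unitary v"
  shows "cmod (\<tau> (v * remainder k)) \<le> real (k ^ 3) * (2 * h * sqrt h)"
  using assms
proof (induction k arbitrary: v)
  case 0
  then show ?case
    by (simp add: remainder_def moved_word_def letters_simps [OF s] first_order_def second_order_def tau_zero)
next
  case (Suc k)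
  define e where "e = 2 * h * sqrt h"
  have e0: "0 \<le> e" using h by (simp add: e_def)
  define a where "a = letter s k * star_if (odd k) (W s h)"
  have a: "a \<in> A" "unitary a"
    using letter_A [OF s] letter_unitary [OF s] W_A [OF s h(1)] W_unitary [OF s h(1)]
    by (auto simp: a_def star_if_def intro: unitary_mult unitary_adj)
  have "\<tau> (v * (remainder k * a)) = \<tau> (a * v * remainder k)"
    using tracial [of "v * remainder k" a] Suc.prems a remainder_A by (simp add: mult.assoc)
  then have 1: "cmod (\<tau> (v * (remainder k * a))) \<le> real (k ^ 3) * e"
    using Suc.IH [of "a * v"] a Suc.prems unitary_mult [OF a(2) Suc.prems(2)] by (simp add: e_def)
  have "\<tau> (v * (second_order k * letter s k * increment k)) =
      (\<Sum>q<k. \<Sum>p<q. \<tau> ((v * letters s 0 (Suc p)) * increment p * letters s (Suc p) (Suc q) *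
        increment q * (letters s (Suc q) k * letter s k) * increment k))"
    using Suc.prems letters_A [OF s] letter_A [OF s] increment_A
    by (simp add: second_order_def sum_distrib_left sum_distrib_right tau_sum mult.assoc)
  also have "cmod \<dots> \<le> (\<Sum>q<k. \<Sum>p<q. e)"
    unfolding e_def using Suc.prems letters_A [OF s] letter_A [OF s] letters_unitary [OF s] letter_unitary [OF s]
    by (intro order_trans [OF norm_sum sum_mono] tau_three_increments) (auto intro: unitary_mult)
  also have "\<dots> \<le> (\<Sum>q<k. real k * e)"
    using e0 by (intro sum_mono) (auto intro!: mult_right_mono)
  finally have 2: "cmod (\<tau> (v * (second_order k * letter s k * increment k))) \<le> real k * (real k * e)" by simp
  have "\<tau> (v * remainder (Suc k)) = \<tau> (v * (remainder k * a)) + \<tau> (v * (second_order k * letter s k * increment k))"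
    using Suc.prems a remainder_A first_second_order_A letter_A [OF s] increment_A
    by (simp add: remainder_Suc distrib_left tau_add a_def [symmetric])
  then have "cmod (\<tau> (v * remainder (Suc k))) \<le> real (k ^ 3) * e + real k * (real k * e)"
    using norm_triangle_ineq [of "\<tau> (v * (remainder k * a))" "\<tau> (v * (second_order k * letter s k * increment k))"] 1 2
    by simp
  also have "\<dots> = real (k ^ 3 + k * k) * e" by (simp add: algebra_simps)
  also have "\<dots> \<le> real (Suc k ^ 3) * e"
    using e0 by (intro mult_right_mono, subst of_nat_le_iff) (simp_all add: power3_eq_cube algebra_simps)
  finally show ?case by (simp add: e_def)
qed

lemma increment_eq:
  "increment j = star_if (odd j) (W s h - complex_of_real (exp (- h / 2)) *\<^sub>C 1) + complex_of_real (exp (- h / 2) - 1) *\<^sub>C 1"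
proof -
  have "complex_of_real (exp (- h / 2) - 1) *\<^sub>C 1 = complex_of_real (exp (- h / 2)) *\<^sub>C 1 - (1 :: 'h bop)"
    using scaleC_add_left [of "complex_of_real (exp (- h / 2) - 1)" 1 "1 :: 'h bop"] scaleC_one [of "1 :: 'h bop"]
    by simp
  then show ?thesis by (simp add: increment_def star_if_def)
qed

lemma tau_span_mult_increment:
  assumes c: "c \<in> span_words s"
  shows "\<tau> (c * increment j) = complex_of_real (exp (- h / 2) - 1) * \<tau> c"
proof -
  define X where "X = star_if (odd j) (W s h - complex_of_real (exp (- h / 2)) *\<^sub>C 1)"
  have XA: "X \<in> A" using W_A [OF s h(1)] by (simp add: X_def star_if_def)
  define \<mu> where "\<mu> = complex_of_real (exp (- h / 2) - 1)"
  have "increment j = X + \<mu> *\<^sub>C 1" by (simp only: increment_eq X_def \<mu>_def)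
  moreover have "\<tau> (c * X) = 0" unfolding X_def by (rule tau_span_words_increment(1) [OF s h(1) c c])
  ultimately show ?thesis
    using XA span_words_A [OF c] unfolding \<mu>_def [symmetric]
    by (simp add: distrib_left tau_add scaleC scaleC_mult_right)
qed

text \<open>Each increment is its centred part plus the scalar \<open>exp (- h / 2) - 1\<close>; the
  mixed terms vanish and the product of the scalars is of order \<open>h^2\<close>.\<close>

lemma tau_two_increments:
  assumes c: "c \<in> span_words s" and d: "d \<in> span_words s" and cd: "c * d \<in> span_words s" and dc: "d * c \<in> span_words s"
  shows "\<tau> (c * increment i * d * increment j) = increment_covariance h (odd i) (odd j) * \<tau> c * \<tau> d +
    complex_of_real ((exp (- h / 2) - 1)\<^sup>2) * \<tau> (c * d)"
proof -
  define X where "X e = star_if e (W s h - complex_of_real (exp (- h / 2)) *\<^sub>C 1)" for e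
  define \<mu> where "\<mu> = complex_of_real (exp (- h / 2) - 1)"
  have XA: "X e \<in> A" for e using W_A [OF s h(1)] by (simp add: X_def star_if_def)
  note cA = span_words_A [OF c] span_words_A [OF d]
  have lin: "\<tau> (a * X e) = 0" if "a \<in> span_words s" for a e
    unfolding X_def by (rule tau_span_words_increment(1) [OF s h(1) that that])
  have inc: "increment j = X (odd j) + \<mu> *\<^sub>C 1" for j
    by (simp only: increment_eq X_def \<mu>_def)
  have "c * increment i * d * increment j = c * X (odd i) * d * X (odd j) + \<mu> *\<^sub>C (c * d * X (odd j)) +
      (\<mu> *\<^sub>C (c * X (odd i) * d) + (\<mu> * \<mu>) *\<^sub>C (c * d))"
    unfolding inc by (simp add: algebra_simps scaleC_mult_left scaleC_mult_right scaleC_scaleC scaleC_add_right)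
  moreover have "\<tau> (c * X (odd i) * d) = 0"
    using tracial [of "c * X (odd i)" d] lin [OF dc] cA XA by (simp add: mult.assoc)
  ultimately have "\<tau> (c * increment i * d * increment j) = \<tau> (c * X (odd i) * d * X (odd j)) + (\<mu> * \<mu>) * \<tau> (c * d)"
    using cA XA lin [OF cd] by (simp add: tau_add scaleC)
  also have "\<tau> (c * X (odd i) * d * X (odd j)) = increment_covariance h (odd i) (odd j) * \<tau> c * \<tau> d"
    unfolding X_def by (rule tau_span_words_increment(2) [OF s h(1) c d])
  finally show ?thesis by (simp add: \<mu>_def power2_eq_square)
qed

end

end

subsection \<open>Summation over pairs of positions\<close>

lemma sum_lessThan_double: "(\<Sum>p<2 * j. g p) = (\<Sum>i<j. g (2 * i) + g (2 * i + 1))"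
  for g :: "nat \<Rightarrow> 'a::comm_monoid_add"
  by (induction j) (simp_all add: add_ac)

text \<open>Separates the pairs of positions of equal parity, which will carry two copies of
  \<open>W\<close> or two adjoints, from the pairs of opposite parity, which will carry one of
  each.\<close>

lemma sum_pairs_double:
  fixes w :: "nat \<Rightarrow> nat \<Rightarrow> 'a::comm_monoid_add"
  shows "(\<Sum>q<2 * n. \<Sum>p<q. w p q) =
    (\<Sum>j<n. \<Sum>i<j. w (2 * i) (2 * j) + w (2 * i + 1) (2 * j + 1)) +
    (\<Sum>j<n. (\<Sum>i<j. w (2 * i + 1) (2 * j)) + (\<Sum>i<Suc j. w (2 * i) (2 * j + 1)))"
proof -
  have "(\<Sum>p<2 * j. w p (2 * j)) + (\<Sum>p<2 * j + 1. w p (2 * j + 1)) =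
      (\<Sum>i<j. w (2 * i) (2 * j) + w (2 * i + 1) (2 * j + 1)) +
      ((\<Sum>i<j. w (2 * i + 1) (2 * j)) + (\<Sum>i<Suc j. w (2 * i) (2 * j + 1)))" for j
    by (simp add: sum_lessThan_double sum.distrib add_ac)
  then show ?thesis
    by (simp only: sum_lessThan_double sum.distrib [symmetric])
qed

text \<open>The triangles \<open>i < j\<close> and \<open>i \<le> j\<close> fill the square, because
  the summand is symmetric in \<open>i\<close> and \<open>j\<close>.\<close>

lemma sum_triangle_symmetric:
  fixes v :: "nat \<Rightarrow> 'a::comm_monoid_add"
  shows "(\<Sum>j<n. (\<Sum>i<j. v (i + j)) + (\<Sum>i<Suc j. v (i + j))) = (\<Sum>j<n. \<Sum>i<n. v (i + j))"
  by (induction n) (simp_all add: sum.distrib add_ac)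

text \<open>Reversing the order of the rows and reflecting \<open>k\<close> to \<open>n - k\<close>
  turns the triangle into the complementary one; the two together fill full rows.\<close>

lemma sum_triangle_reflect:
  fixes u :: "nat \<Rightarrow> 'a::comm_semiring_1"
  assumes u: "\<And>k. 0 < k \<Longrightarrow> k < n \<Longrightarrow> u (n - k) = u k"
  shows "2 * (\<Sum>j<n. \<Sum>i<j. u (j - i)) = of_nat n * (\<Sum>k\<in>{1..<n}. u k)"
proof -
  have row: "(\<Sum>i<j. u (j - i)) = (\<Sum>k\<in>{1..<Suc j}. u k)" for j
    by (rule sum.reindex_bij_witness [of _ "\<lambda>k. j - k" "\<lambda>i. j - i"]) auto
  have "(\<Sum>j<n. \<Sum>k\<in>{1..<Suc j}. u k) = (\<Sum>j<n. \<Sum>k\<in>{1..<n - j}. u k)"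
    by (rule sum.reindex_bij_witness [of _ "\<lambda>j. n - Suc j" "\<lambda>j. n - Suc j"]) auto
  also have "\<dots> = (\<Sum>j<n. \<Sum>k\<in>{Suc j..<n}. u k)"
  proof (rule sum.cong)
    fix j assume "j \<in> {..<n}"
    then show "(\<Sum>k\<in>{1..<n - j}. u k) = (\<Sum>k\<in>{Suc j..<n}. u k)"
      by (intro sum.reindex_bij_witness [of _ "\<lambda>k. n - k" "\<lambda>k. n - k"]) (auto simp: u)
  qed simp
  finally have "2 * (\<Sum>j<n. \<Sum>i<j. u (j - i)) = (\<Sum>j<n. (\<Sum>k\<in>{1..<Suc j}. u k) + (\<Sum>k\<in>{Suc j..<n}. u k))"
    by (simp add: row mult_2 sum.distrib)
  also have "\<dots> = (\<Sum>j<n. \<Sum>k\<in>{1..<n}. u k)"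
    by (intro sum.cong sum.atLeastLessThan_concat) auto
  finally show ?thesis by simp
qed

text \<open>The trace of a word of odd length whose middle letter stands at position
  \<open>n\<close>.\<close>

definition parity_value :: "complex \<Rightarrow> complex \<Rightarrow> nat \<Rightarrow> complex"
  where "parity_value a b n = (if even n then a else b)"

text \<open>\<open>n\<close> times this number is the contribution to the derivative of the \<open>n\<close>-th moment of the pairs of one
  \<open>W\<close> and one \<open>W\<^sup>*\<close>, that is, of the pairs of positions at odd distance.\<close>

definition source_coeff :: "complex \<Rightarrow> complex \<Rightarrow> nat \<Rightarrow> complex"
  where "source_coeff a b n = (if odd n then of_nat n * (a * b) else of_nat n * (a\<^sup>2 + b\<^sup>2) / 2)"

text \<open>For odd \<open>n\<close> the two indices always have opposite parity. For even
  \<open>n\<close> they agree, and each row contains either parity \<open>n / 2\<close>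
  times.\<close>

lemma sum_parity_values:
  "(\<Sum>j<n. \<Sum>i<n. parity_value a b (i + j + 1) * parity_value a b (i + j + 1 + n)) = of_nat n * source_coeff a b n"
proof (cases "odd n")
  case True
  then have "parity_value a b (k + 1) * parity_value a b (k + 1 + n) = a * b" for k
    by (auto simp: parity_value_def)
  then show ?thesis using True by (simp add: source_coeff_def)
next
  case False
  then obtain m where m: "n = 2 * m" by blast
  have sq: "parity_value a b (k + n) = parity_value a b k" for k using False by (simp add: parity_value_def)
  have "(\<Sum>i<2 * m. parity_value a b (i + j + 1) * parity_value a b (i + j + 1)) = of_nat m * (a\<^sup>2 + b\<^sup>2)" for j
    by (induction m) (auto simp: parity_value_def power2_eq_square algebra_simps)
  then show ?thesis using False unfolding sq by (simp add: m source_coeff_def field_simps)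
qed

section \<open>The closed differential system of the moments\<close>

context free_unitary_brownian_symmetries
begin

definition moment :: "nat \<Rightarrow> real \<Rightarrow> complex"
  where "moment n s = \<tau> ((R * U s * S * adj (U s)) ^ n)"

text \<open>The coefficient of \<open>h\<close> in \<open>increment_covariance\<close>.\<close>

definition pair_sign :: "nat \<Rightarrow> nat \<Rightarrow> complex"
  where "pair_sign p q = (if odd p = odd q then - 1 else 1)"

text \<open>Cutting the cyclic word of length \<open>k\<close> after the positions \<open>p\<close>
  and \<open>q\<close> leaves two arcs; this one runs through the end of the word.\<close>

definition outer_word :: "real \<Rightarrow> nat \<Rightarrow> nat \<Rightarrow> nat \<Rightarrow> 'h bop"
  where "outer_word s k p q = letters s (Suc q) k * letters s 0 (Suc p)"

definition inner_word :: "real \<Rightarrow> nat \<Rightarrow> nat \<Rightarrow> 'h bop"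
  where "inner_word s p q = letters s (Suc p) (Suc q)"

text \<open>The coefficient of \<open>h\<close> in the expansion: one term for each pair of
  increments, and \<open>- 1 / 2\<close> for the mean of each of the \<open>k\<close> single
  increments.\<close>

definition drift :: "real \<Rightarrow> nat \<Rightarrow> complex"
  where "drift s k = (\<Sum>q<k. \<Sum>p<q. pair_sign p q * (\<tau> (outer_word s k p q) * \<tau> (inner_word s p q))) -
    of_nat k / 2 * \<tau> (letters s 0 k)"

lemma increment_covariance_approx:
  assumes h: "0 \<le> h"
  shows "cmod (increment_covariance h (odd p) (odd q) - h * pair_sign p q) \<le> h\<^sup>2"
proof (cases "odd p = odd q")
  case True
  then have "increment_covariance h (odd p) (odd q) - h * pair_sign p q = complex_of_real (h * (1 - exp (- h)))"
    by (simp add: increment_covariance_def pair_sign_def algebra_simps)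
  also have "cmod \<dots> = \<bar>h * (1 - exp (- h))\<bar>" by (rule norm_of_real)
  also have "\<dots> = h * (1 - exp (- h))" using h by simp
  also have "\<dots> \<le> h * h" using h exp_minus_bounds(1) [OF h] by (intro mult_left_mono) auto
  finally show ?thesis by (simp add: power2_eq_square)
next
  case False
  then have "increment_covariance h (odd p) (odd q) - h * pair_sign p q = complex_of_real (1 - exp (- h) - h)"
    by (simp add: increment_covariance_def pair_sign_def)
  also have "cmod \<dots> = \<bar>1 - exp (- h) - h\<bar>" by (rule norm_of_real)
  also have "\<dots> \<le> h\<^sup>2" using exp_minus_bounds [OF h] zero_le_power2 [of h] by simp
  finally show ?thesis .
qed

context
  fixes s h :: real
  assumes s: "0 \<le> s" and h: "0 \<le> h" "h \<le> 1"
begin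

lemma tau_first_order:
  "\<tau> (first_order s h k) = of_nat k * (complex_of_real (exp (- h / 2) - 1) * \<tau> (letters s 0 k))"
proof -
  note A_s = letters_A [OF s] increment_A [OF s h]
  have "\<tau> (letters s 0 (Suc p) * increment s h p * letters s (Suc p) k) =
      complex_of_real (exp (- h / 2) - 1) * \<tau> (letters s 0 k)" if p: "p < k" for p
  proof -
    have "\<tau> (letters s 0 (Suc p) * increment s h p * letters s (Suc p) k) =
        \<tau> (letters s (Suc p) k * letters s 0 (Suc p) * increment s h p)"
      using tracial [of "letters s 0 (Suc p) * increment s h p" "letters s (Suc p) k"] A_s by (simp add: mult.assoc)
    also have "\<dots> = complex_of_real (exp (- h / 2) - 1) * \<tau> (letters s (Suc p) k * letters s 0 (Suc p))"
      by (intro tau_span_mult_increment [OF s h] letters_mult_span [OF s] letters_span [OF s])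
    also have "\<tau> (letters s (Suc p) k * letters s 0 (Suc p)) = \<tau> (letters s 0 k)"
      using tracial [of "letters s (Suc p) k" "letters s 0 (Suc p)"] A_s p letters_append [OF s, of 0 "Suc p" k] by simp
    finally show ?thesis .
  qed
  then show ?thesis using A_s by (simp add: first_order_def [OF s h] tau_sum)
qed

lemma tau_second_order:
  "\<tau> (second_order s h k) = (\<Sum>q<k. \<Sum>p<q. increment_covariance h (odd p) (odd q) * \<tau> (outer_word s k p q) * \<tau> (inner_word s p q) +
    complex_of_real ((exp (- h / 2) - 1)\<^sup>2) * \<tau> (outer_word s k p q * inner_word s p q))"
proof -
  note A_s = letters_A [OF s] increment_A [OF s h]
  have "\<tau> (letters s 0 (Suc p) * increment s h p * letters s (Suc p) (Suc q) * increment s h q * letters s (Suc q) k) =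
      increment_covariance h (odd p) (odd q) * \<tau> (outer_word s k p q) * \<tau> (inner_word s p q) +
      complex_of_real ((exp (- h / 2) - 1)\<^sup>2) * \<tau> (outer_word s k p q * inner_word s p q)" for p q
  proof -
    have "\<tau> (letters s 0 (Suc p) * increment s h p * letters s (Suc p) (Suc q) * increment s h q * letters s (Suc q) k) =
        \<tau> (outer_word s k p q * increment s h p * inner_word s p q * increment s h q)"
      using tracial [of "letters s 0 (Suc p) * increment s h p * letters s (Suc p) (Suc q) * increment s h q" "letters s (Suc q) k"] A_s
      by (simp add: mult.assoc outer_word_def inner_word_def)
    also have "\<dots> = increment_covariance h (odd p) (odd q) * \<tau> (outer_word s k p q) * \<tau> (inner_word s p q) +
      complex_of_real ((exp (- h / 2) - 1)\<^sup>2) * \<tau> (outer_word s k p q * inner_word s p q)"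
      unfolding outer_word_def inner_word_def
      by (rule tau_two_increments [OF s h]) (simp_all add: letters_mult_span [OF s] letters_span [OF s] mult.assoc)
    finally show ?thesis .
  qed
  then show ?thesis using A_s by (simp add: second_order_def [OF s h] tau_sum)
qed

text \<open>In units of \<open>h * sqrt h\<close>, the \<open>k\<close> means cost \<open>k\<close>,
  the at most \<open>k^2\<close> pairs cost 2 each, one for the covariance and one for the square of
  the mean, and the remainder costs \<open>2 * k^3\<close>.\<close>

lemma moved_word_approx:
  "cmod (\<tau> (moved_word s h k) - \<tau> (letters s 0 k) - h *\<^sub>R drift s k) \<le> (real k + 2 * real k ^ 2 + 2 * real k ^ 3) * h * sqrt h"
proof -
  note A_s = letters_A [OF s] letters_unitary [OF s]
  define \<mu> where "\<mu> = exp (- h / 2) - 1"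
  define e where "e = h * sqrt h"
  have he: "h\<^sup>2 \<le> e" using square_le_mult_sqrt [OF h] by (simp add: e_def)
  have e0: "0 \<le> e" using h by (simp add: e_def)
  define P where "P p q = (increment_covariance h (odd p) (odd q) - h * pair_sign p q) * (\<tau> (outer_word s k p q) * \<tau> (inner_word s p q)) +
    complex_of_real (\<mu>\<^sup>2) * \<tau> (outer_word s k p q * inner_word s p q)" for p q
  have \<mu>: "\<bar>\<mu> + h / 2\<bar> \<le> e" "\<mu>\<^sup>2 \<le> e"
  proof -
    have b: "- h / 2 \<le> \<mu>" "\<mu> \<le> - h / 2 + h\<^sup>2 / 8" 
      using exp_minus_bounds [of "h / 2"] h by (simp_all add: \<mu>_def power_divide)
    then show "\<bar>\<mu> + h / 2\<bar> \<le> e" using he zero_le_power2 [of h] by simp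
    have "\<bar>\<mu>\<bar> \<le> h" using b(1) h by (simp add: \<mu>_def abs_le_iff)
    then show "\<mu>\<^sup>2 \<le> e" using he h by (metis abs_le_square_iff abs_of_nonneg order_trans)
  qed
  have "\<tau> (moved_word s h k) = \<tau> (letters s 0 k) + \<tau> (first_order s h k) + \<tau> (second_order s h k) + \<tau> (remainder s h k)"
  proof -
    have "moved_word s h k = (letters s 0 k + first_order s h k) + (second_order s h k + remainder s h k)"
      by (simp add: remainder_def [OF s h])
    then show ?thesis
      using A_s first_second_order_A [OF s h] remainder_A [OF s h] by (simp add: tau_add)
  qed
  moreover have "\<tau> (second_order s h k) = (\<Sum>q<k. \<Sum>p<q. P p q) + h *\<^sub>R (\<Sum>q<k. \<Sum>p<q. pair_sign p q * (\<tau> (outer_word s k p q) * \<tau> (inner_word s p q)))"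
    unfolding tau_second_order P_def \<mu>_def [symmetric]
    by (simp add: scaleR_conv_of_real sum_distrib_left flip: sum.distrib) (simp add: algebra_simps)
  ultimately have "\<tau> (moved_word s h k) - \<tau> (letters s 0 k) - h *\<^sub>R drift s k =
      of_nat k * (complex_of_real (\<mu> + h / 2) * \<tau> (letters s 0 k)) + (\<Sum>q<k. \<Sum>p<q. P p q) + \<tau> (remainder s h k)"
    unfolding tau_first_order \<mu>_def [symmetric] drift_def
    by (simp add: algebra_simps scaleR_conv_of_real)
  also have "cmod \<dots> \<le> cmod (of_nat k * (complex_of_real (\<mu> + h / 2) * \<tau> (letters s 0 k))) +
      cmod (\<Sum>q<k. \<Sum>p<q. P p q) + cmod (\<tau> (remainder s h k))"
    by (intro order_trans [OF norm_triangle_ineq add_mono] order_trans [OF norm_triangle_ineq] order_refl add_mono)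
  also have "cmod (of_nat k * (complex_of_real (\<mu> + h / 2) * \<tau> (letters s 0 k))) \<le> real k * (e * 1)"
    unfolding norm_mult norm_of_nat norm_of_real using \<mu> A_s e0
    by (intro mult_left_mono mult_mono tau_unitary_le) auto
  also have "cmod (\<Sum>q<k. \<Sum>p<q. P p q) \<le> (\<Sum>q<k. \<Sum>p<q. 2 * e)"
  proof (intro order_trans [OF norm_sum sum_mono])
    fix p q
    have un: "outer_word s k p q \<in> A" "unitary (outer_word s k p q)" "inner_word s p q \<in> A" "unitary (inner_word s p q)"
      using A_s by (auto simp: outer_word_def inner_word_def intro: unitary_mult)
    have "cmod (P p q) \<le> cmod (increment_covariance h (odd p) (odd q) - h * pair_sign p q) * (cmod (\<tau> (outer_word s k p q)) * cmod (\<tau> (inner_word s p q))) +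
        \<mu>\<^sup>2 * cmod (\<tau> (outer_word s k p q * inner_word s p q))"
      unfolding P_def by (rule order_trans [OF norm_triangle_ineq]) (simp add: norm_mult norm_power)
    also have "\<dots> \<le> e * (1 * 1) + e * 1"
      using un increment_covariance_approx [OF h(1), of p q] he \<mu> e0
      by (intro add_mono mult_mono tau_unitary_le unitary_mult) (auto intro: order_trans)
    finally show "cmod (P p q) \<le> 2 * e" by simp
  qed
  also have "(\<Sum>q<k. \<Sum>p<q. 2 * e) \<le> (\<Sum>q<k. real k * (2 * e))"
    using e0 by (intro sum_mono) (auto intro!: mult_right_mono)
  also have "cmod (\<tau> (remainder s h k)) \<le> real (k ^ 3) * (2 * h * sqrt h)"
    using remainder_bound [OF s h, of 1 k] by (simp add: unitary_one)
  finally show ?thesis by (simp add: e_def algebra_simps power2_eq_square)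
qed

end

section \<open>Traces of words in the two conjugated symmetries\<close>

context
  fixes s :: real
  assumes s: "0 \<le> s"
begin

lemma letters_shift: "letters s (i + 2 * m) (j + 2 * m) = letters s i j"
proof (induction j)
  case 0
  then show ?case by (simp add: letters_def)
next
  case (Suc j)
  have "letter s (j + 2 * m) = letter s j" by (simp add: letter_def)
  then show ?case using Suc by (cases "i \<le> j") (simp_all add: letters_def)
qed

lemma letters_Suc_left: "i < j \<Longrightarrow> letters s i j = letter s i * letters s (Suc i) j"
  by (simp add: letters_def upt_conv_Cons)

lemma tau_conj_letter: "a \<in> A \<Longrightarrow> \<tau> (letter s j * a * letter s j) = \<tau> a"
  using tracial [of "letter s j * a" "letter s j"] letter_A [OF s] letter_square [OF s] by (simp add: mult.assoc)

lemma tau_letters_0: "\<tau> (letters s 0 (2 * k)) = moment k s"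
  using moment_moved_word [OF s order_refl, of k] U_unitary [OF s]
  by (simp add: moment_def moved_word_def letters_def W_def unitary_inverse star_if_simps(1))

text \<open>A word of even length that starts at an odd position is conjugate, by a letter that
  squares to one, to the word of that length starting at position 0.\<close>

lemma tau_letters_even: "\<tau> (letters s i (i + 2 * k)) = moment k s"
proof -
  have 0: "\<tau> (letters s (0 + 2 * m) (2 * k + 2 * m)) = moment k s" for m
    unfolding letters_shift by (rule tau_letters_0)
  have 1: "\<tau> (letters s (1 + 2 * m) (1 + 2 * k + 2 * m)) = moment k s" for m
  proof -
    have "letter s 0 * letters s 1 (1 + 2 * k) = letters s 0 (2 * k) * letter s 0"
      using letters_Suc_left [of 0 "Suc (2 * k)"] letters_simps(2) [OF s, of 0 "2 * k"] by (simp add: letter_def)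
    then have "letters s 1 (1 + 2 * k) = letter s 0 * letters s 0 (2 * k) * letter s 0"
      using letter_square(2) [OF s, of 0] by (metis mult.assoc)
    then show ?thesis
      unfolding letters_shift using tau_conj_letter [OF letters_A [OF s]] tau_letters_0 by simp
  qed
  show ?thesis
  proof (cases "even i")
    case True
    then obtain m where "i = 2 * m" by blast
    then show ?thesis using 0 [of m] by (simp add: add_ac)
  next
    case False
    then obtain m where "i = 2 * m + 1" using oddE by blast
    then show ?thesis using 1 [of m] by (simp add: add_ac)
  qed
qed

text \<open>First and last letter of a word of odd length agree and square to one, so the trace does
  not see them. Peeling continues down to the middle letter, at position
  \<open>i + k\<close>.\<close>

lemma tau_letters_odd: "\<tau> (letters s i (i + 2 * k + 1)) = parity_value (\<tau> R) (\<tau> S) (i + k)"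
proof (induction k arbitrary: i)
  case 0
  have "\<tau> (adj (U s) * R * U s) = \<tau> R"
    using tracial [of "adj (U s)" "R * U s"] U_A [OF s] U_unitary [OF s] R_A by (simp add: mult.assoc unitary_inverse)
  then show ?case by (simp add: letters_def letter_def parity_value_def)
next
  case (Suc k)
  have "letters s i (i + 2 * Suc k + 1) = letter s i * letters s (Suc i) (Suc i + 2 * k + 1) * letter s (i + 2 * k + 2)"
    using letters_Suc_left [of i "i + 2 * k + 3"] letters_simps(2) [OF s, of "Suc i" "i + 2 * k + 2"]
    by (simp add: eval_nat_numeral mult.assoc)
  also have "letter s (i + 2 * k + 2) = letter s i" by (simp add: letter_def)
  finally have "\<tau> (letters s i (i + 2 * Suc k + 1)) = \<tau> (letters s (Suc i) (Suc i + 2 * k + 1))"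
    using tau_conj_letter [OF letters_A [OF s]] by simp
  then show ?case using Suc.IH [of "Suc i"] by (simp add: add_ac)
qed

text \<open>By periodicity the arc through the end is again a word in consecutive letters, continued
  past position \<open>2 * n\<close>.\<close>

lemma outer_eq: "q < 2 * n \<Longrightarrow> outer_word s (2 * n) p q = letters s (Suc q) (Suc p + 2 * n)"
  using letters_shift [of 0 n "Suc p"] letters_append [OF s, of "Suc q" "2 * n" "Suc p + 2 * n"]
  by (simp add: outer_word_def)

lemma tau_inner_word:
  "q = p + 2 * d \<Longrightarrow> \<tau> (inner_word s p q) = moment d s"
  "q = p + 2 * d + 1 \<Longrightarrow> \<tau> (inner_word s p q) = parity_value (\<tau> R) (\<tau> S) (Suc p + d)"
  using tau_letters_even [of "Suc p" d] tau_letters_odd [of "Suc p" d] by (simp_all add: inner_word_def)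

lemma tau_outer_word:
  assumes q: "q < 2 * n"
  shows "p + 2 * n = q + 2 * d \<Longrightarrow> \<tau> (outer_word s (2 * n) p q) = moment d s"
    "p + 2 * n = q + 2 * d + 1 \<Longrightarrow> \<tau> (outer_word s (2 * n) p q) = parity_value (\<tau> R) (\<tau> S) (Suc q + d)"
  using tau_letters_even [of "Suc q" d] tau_letters_odd [of "Suc q" d] by (simp_all add: outer_eq [OF q])

text \<open>At even distance both arcs are even, with half lengths adding up to \<open>n\<close>,
  and the pair yields a product of moments with sign -1. At odd distance both arcs are odd, with
  middle letters at \<open>i + j + 1\<close> and \<open>i + j + 1 + n\<close>, and the pair yields a
  constant.\<close>

lemma drift_eq:
  "drift s (2 * n) = of_nat n * source_coeff (\<tau> R) (\<tau> S) n - of_nat n * moment n s -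
    of_nat n * (\<Sum>k\<in>{1..<n}. moment k s * moment (n - k) s)"
proof -
  define w where "w p q = pair_sign p q * (\<tau> (outer_word s (2 * n) p q) * \<tau> (inner_word s p q))" for p q
  define u where "u k = moment k s * moment (n - k) s" for k
  define v where "v k = parity_value (\<tau> R) (\<tau> S) (k + 1) * parity_value (\<tau> R) (\<tau> S) (k + 1 + n)" for k
  have even_pair: "w (2 * i) (2 * j) = - u (j - i)" "w (2 * i + 1) (2 * j + 1) = - u (j - i)"
    if "i < j" "j < n" for i j
  proof -
    have e: "2 * j = 2 * i + 2 * (j - i)" "2 * i + 2 * n = 2 * j + 2 * (n - (j - i))" and l: "2 * j < 2 * n"
      using that by auto
    show "w (2 * i) (2 * j) = - u (j - i)"
      unfolding w_def tau_inner_word(1) [OF e(1)] tau_outer_word(1) [OF l e(2)]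
      by (simp add: pair_sign_def u_def)
    have e: "2 * j + 1 = 2 * i + 1 + 2 * (j - i)" "2 * i + 1 + 2 * n = 2 * j + 1 + 2 * (n - (j - i))"
      and l: "2 * j + 1 < 2 * n"
      using that by auto
    show "w (2 * i + 1) (2 * j + 1) = - u (j - i)"
      unfolding w_def tau_inner_word(1) [OF e(1)] tau_outer_word(1) [OF l e(2)]
      by (simp add: pair_sign_def u_def)
  qed
  have odd_pair1: "w (2 * i + 1) (2 * j) = v (i + j)" if "i < j" "j < n" for i j
  proof -
    have e: "2 * j = 2 * i + 1 + 2 * (j - i - 1) + 1" "2 * i + 1 + 2 * n = 2 * j + 2 * (n + i - j) + 1"
      and l: "2 * j < 2 * n"
      using that by auto
    have "Suc (2 * i + 1) + (j - i - 1) = i + j + 1" "Suc (2 * j) + (n + i - j) = i + j + 1 + n"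
      using that by auto
    then show ?thesis
      unfolding w_def v_def tau_inner_word(2) [OF e(1)] tau_outer_word(2) [OF l e(2)]
      by (simp only: pair_sign_def) simp
  qed
  have odd_pair2: "w (2 * i) (2 * j + 1) = v (i + j)" if "i < Suc j" "j < n" for i j
  proof -
    have e: "2 * j + 1 = 2 * i + 2 * (j - i) + 1" "2 * i + 2 * n = 2 * j + 1 + 2 * (n + i - j - 1) + 1"
      and l: "2 * j + 1 < 2 * n"
      using that by auto
    have "Suc (2 * i) + (j - i) = i + j + 1" "Suc (2 * j + 1) + (n + i - j - 1) = i + j + 1 + n"
      using that by auto
    then show ?thesis
      unfolding w_def v_def tau_inner_word(2) [OF e(1)] tau_outer_word(2) [OF l e(2)]
      by (simp only: pair_sign_def) simp
  qed
  have "(\<Sum>q<2 * n. \<Sum>p<q. w p q) = (\<Sum>j<n. \<Sum>i<j. - u (j - i) + - u (j - i)) + (\<Sum>j<n. (\<Sum>i<j. v (i + j)) + (\<Sum>i<Suc j. v (i + j)))"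
    unfolding sum_pairs_double
    by (intro arg_cong2 [where f = "(+)"] sum.cong refl) (simp_all only: lessThan_iff even_pair odd_pair1 odd_pair2)
  also have "(\<Sum>j<n. (\<Sum>i<j. v (i + j)) + (\<Sum>i<Suc j. v (i + j))) = (\<Sum>j<n. \<Sum>i<n. v (i + j))"
    by (rule sum_triangle_symmetric)
  also have "\<dots> = of_nat n * source_coeff (\<tau> R) (\<tau> S) n"
    unfolding v_def by (rule sum_parity_values)
  also have "(\<Sum>j<n. \<Sum>i<j. - u (j - i) + - u (j - i)) = - (2 * (\<Sum>j<n. \<Sum>i<j. u (j - i)))"
    by (simp add: sum_negf sum_distrib_left)
  also have "2 * (\<Sum>j<n. \<Sum>i<j. u (j - i)) = of_nat n * (\<Sum>k\<in>{1..<n}. u k)"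
    by (rule sum_triangle_reflect) (simp add: u_def)
  finally show ?thesis
    using tau_letters_0 [of n] by (simp add: drift_def w_def [symmetric] u_def)
qed

end

lemma moment_step:
  assumes "0 \<le> s" "0 \<le> h" "h \<le> 1"
  shows "cmod (moment n (s + h) - moment n s - h *\<^sub>R drift s (2 * n)) \<le>
    (real (2 * n) + 2 * real (2 * n) ^ 2 + 2 * real (2 * n) ^ 3) * h * sqrt h"
  using moved_word_approx [OF assms, of "2 * n"] moment_moved_word [OF assms(1,2), of n] tau_letters_0 [OF assms(1), of n]
  by (simp add: moment_def)

lemma moment_bound: "0 \<le> s \<Longrightarrow> cmod (moment n s) \<le> 1"
  unfolding tau_letters_0 [symmetric] by (intro tau_unitary_le letters_A letters_unitary)

lemma drift_bound:
  assumes "0 \<le> s"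
  shows "cmod (drift s (2 * n)) \<le> real n * (cmod (source_coeff (\<tau> R) (\<tau> S) n) + 1 + real n)"
proof -
  have "cmod (\<Sum>k\<in>{1..<n}. moment k s * moment (n - k) s) \<le> (\<Sum>k\<in>{1..<n}. 1 * 1)"
    unfolding norm_mult [symmetric]
    by (intro order_trans [OF norm_sum sum_mono]) (auto simp: norm_mult intro!: mult_le_one moment_bound assms)
  also have "\<dots> \<le> real n" by simp
  finally have "cmod (of_nat n * (source_coeff (\<tau> R) (\<tau> S) n - moment n s - (\<Sum>k\<in>{1..<n}. moment k s * moment (n - k) s)))
      \<le> real n * (cmod (source_coeff (\<tau> R) (\<tau> S) n) + 1 + real n)"
    unfolding norm_mult norm_of_nat using moment_bound [OF assms, of n]
    by (intro mult_left_mono order_trans [OF norm_triangle_ineq4 add_mono]) auto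
  then show ?thesis unfolding drift_eq [OF assms] by (simp add: algebra_simps)
qed

text \<open>The drift is bounded, so the moments are continuous; by its closed formula the drift is
  then continuous too, which upgrades the increments to derivatives.\<close>

lemma moment_has_vector_derivative:
  assumes "0 \<le> t"
  shows "(moment n has_vector_derivative drift t (2 * n)) (at t within {0..})"
proof (rule has_vector_derivative_of_increments [OF moment_step _ assms])
  have "continuous_on {0..} (moment k)" for k
    by (rule continuous_on_of_increments [OF moment_step drift_bound])
  then have "continuous_on {0..} (\<lambda>s. of_nat n * source_coeff (\<tau> R) (\<tau> S) n - of_nat n * moment n s -
      of_nat n * (\<Sum>k\<in>{1..<n}. moment k s * moment (n - k) s))"
    by (intro continuous_intros)
  then show "continuous_on {0..} (\<lambda>s. drift s (2 * n))"
    by (rule continuous_on_eq) (simp add: drift_eq)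
qed

end

subsection \<open>Generating functions\<close>

text \<open>Majorant for differentiating in time term by term: the derivative of the
  \<open>n\<close>-th moment grows at most quadratically in \<open>n\<close>. The coefficients are
  those of the second derivative of the geometric series.\<close>

lemma summable_quadratic_powser:
  fixes r :: real assumes r: "0 \<le> r" "r < 1"
  shows "summable (\<lambda>n. real ((n + 1) * (n + 2)) * r ^ n)"
proof -
  have "summable (\<lambda>n. diffs (diffs (\<lambda>_. 1)) n * r ^ n)"
  proof (rule termdiff_converges [where K = 1])
    show "summable (\<lambda>n. diffs (\<lambda>_. 1) n * x ^ n)" if "norm x < 1" for x :: real
      by (rule termdiff_converges [where K = 1]) (use that in \<open>auto simp: summable_geometric\<close>)
  qed (use r in simp)
  then show ?thesis by (simp add: diffs_def algebra_simps)
qed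

lemma powser_derivative_sums:
  fixes c :: "nat \<Rightarrow> complex"
  assumes sums: "\<And>z. cmod z < 1 \<Longrightarrow> (\<lambda>n. c n * z ^ n) sums f z" and z: "cmod z < 1"
  obtains f' where "(f has_field_derivative f') (at z)" "(\<lambda>n. of_nat n * c n * z ^ n) sums (z * f')"
proof -
  have "((\<lambda>z. \<Sum>n. c n * z ^ n) has_field_derivative (\<Sum>n. diffs c n * z ^ n)) (at z)"
    by (rule termdiffs_strong' [of 1]) (use sums z in \<open>auto simp: sums_iff\<close>)
  then have der: "(f has_field_derivative (\<Sum>n. diffs c n * z ^ n)) (at z)"
    by (rule has_field_derivative_transform_within_open [of _ _ _ "ball 0 1"])
      (use sums z in \<open>auto simp: sums_iff\<close>)
  have "(\<lambda>n. diffs c n * z ^ n) sums (\<Sum>n. diffs c n * z ^ n)"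
    using termdiffs_sums_strong [OF sums der z] .
  then have "(\<lambda>n. z * (diffs c n * z ^ n)) sums (z * (\<Sum>n. diffs c n * z ^ n))" by (rule sums_mult)
  then have "(\<lambda>n. of_nat (Suc n) * c (Suc n) * z ^ Suc n) sums (z * (\<Sum>n. diffs c n * z ^ n))"
    by (simp add: diffs_def mult_ac)
  then have "(\<lambda>n. of_nat n * c n * z ^ n) sums (z * (\<Sum>n. diffs c n * z ^ n))"
    by (subst (asm) sums_Suc_iff) simp
  with der show thesis by (rule that)
qed

text \<open>The generating function of \<open>source_coeff\<close>, which equals
  \<open>n / 4\<close> times \<open>(a + b)^2 + (-1)^n * (a - b)^2\<close>; the two summands come
  from the series of \<open>n * w^n\<close> at \<open>w\<close> and at \<open>- w\<close>.\<close>

definition source_fun :: "complex \<Rightarrow> complex \<Rightarrow> complex \<Rightarrow> complex"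
  where "source_fun a b w = ((a + b)\<^sup>2 * (w / (1 - w)\<^sup>2) - (a - b)\<^sup>2 * (w / (1 + w)\<^sup>2)) / 4"

lemma of_nat_powser_sums:
  fixes w :: complex assumes "cmod w < 1"
  shows "(\<lambda>n. of_nat n * w ^ n) sums (w / (1 - w)\<^sup>2)"
proof -
  have "(\<lambda>n. w * (of_nat (Suc n) * w ^ n)) sums (w * (1 / (1 - w)\<^sup>2))"
    by (intro sums_mult geometric_deriv_sums assms)
  then have "(\<lambda>n. of_nat (Suc n) * w ^ Suc n) sums (w / (1 - w)\<^sup>2)" by (simp add: mult_ac)
  then show ?thesis by (subst (asm) sums_Suc_iff) simp
qed

lemma source_sums:
  assumes w: "cmod w < 1"
  shows "(\<lambda>n. source_coeff a b n * w ^ n) sums source_fun a b w"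
proof -
  have "(\<lambda>n. ((a + b)\<^sup>2 * (of_nat n * w ^ n) + (a - b)\<^sup>2 * (of_nat n * (- w) ^ n)) / 4) sums
      (((a + b)\<^sup>2 * (w / (1 - w)\<^sup>2) + (a - b)\<^sup>2 * ((- w) / (1 - (- w))\<^sup>2)) / 4)"
    by (intro sums_divide sums_add sums_mult of_nat_powser_sums) (use w in auto)
  moreover have "((a + b)\<^sup>2 * (of_nat n * w ^ n) + (a - b)\<^sup>2 * (of_nat n * (- w) ^ n)) / 4 = source_coeff a b n * w ^ n" for n
  proof (cases "odd n")
    case True
    then have "((a + b)\<^sup>2 * (of_nat n * w ^ n) + (a - b)\<^sup>2 * (of_nat n * (- w) ^ n)) / 4 =
        ((a + b)\<^sup>2 - (a - b)\<^sup>2) / 4 * (of_nat n * w ^ n)" by (simp add: algebra_simps)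
    also have "((a + b)\<^sup>2 - (a - b)\<^sup>2) / 4 = a * b" by (simp add: power2_eq_square algebra_simps)
    finally show ?thesis using True by (simp add: source_coeff_def)
  next
    case False
    then have "((a + b)\<^sup>2 * (of_nat n * w ^ n) + (a - b)\<^sup>2 * (of_nat n * (- w) ^ n)) / 4 =
        ((a + b)\<^sup>2 + (a - b)\<^sup>2) / 4 * (of_nat n * w ^ n)" by (simp add: algebra_simps)
    also have "((a + b)\<^sup>2 + (a - b)\<^sup>2) / 4 = (a\<^sup>2 + b\<^sup>2) / 2" by (simp add: power2_eq_square algebra_simps)
    finally show ?thesis using False by (simp add: source_coeff_def)
  qed
  ultimately show ?thesis by (simp add: source_fun_def)
qed

lemma source_fun_derivative:
  assumes z: "cmod z < 1"
  obtains D where "(source_fun a b has_field_derivative D) (at z)"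
    "2 * z * D = 2 * z * (a * z\<^sup>2 + 2 * b * z + a) * (b * z\<^sup>2 + 2 * a * z + b) / (1 - z\<^sup>2) ^ 3"
proof -
  have nz: "1 - z \<noteq> 0" "1 + z \<noteq> 0"
    using z by (auto simp: add_eq_0_iff)
  define D where "D = ((a + b)\<^sup>2 * ((1 + z) / (1 - z) ^ 3) - (a - b)\<^sup>2 * ((1 - z) / (1 + z) ^ 3)) / 4"
  have d1: "((\<lambda>w. w / (1 - w)\<^sup>2) has_field_derivative (1 + z) / (1 - z) ^ 3) (at z)"
  proof -
    have "((\<lambda>w. w / (1 - w)\<^sup>2) has_field_derivative ((1 - z)\<^sup>2 - z * (- (2 * (1 - z)))) / ((1 - z)\<^sup>2 * (1 - z)\<^sup>2)) (at z)"
      using nz by (auto intro!: derivative_eq_intros)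
    moreover have "((1 - z)\<^sup>2 - z * (- (2 * (1 - z)))) / ((1 - z)\<^sup>2 * (1 - z)\<^sup>2) = (1 + z) / (1 - z) ^ 3"
    proof -
      have "(1 - z)\<^sup>2 - z * (- (2 * (1 - z))) = (1 - z) * (1 + z)" by (simp add: power2_eq_square algebra_simps)
      moreover have "(1 - z)\<^sup>2 * (1 - z)\<^sup>2 = (1 - z) * (1 - z) ^ 3" by (simp add: eval_nat_numeral mult_ac)
      ultimately show ?thesis using nz(1) by simp
    qed
    ultimately show ?thesis by simp
  qed
  have d2: "((\<lambda>w. w / (1 + w)\<^sup>2) has_field_derivative (1 - z) / (1 + z) ^ 3) (at z)"
  proof -
    have "((\<lambda>w. w / (1 + w)\<^sup>2) has_field_derivative ((1 + z)\<^sup>2 - z * (2 * (1 + z))) / ((1 + z)\<^sup>2 * (1 + z)\<^sup>2)) (at z)"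
      using nz by (auto intro!: derivative_eq_intros)
    moreover have "((1 + z)\<^sup>2 - z * (2 * (1 + z))) / ((1 + z)\<^sup>2 * (1 + z)\<^sup>2) = (1 - z) / (1 + z) ^ 3"
    proof -
      have "(1 + z)\<^sup>2 - z * (2 * (1 + z)) = (1 + z) * (1 - z)" by (simp add: power2_eq_square algebra_simps)
      moreover have "(1 + z)\<^sup>2 * (1 + z)\<^sup>2 = (1 + z) * (1 + z) ^ 3" by (simp add: eval_nat_numeral mult_ac)
      ultimately show ?thesis using nz(2) by simp
    qed
    ultimately show ?thesis by simp
  qed
  show thesis
  proof (rule that)
    show "(source_fun a b has_field_derivative D) (at z)"
      unfolding source_fun_def [abs_def] D_def by (intro DERIV_cdivide DERIV_diff DERIV_cmult d1 d2)
    have f1: "(1 + z) / (1 - z) ^ 3 = (1 + z) ^ 4 / (1 - z\<^sup>2) ^ 3" "(1 - z) / (1 + z) ^ 3 = (1 - z) ^ 4 / (1 - z\<^sup>2) ^ 3"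
    proof -
      have e: "(1 - z\<^sup>2) ^ 3 = (1 - z) ^ 3 * (1 + z) ^ 3"
        unfolding power_mult_distrib [symmetric] by (simp add: power2_eq_square algebra_simps)
      have p4: "u ^ 4 = u ^ 3 * u" for u :: complex by (simp add: eval_nat_numeral mult_ac)
      have "(1 + z) ^ 4 / ((1 - z) ^ 3 * (1 + z) ^ 3) = ((1 + z) ^ 3 * (1 + z)) / ((1 + z) ^ 3 * (1 - z) ^ 3)"
        "(1 - z) ^ 4 / ((1 - z) ^ 3 * (1 + z) ^ 3) = ((1 - z) ^ 3 * (1 - z)) / ((1 - z) ^ 3 * (1 + z) ^ 3)"
        by (simp_all only: p4 mult.commute)
      then show "(1 + z) / (1 - z) ^ 3 = (1 + z) ^ 4 / (1 - z\<^sup>2) ^ 3" "(1 - z) / (1 + z) ^ 3 = (1 - z) ^ 4 / (1 - z\<^sup>2) ^ 3"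
        unfolding e using nz by simp_all
    qed
    have "2 * z * D = z / 2 * ((a + b)\<^sup>2 * (1 + z) ^ 4 - (a - b)\<^sup>2 * (1 - z) ^ 4) / (1 - z\<^sup>2) ^ 3"
      unfolding D_def f1 times_divide_eq_right diff_divide_distrib [symmetric] by simp
    \<comment> \<open>A difference of squares: its factors are \<open>(a + b) * (1 + z)^2\<close>
      plus and minus \<open>(a - b) * (1 - z)^2\<close>.\<close>
    also have "(a + b)\<^sup>2 * (1 + z) ^ 4 - (a - b)\<^sup>2 * (1 - z) ^ 4 =
        4 * ((a * z\<^sup>2 + 2 * b * z + a) * (b * z\<^sup>2 + 2 * a * z + b))"
      by (simp add: eval_nat_numeral algebra_simps)
    finally show "2 * z * D = 2 * z * (a * z\<^sup>2 + 2 * b * z + a) * (b * z\<^sup>2 + 2 * a * z + b) / (1 - z\<^sup>2) ^ 3"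
      by simp
  qed
qed

text \<open>Write \<open>H = 1 + 2 f\<close> and let \<open>\<Phi>\<close> be the source function
  minus \<open>f\<close> minus \<open>f^2\<close>. The system says that the time derivative of
  \<open>H\<close> is \<open>2 z\<close> times the derivative of \<open>\<Phi>\<close>, while
  \<open>H^2\<close> is \<open>1 - 4 \<Phi>\<close> plus four times the source function. In the sum
  the derivative of \<open>\<Phi>\<close> cancels and only that of the source remains.\<close>

lemma moments_burgers:
  fixes a d :: "nat \<Rightarrow> real \<Rightarrow> complex" and H :: "real \<Rightarrow> complex \<Rightarrow> complex"
  assumes bound: "\<And>n t. 0 \<le> t \<Longrightarrow> cmod (a n t) \<le> 1"
    and der: "\<And>n t. 0 \<le> t \<Longrightarrow> (a n has_vector_derivative d n t) (at t within {0..})"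
    and d_eq: "\<And>n t. 0 \<le> t \<Longrightarrow> d n t = of_nat n * source_coeff \<alpha> \<beta> n - of_nat n * a n t -
      of_nat n * (\<Sum>k\<in>{1..<n}. a k t * a (n - k) t)"
    and d_bound: "\<And>n t. 0 \<le> t \<Longrightarrow> cmod (d n t) \<le> real n * (cmod (source_coeff \<alpha> \<beta> n) + 1 + real n)"
    and H: "\<And>t z. 0 \<le> t \<Longrightarrow> cmod z < 1 \<Longrightarrow> (\<lambda>n. 2 * a (Suc n) t * z ^ Suc n) sums (H t z - 1)"
    and t: "0 \<le> t" and z: "cmod z < 1"
  shows "\<exists>Ht Hz. ((\<lambda>s. H s z) has_vector_derivative Ht) (at t within {0..}) \<and>
      ((\<lambda>w. (H t w)\<^sup>2) has_field_derivative Hz) (at z) \<and>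
      Ht + z / 2 * Hz = 2 * z * (\<alpha> * z\<^sup>2 + 2 * \<beta> * z + \<alpha>) * (\<beta> * z\<^sup>2 + 2 * \<alpha> * z + \<beta>) / (1 - z\<^sup>2) ^ 3"
proof -
  \<comment> \<open>Dropping the zeroth moment makes the full Cauchy product of \<open>b\<close>
    with itself have exactly the terms with \<open>0 < k < n\<close>.\<close>
  define b where "b n = (if n = 0 then 0 else a n t)" for n
  define f where "f w = (H t w - 1) / 2" for w
  define D where "D n = source_coeff \<alpha> \<beta> n - b n - (\<Sum>k\<le>n. b k * b (n - k))" for n
  define \<Phi> where "\<Phi> w = source_fun \<alpha> \<beta> w - f w - f w * f w" for w
  have b_sums: "(\<lambda>n. b n * w ^ n) sums f w" if w: "cmod w < 1" for w
  proof -
    have "(\<lambda>n. 2 * a (Suc n) t * w ^ Suc n / 2) sums f w"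
      unfolding f_def by (intro sums_divide H t w)
    then have "(\<lambda>n. b (Suc n) * w ^ Suc n) sums f w" by (simp add: b_def)
    then show ?thesis by (subst (asm) sums_Suc_iff) (simp add: b_def)
  qed
  have conv_sums: "(\<lambda>n. (\<Sum>k\<le>n. b k * b (n - k)) * w ^ n) sums (f w * f w)" if w: "cmod w < 1" for w
  proof -
    have sm: "summable (\<lambda>n. norm (b n * w ^ n))"
    proof (rule summable_comparison_test')
      show "summable (\<lambda>n. cmod w ^ n)" using w by (simp add: summable_geometric)
      show "norm (norm (b n * w ^ n)) \<le> cmod w ^ n" if "0 \<le> n" for n
        using bound [OF t, of n] by (auto simp: b_def norm_mult norm_power intro: mult_left_le_one_le)
    qed
    have "(\<lambda>n. \<Sum>k\<le>n. (b k * w ^ k) * (b (n - k) * w ^ (n - k))) sums ((\<Sum>n. b n * w ^ n) * (\<Sum>n. b n * w ^ n))"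
      by (rule Cauchy_product_sums [OF sm sm])
    moreover have "(\<Sum>k\<le>n. (b k * w ^ k) * (b (n - k) * w ^ (n - k))) = (\<Sum>k\<le>n. b k * b (n - k)) * w ^ n" for n
    proof -
      have "(b k * w ^ k) * (b (n - k) * w ^ (n - k)) = b k * b (n - k) * w ^ n" if "k \<le> n" for k
      proof -
        have "w ^ n = w ^ k * w ^ (n - k)" using that by (simp flip: power_add)
        then show ?thesis by (simp add: mult_ac)
      qed
      then show ?thesis unfolding sum_distrib_right by (intro sum.cong refl) (simp only: atMost_iff)
    qed
    ultimately show ?thesis using sums_unique [OF b_sums [OF w]] by simp
  qed
  have \<Phi>_sums: "(\<lambda>n. D n * w ^ n) sums \<Phi> w" if w: "cmod w < 1" for w
    using sums_diff [OF sums_diff [OF source_sums [OF w] b_sums [OF w]] conv_sums [OF w]]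
    by (simp add: D_def \<Phi>_def left_diff_distrib)
  obtain \<Phi>' where \<Phi>': "(\<Phi> has_field_derivative \<Phi>') (at z)" "(\<lambda>n. of_nat n * D n * z ^ n) sums (z * \<Phi>')"
    using powser_derivative_sums [OF \<Phi>_sums z] by blast
  obtain \<psi>' where \<psi>': "(source_fun \<alpha> \<beta> has_field_derivative \<psi>') (at z)"
    "2 * z * \<psi>' = 2 * z * (\<alpha> * z\<^sup>2 + 2 * \<beta> * z + \<alpha>) * (\<beta> * z\<^sup>2 + 2 * \<alpha> * z + \<beta>) / (1 - z\<^sup>2) ^ 3"
    using source_fun_derivative [OF z] by blast
  have dD: "d n t = of_nat n * D n" for n
  proof (cases "n = 0")
    case False
    have "(\<Sum>k\<le>n. b k * b (n - k)) = (\<Sum>k\<in>{1..<n}. a k t * a (n - k) t)"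
      by (rule sum.mono_neutral_cong_right) (auto simp: b_def)
    then show ?thesis using False by (simp add: d_eq [OF t] D_def b_def right_diff_distrib)
  qed (simp add: d_eq [OF t])
  have H2: "((\<lambda>w. (H t w)\<^sup>2) has_field_derivative (- 4 * \<Phi>' + 4 * \<psi>')) (at z)"
  proof -
    have "(H t w)\<^sup>2 = 1 + - 4 * \<Phi> w + 4 * source_fun \<alpha> \<beta> w" for w
      by (simp add: \<Phi>_def f_def power2_eq_square field_simps)
    then show ?thesis
      by (auto intro!: derivative_eq_intros \<Phi>' \<psi>' simp: fun_eq_iff)
  qed
  define T where "T n s = 2 * a (Suc n) s * z ^ Suc n" for n s
  define T' where "T' n s = 2 * d (Suc n) s * z ^ Suc n" for n s
  obtain C where C: "0 \<le> C" "\<And>n. cmod (source_coeff \<alpha> \<beta> n) \<le> C * real n"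
  proof
    show "cmod (source_coeff \<alpha> \<beta> n) \<le> (cmod (\<alpha> * \<beta>) + cmod (\<alpha>\<^sup>2 + \<beta>\<^sup>2)) * real n" for n
    proof (cases "odd n")
      case False
      then have "cmod (source_coeff \<alpha> \<beta> n) = cmod (\<alpha>\<^sup>2 + \<beta>\<^sup>2) / 2 * real n"
        by (simp add: source_coeff_def norm_mult norm_divide)
      also have "\<dots> \<le> (cmod (\<alpha> * \<beta>) + cmod (\<alpha>\<^sup>2 + \<beta>\<^sup>2)) * real n" by (intro mult_right_mono) auto
      finally show ?thesis .
    qed (simp add: source_coeff_def norm_mult algebra_simps)
  qed simp
  \<comment> \<open>Independent of the time, so the Weierstrass test gives uniform convergence of
    the differentiated series on the whole half-line.\<close>
  define M where "M n = (2 * (C + 2) * cmod z) * (real ((n + 1) * (n + 2)) * cmod z ^ n)" for n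
  have M: "summable M"
    unfolding M_def by (intro summable_mult summable_quadratic_powser) (use z in auto)
  have TM: "norm (T' n s) \<le> M n" if "s \<in> {0..}" for n s
  proof -
    have "cmod (d (Suc n) s) \<le> real (Suc n) * (C * real (Suc n) + 1 + real (Suc n))"
      using d_bound [of s "Suc n"] C(2) [of "Suc n"] that
      by (smt (verit) atLeast_iff mult_left_mono of_nat_0_le_iff)
    also have "\<dots> \<le> real (Suc n) * ((C + 2) * real (n + 2))"
      using C(1) by (intro mult_left_mono) (auto simp: algebra_simps)
    finally have "norm (T' n s) \<le> 2 * (real (Suc n) * ((C + 2) * real (n + 2))) * cmod z ^ Suc n"
      unfolding T'_def norm_mult norm_power by (intro mult_right_mono mult_left_mono) auto
    then show ?thesis by (simp add: M_def algebra_simps)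
  qed
  have unif: "uniform_limit {0..} (\<lambda>n s. \<Sum>i<n. T' i s) (\<lambda>s. \<Sum>i. T' i s) sequentially"
    by (rule Weierstrass_m_test [OF TM M])
  have "\<exists>g. \<forall>s\<in>{0..}. (\<lambda>n. T n s) sums g s \<and> (g has_derivative (\<lambda>h. h *\<^sub>R (\<Sum>i. T' i s))) (at s within {0..})"
  proof (rule has_derivative_series [where f' = "\<lambda>n s h. h *\<^sub>R T' n s"])
    show "convex {0::real..}" by simp
    show "(T n has_derivative (\<lambda>h. h *\<^sub>R T' n s)) (at s within {0..})" if "s \<in> {0..}" for n s
    proof -
      have "((\<lambda>s. 2 * a (Suc n) s * z ^ Suc n) has_vector_derivative 2 * d (Suc n) s * z ^ Suc n) (at s within {0..})"
        using that by (intro has_vector_derivative_mult_left has_vector_derivative_mult_right der) auto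
      then show ?thesis by (simp only: T_def [abs_def] T'_def has_vector_derivative_def)
    qed
    show "\<forall>\<^sub>F n in sequentially. \<forall>s\<in>{0..}. \<forall>h. norm ((\<Sum>i<n. h *\<^sub>R T' i s) - h *\<^sub>R (\<Sum>i. T' i s)) \<le> e * norm h"
      if "0 < e" for e
      using uniform_limitD [OF unif that]
    proof eventually_elim
      case (elim n)
      show ?case
      proof (intro ballI allI)
        fix s h :: real assume "s \<in> {0..}"
        with elim have "norm ((\<Sum>i<n. T' i s) - (\<Sum>i. T' i s)) \<le> e" by (auto simp: dist_norm intro: less_imp_le)
        then have "\<bar>h\<bar> * norm ((\<Sum>i<n. T' i s) - (\<Sum>i. T' i s)) \<le> \<bar>h\<bar> * e" by (intro mult_left_mono) auto
        then show "norm ((\<Sum>i<n. h *\<^sub>R T' i s) - h *\<^sub>R (\<Sum>i. T' i s)) \<le> e * norm h"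
          by (simp add: mult.commute flip: scaleR_sum_right scaleR_diff_right)
      qed
    qed
    show "(\<lambda>n. T n t) sums (H t z - 1)" unfolding T_def by (rule H [OF t z])
  qed (use t in auto)
  then obtain g where g: "\<And>s. 0 \<le> s \<Longrightarrow> (\<lambda>n. T n s) sums g s"
    "\<And>s. 0 \<le> s \<Longrightarrow> (g has_vector_derivative (\<Sum>i. T' i s)) (at s within {0..})"
    by (auto simp: has_vector_derivative_def)
  have gH: "g s = H s z - 1" if "0 \<le> s" for s
    using sums_unique2 [OF g(1) [OF that] H [OF that z, folded T_def]] .
  have Ht: "((\<lambda>s. H s z) has_vector_derivative (\<Sum>i. T' i t)) (at t within {0..})"
  proof (rule has_vector_derivative_transform [of _ _ _ "\<lambda>s. g s + 1"])
    show "((\<lambda>s. g s + 1) has_vector_derivative (\<Sum>i. T' i t)) (at t within {0..})"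
      using has_vector_derivative_add [OF g(2) [OF t] has_vector_derivative_const] by simp
  qed (use t gH in auto)
  have "(\<lambda>n. 2 * (of_nat n * D n * z ^ n)) sums (2 * (z * \<Phi>'))" by (intro sums_mult \<Phi>')
  then have "(\<lambda>n. 2 * (of_nat (Suc n) * D (Suc n) * z ^ Suc n)) sums (2 * (z * \<Phi>'))"
    by (subst sums_Suc_iff) simp
  then have "(\<lambda>n. T' n t) sums (2 * (z * \<Phi>'))" by (simp add: T'_def dD mult.assoc)
  then have "(\<Sum>i. T' i t) = 2 * (z * \<Phi>')" by (simp add: sums_iff)
  then have "(\<Sum>i. T' i t) + z / 2 * (- 4 * \<Phi>' + 4 * \<psi>') = 2 * z * \<psi>'" by (simp add: algebra_simps)
  with Ht H2 \<psi>'(2) show ?thesis by metis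
qed

subsection \<open>The Herglotz transform of a spectral distribution\<close>

text \<open>On the unit circle the inverse of a point is its conjugate, so the kernel is 1 plus
  twice the geometric series in \<open>z * cnj \<zeta>\<close> without its constant term.
  Integration therefore produces the moments of \<open>adj a\<close>.\<close>

lemma herglotz_transform_sums:
  assumes \<nu>: "spectral_distribution \<tau> a \<nu>" and circle: "emeasure \<nu> (- sphere 0 1) = 0" and z: "cmod z < 1"
  shows "(\<lambda>n. 2 * \<tau> (adj a ^ Suc n) * z ^ Suc n) sums (herglotz_transform \<nu> z - 1)"
proof -
  have sets: "sets \<nu> = sets borel" and total: "emeasure \<nu> UNIV = 1"
    and mom: "\<And>l. (LINT \<zeta>|\<nu>. cnj \<zeta> ^ l) = \<tau> (adj a ^ l)"
    using \<nu> unfolding spectral_distribution_def by (auto dest: spec [of _ 0])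
  have space: "space \<nu> = UNIV" using sets_eq_imp_space_eq [OF sets] by simp
  interpret finite_measure \<nu> by (rule finite_measureI) (simp add: space total)
  have meas1: "measure \<nu> (space \<nu>) = 1" by (simp add: space measure_def total)
  have ae: "AE \<zeta> in \<nu>. cmod \<zeta> = 1"
    by (rule AE_I [of _ _ "- sphere 0 1"]) (use circle sets in auto)
  note borel = measurable_cong_sets [OF sets refl]
  define f where "f n \<zeta> = 2 * z ^ Suc n * cnj \<zeta> ^ Suc n" for n \<zeta>
  have f_meas: "f n \<in> borel_measurable \<nu>" for n
    unfolding borel f_def [abs_def] by (intro borel_measurable_continuous_onI continuous_intros)
  have f_norm: "AE \<zeta> in \<nu>. norm (f n \<zeta>) = 2 * cmod z ^ Suc n" for n
    using ae by eventually_elim (simp add: f_def norm_mult norm_power)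
  have f_int: "integrable \<nu> (f n)" for n
  proof (rule integrable_const_bound [OF _ f_meas])
    show "AE \<zeta> in \<nu>. norm (f n \<zeta>) \<le> 2 * cmod z ^ Suc n" using f_norm [of n] by eventually_elim simp
  qed
  have geo: "summable (\<lambda>n. 2 * cmod z ^ Suc n)"
    using z by (intro summable_mult) (simp add: summable_geometric)
  have ae_sum: "AE \<zeta> in \<nu>. summable (\<lambda>n. norm (f n \<zeta>))"
    using ae
  proof eventually_elim
    case (elim \<zeta>)
    then have "(\<lambda>n. norm (f n \<zeta>)) = (\<lambda>n. 2 * cmod z ^ Suc n)" by (simp add: f_def norm_mult norm_power)
    then show ?case using geo by simp
  qed
  have "(LINT \<zeta>|\<nu>. norm (f n \<zeta>)) = (LINT \<zeta>|\<nu>. 2 * cmod z ^ Suc n)" for n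
    by (rule integral_cong_AE) (use f_meas f_norm in auto)
  then have sum_int: "summable (\<lambda>n. LINT \<zeta>|\<nu>. norm (f n \<zeta>))" using geo by (simp add: meas1)
  have "(\<lambda>n. LINT \<zeta>|\<nu>. f n \<zeta>) sums (LINT \<zeta>|\<nu>. (\<Sum>n. f n \<zeta>))"
    by (rule sums_integral [OF f_int ae_sum sum_int])
  moreover have "(LINT \<zeta>|\<nu>. f n \<zeta>) = 2 * \<tau> (adj a ^ Suc n) * z ^ Suc n" for n
    using mom [of "Suc n"] unfolding f_def by (simp del: power_Suc add: mult_ac)
  moreover have "(LINT \<zeta>|\<nu>. (\<Sum>n. f n \<zeta>)) = herglotz_transform \<nu> z - 1"
  proof -
    have int: "integrable \<nu> (\<lambda>\<zeta>. \<Sum>n. f n \<zeta>)" by (rule integrable_suminf [OF f_int ae_sum sum_int])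
    have "herglotz_transform \<nu> z = (LINT \<zeta>|\<nu>. 1 + (\<Sum>n. f n \<zeta>))"
      unfolding herglotz_transform_def
    proof (rule integral_cong_AE)
      show "(\<lambda>\<zeta>. (\<zeta> + z) / (\<zeta> - z)) \<in> borel_measurable \<nu>" unfolding borel by measurable
      show "(\<lambda>\<zeta>. 1 + (\<Sum>n. f n \<zeta>)) \<in> borel_measurable \<nu>" using int by (intro borel_measurable_add) auto
      show "AE \<zeta> in \<nu>. (\<zeta> + z) / (\<zeta> - z) = 1 + (\<Sum>n. f n \<zeta>)"
        using ae
      proof eventually_elim
        case (elim \<zeta>)
        define w where "w = z * cnj \<zeta>"
        have w: "cmod w < 1" using elim z by (simp add: w_def norm_mult)
        have zw: "z = w * \<zeta>" using elim complex_norm_square [of \<zeta>] by (simp add: w_def mult_ac)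
        have nz: "\<zeta> \<noteq> 0" "1 - w \<noteq> 0" using elim w by auto
        have "(\<lambda>n. 2 * w * w ^ n) sums (2 * w * (1 / (1 - w)))" by (intro sums_mult geometric_sums w)
        then have "(\<lambda>n. f n \<zeta>) sums (2 * w * (1 / (1 - w)))" by (simp add: f_def w_def power_mult_distrib mult_ac)
        then have "(\<Sum>n. f n \<zeta>) = 2 * w / (1 - w)" by (simp add: sums_iff)
        moreover have "(\<zeta> + z) / (\<zeta> - z) = (\<zeta> * (1 + w)) / (\<zeta> * (1 - w))" by (simp add: zw algebra_simps)
        moreover have "1 + 2 * w / (1 - w) = (1 + w) / (1 - w)" using nz(2) by (simp add: field_simps)
        ultimately show ?case using nz(1) by simp
      qed
    qed
    also have "\<dots> = 1 + (LINT \<zeta>|\<nu>. (\<Sum>n. f n \<zeta>))"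
      using int by (subst Bochner_Integration.integral_add) (simp_all add: meas1)
    finally show ?thesis by simp
  qed
  ultimately show ?thesis by simp
qed

theorem proposition2p3:
  fixes A :: "'h::complex_hilbert_space bop set"
    and \<tau> :: "'h bop \<Rightarrow> complex"
    and R S :: "'h bop"
    and U V :: "real \<Rightarrow> 'h bop"
    and \<nu> :: "real \<Rightarrow> complex measure"
    and H :: "real \<Rightarrow> complex \<Rightarrow> complex"
    and \<alpha> \<beta> :: real
  assumes "wstar_probability_space A \<tau>"
    and "R \<in> A" "symmetry R" "\<tau> R = complex_of_real \<alpha>"
    and "S \<in> A" "symmetry S" "\<tau> S = complex_of_real \<beta>"
    and "free_unitary_brownian_motion A \<tau> U"
    and "freely_independent \<tau> (U ` {0..}) {R, S}"
    and V: "\<And>t. V t = R * U t * S * adj (U t)"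
    and "\<And>t. t \<ge> 0 \<Longrightarrow> spectral_distribution \<tau> (V t) (\<nu> t)"
    and "\<And>t. t \<ge> 0 \<Longrightarrow> emeasure (\<nu> t) (- sphere 0 1) = 0"
    and H: "\<And>t z. H t z = herglotz_transform (\<nu> t) z"
  shows "\<forall>t\<ge>0. \<forall>z::complex. cmod z < 1 \<longrightarrow>
    (\<lambda>n. 2 * \<tau> (V t ^ Suc n) * z ^ Suc n) sums (H t z - 1) \<and>
    (\<exists>Ht Hz :: complex.
      ((\<lambda>s. H s z) has_vector_derivative Ht) (at t within {0..}) \<and>
      ((\<lambda>w. (H t w)\<^sup>2) has_field_derivative Hz) (at z) \<and>
      Ht + z / 2 * Hz =
        2 * z * (complex_of_real \<alpha> * z\<^sup>2 + 2 * complex_of_real \<beta> * z + complex_of_real \<alpha>)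
          * (complex_of_real \<beta> * z\<^sup>2 + 2 * complex_of_real \<alpha> * z + complex_of_real \<beta>) / (1 - z\<^sup>2) ^ 3)"
proof -
  interpret wstar_probability_space A \<tau> by (rule assms(1))
  obtain \<F> B where FB: "vn_filtration A \<F>" "free_brownian_motion \<tau> \<F> B"
    and sde: "\<And>t. t \<ge> 0 \<Longrightarrow> U t \<in> \<F> t \<and>
        (\<exists>I J. I \<in> A \<and> has_free_ito_integral \<tau> \<F> B (\<lambda>s. \<i> *\<^sub>C U s) t I \<and>
          (U has_integral J) {0..t} \<and> U t = 1 + I - (1 / 2) *\<^sub>R J)"
    using assms(8) unfolding free_unitary_brownian_motion_def by blast
  interpret free_unitary_brownian_symmetries A \<tau> \<F> B U R S
    using FB sde assms(2,3,5,6,8,9)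
    by unfold_locales (auto simp: free_unitary_brownian_motion_def)
  \<comment> \<open>Conjugation by the symmetry \<open>R\<close> turns \<open>V t\<close> into its
    adjoint, so the moments obtained from the Herglotz transform are those of \<open>V t\<close>
    itself.\<close>
  have adj_V: "\<tau> (adj (V t) ^ n) = \<tau> (V t ^ n)" if t: "0 \<le> t" for t n
  proof -
    have "adj (V t) ^ n = R * V t ^ n * R"
    proof (induction n)
      case (Suc n)
      have "adj (V t) = R * V t * R" by (simp add: V symmetry_inverse mult.assoc)
      with Suc show ?case by (simp add: mult.assoc symmetry_inverse)
    qed (simp add: symmetry_inverse)
    moreover have "V t \<in> A" using U_A [OF t] R_A S_A by (simp add: V)
    ultimately show ?thesis
      using tracial [of "R * V t ^ n" R] R_A by (simp add: symmetry_inverse flip: mult.assoc)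
  qed
  have sums: "(\<lambda>n. 2 * moment (Suc n) t * z ^ Suc n) sums (H t z - 1)" if "0 \<le> t" "cmod z < 1" for t z
    using herglotz_transform_sums [OF assms(11,12) that(2), of t] that adj_V [OF that(1)]
    unfolding H moment_def V by (simp del: power_Suc)
  show ?thesis
  proof (intro allI impI conjI)
    fix t :: real and z :: complex assume t: "t \<ge> 0" and z: "cmod z < 1"
    show "(\<lambda>n. 2 * \<tau> (V t ^ Suc n) * z ^ Suc n) sums (H t z - 1)"
      using sums [OF t z] unfolding moment_def V .
    show "\<exists>Ht Hz :: complex.
      ((\<lambda>s. H s z) has_vector_derivative Ht) (at t within {0..}) \<and>
      ((\<lambda>w. (H t w)\<^sup>2) has_field_derivative Hz) (at z) \<and>
      Ht + z / 2 * Hz =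
        2 * z * (complex_of_real \<alpha> * z\<^sup>2 + 2 * complex_of_real \<beta> * z + complex_of_real \<alpha>)
          * (complex_of_real \<beta> * z\<^sup>2 + 2 * complex_of_real \<alpha> * z + complex_of_real \<beta>) / (1 - z\<^sup>2) ^ 3"
      using moment_bound moment_has_vector_derivative drift_eq drift_bound sums t z
      unfolding assms(4,7) by (rule moments_burgers)
  qed
qed

end
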